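(* Let $z_2>z_1>0$ be real numbers, let $m\in\mathbb{N}$, and let $p,p^{*},q,q^{*}$ and $\alpha_i,p_i$ ($1\le i\le m$) be real numbers with $\alpha_i>z_1^2$ for all $i$ and $p^{*}-p=q^{*}-q=:2c$. Let $$h(z)=(z_1-z)^{p}(z_1+z)^{p^{*}}(z_2-z)^{q}(z_2+z)^{q^{*}}\prod_{i=1}^{m}(\alpha_i-z^2)^{p_i},$$ $$f(z)=\operatorname{Log}(z_1-z)+\operatorname{Log}(z_2-z)-\operatorname{Log}(z_1+z)-\operatorname{Log}(z_2+z),$$ and define polynomials $H_n(s)$ by $\sum_{n\ge0}H_n(s)\frac{z^n}{n!}=h(z)e^{sf(z)}$. Let $T>0$ and $\zeta:[0,T)\to\mathbb{C}$ be the number and the function, depending only on $z_1,z_2$, defined in the context. For $x\in(0,T)$ and $\epsilon>0$ let $N_{n,\epsilon}(x)$ be the number of zeros $t$ of $H_n(c+int)$ in the interval $(x,x+\epsilon)$. Then for every $x\in(0,T)$, $$\lim_{\epsilon\to0^{+}}\frac1\epsilon\lim_{n\to\infty}\frac{N_{n,\epsilon}(x)}{n}=\frac1\pi\ln\left|\frac{(z_1+\zeta(x))(z_2+\zeta(x))}{(z_1-\zeta(x))(z_2-\zeta(x))}\right|.$$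
   Context: $\operatorname{Log}$ is the principal logarithm, and real powers and square roots are principal branches. In $H_n(c+int)$, $i$ is the imaginary unit and $t$ is real. Put $$T_1=\frac{z_2-z_1}{z_1+z_2},\qquad T_2=\frac{z_1+z_2}{4\sqrt{z_1z_2}},\qquad T=\begin{cases}T_1&\text{if } z_1^2-6z_1z_2+z_2^2\ge0,\\ T_2&\text{if } z_1^2-6z_1z_2+z_2^2<0.\end{cases}$$ The function $\zeta$ is $$\zeta(t)=\frac{z_1+z_2}{2}\left(it-\sqrt{T_1^2-t^2}+\sqrt{1-2t^2-2it\sqrt{T_1^2-t^2}}\right)\quad\text{for }0\le t<T_1,$$ and, when $T=T_2$, $$\zeta(t)=\frac{z_1+z_2}{2}\left(it+i\sqrt{t^2-T_1^2}+\sqrt{1-2t^2-2t\sqrt{t^2-T_1^2}}\right)\quad\text{for }T_1\le t\le T_2.$$ *)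

theory Defs
  imports "HOL-Complex_Analysis.Complex_Analysis"
begin

definition T1 :: "real \<Rightarrow> real \<Rightarrow> real" where
  "T1 z1 z2 = (z2 - z1) / (z1 + z2)"

definition T2 :: "real \<Rightarrow> real \<Rightarrow> real" where
  "T2 z1 z2 = (z1 + z2) / (4 * sqrt (z1 * z2))"

definition T_end :: "real \<Rightarrow> real \<Rightarrow> real" where
  "T_end z1 z2 = (if z1\<^sup>2 - 6 * z1 * z2 + z2\<^sup>2 \<ge> 0 then T1 z1 z2 else T2 z1 z2)"

(* Only the values on {0..<T_end z1 z2} are meaningful. In particular the second branch
   is relevant only if T_end z1 z2 = T2 z1 z2. *)
definition zeta :: "real \<Rightarrow> real \<Rightarrow> real \<Rightarrow> complex" where
  "zeta z1 z2 t =
     (if t < T1 z1 z2 then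
        of_real ((z1 + z2) / 2) *
          (\<i> * of_real t - of_real (sqrt ((T1 z1 z2)\<^sup>2 - t\<^sup>2))
           + csqrt (1 - 2 * (of_real t)\<^sup>2
                    - 2 * \<i> * of_real t * of_real (sqrt ((T1 z1 z2)\<^sup>2 - t\<^sup>2))))
      else
        of_real ((z1 + z2) / 2) *
          (\<i> * of_real t + \<i> * of_real (sqrt (t\<^sup>2 - (T1 z1 z2)\<^sup>2))
           + csqrt (1 - 2 * (of_real t)\<^sup>2
                    - 2 * of_real t * of_real (sqrt (t\<^sup>2 - (T1 z1 z2)\<^sup>2)))))"

definition h_fun ::
  "real \<Rightarrow> real \<Rightarrow> real \<Rightarrow> real \<Rightarrow> real \<Rightarrow> real \<Rightarrow> nat \<Rightarrow> (nat \<Rightarrow> real) \<Rightarrow> (nat \<Rightarrow> real)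
     \<Rightarrow> complex \<Rightarrow> complex" where
  "h_fun z1 z2 p p' q q' m \<alpha> r z =
     (of_real z1 - z) powr of_real p * (of_real z1 + z) powr of_real p' *
     (of_real z2 - z) powr of_real q * (of_real z2 + z) powr of_real q' *
     (\<Prod>i=1..m. (of_real (\<alpha> i) - z\<^sup>2) powr of_real (r i))"

definition f_fun :: "real \<Rightarrow> real \<Rightarrow> complex \<Rightarrow> complex" where
  "f_fun z1 z2 z =
     Ln (of_real z1 - z) + Ln (of_real z2 - z) - Ln (of_real z1 + z) - Ln (of_real z2 + z)"

definition gen_polys ::
  "(complex \<Rightarrow> complex) \<Rightarrow> (complex \<Rightarrow> complex) \<Rightarrow> (nat \<Rightarrow> complex poly) \<Rightarrow> bool" where
  "gen_polys h f H \<longleftrightarrow>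
     (\<forall>s. (\<lambda>z. h z * exp (s * f z)) has_fps_expansion Abs_fps (\<lambda>n. poly (H n) s / fact n))"

(* Distinct zeros. For h_fun and f_fun the polynomial H n has degree n, since h(0) and f'(0) are
   nonzero, so the set is finite when n > 0. *)
definition zero_count :: "(nat \<Rightarrow> complex poly) \<Rightarrow> real \<Rightarrow> nat \<Rightarrow> real \<Rightarrow> real \<Rightarrow> nat" where
  "zero_count H c n \<epsilon> x =
     card {t \<in> {x<..<x + \<epsilon>}. poly (H n) (of_real c + \<i> * of_nat n * of_real t) = 0}"

text \<open>The generating function determines the polynomials, and such polynomials exist.\<close>

lemma gen_polys_unique:
  assumes "gen_polys h f H" "gen_polys h f H'"
  shows "H = H'"
proof (rule ext)
  fix n
  have "poly (H n) s = poly (H' n) s" for s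
  proof -
    have "Abs_fps (\<lambda>n. poly (H n) s / fact n) = Abs_fps (\<lambda>n. poly (H' n) s / fact n)"
      using assms unfolding gen_polys_def by (blast intro: fps_expansion_unique_complex)
    hence "Abs_fps (\<lambda>n. poly (H n) s / fact n) $ n = Abs_fps (\<lambda>n. poly (H' n) s / fact n) $ n"
      by simp
    thus ?thesis by simp
  qed
  thus "H n = H' n" using poly_eq_poly_eq_iff by blast
qed

lemma gen_polys_exist:
  assumes "h analytic_on {0}" "f analytic_on {0}" "f 0 = 0"
  shows "\<exists>H. gen_polys h f H"
proof -
  obtain G where G: "h has_fps_expansion G"
    using analytic_at_imp_has_fps_expansion_0[OF assms(1)] by blast
  obtain F where F: "f has_fps_expansion F"
    using analytic_at_imp_has_fps_expansion_0[OF assms(2)] by blast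
  have F0: "F $ 0 = 0"
    using has_fps_expansion_imp_0_eq_fps_nth_0[OF F] assms(3) by simp
  define H where "H = (\<lambda>n. \<Sum>i=0..n. \<Sum>k=0..n - i.
    monom (fact n * (G $ i) * ((F ^ k) $ (n - i)) / fact k) k)"
  have "(\<lambda>z. h z * exp (s * f z)) has_fps_expansion Abs_fps (\<lambda>n. poly (H n) s / fact n)" for s
  proof -
    have "((\<lambda>z. exp (s * z)) \<circ> f) has_fps_expansion (fps_exp s oo F)"
      by (intro has_fps_expansion_compose has_fps_expansion_exp F F0)
    hence "(\<lambda>z. h z * exp (s * f z)) has_fps_expansion G * (fps_exp s oo F)"
      using has_fps_expansion_mult[OF G] by (simp add: o_def)
    moreover have "G * (fps_exp s oo F) = Abs_fps (\<lambda>n. poly (H n) s / fact n)"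
      by (rule fps_ext)
         (simp add: H_def fps_mult_nth fps_compose_nth poly_sum poly_monom sum_distrib_left
            sum_divide_distrib field_simps)
    ultimately show ?thesis by simp
  qed
  thus ?thesis unfolding gen_polys_def by blast
qed

lemma gen_polys_exist_h_f:
  assumes "0 < z1" "z1 < z2" "\<forall>i\<in>{1..m}. \<alpha> i > z1\<^sup>2"
  shows "\<exists>H. gen_polys (h_fun z1 z2 p p' q q' m \<alpha> r) (f_fun z1 z2) H"
proof (rule gen_polys_exist)
  have "\<alpha> i > 0" if "i \<in> {1..m}" for i
    using assms that by (meson le_less_trans zero_le_power2)
  hence pos: "\<not> \<alpha> i \<le> 0" if "Suc 0 \<le> i" "i \<le> m" for i
    using that by force
  show "h_fun z1 z2 p p' q q' m \<alpha> r analytic_on {0}"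
    unfolding h_fun_def using assms(1,2) pos
    by (intro analytic_intros) auto
  show "f_fun z1 z2 analytic_on {0}"
    unfolding f_fun_def using assms(1,2) by (intro analytic_intros) auto
  show "f_fun z1 z2 0 = 0"
    by (simp add: f_fun_def)
qed

end

(* Put G(z) = h(z) e^{c f(z)}. Since p* - p = q* - q = 2c, the function G satisfies
   G(-cnj z) = cnj (G z), while f(-cnj z) = -cnj (f z). Hence H_n(c + int) / n! is the n-th
   coefficient of G e^{intf}, and Cauchy's formula on a contour symmetric about the imaginary
   axis writes i^n H_n(c + int) / n! as the imaginary part of the integral of (G(z)/z) e^{n phi_t(z)}
   over its right half, where phi_t(z) = i t f(z) - Log z. The point zeta(t) is a saddle point of
   phi_t, and the curve u |-> zeta(u) is itself a contour of descent: by the saddle point equation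
   the derivative of phi_t(zeta(u)) with respect to u is (t/u - 1) zeta'(u)/zeta(u), so that
   Re phi_t increases along it up to u = t and decreases afterwards. (If t > T_1, the part of the
   curve with u > T_1 is a circular arc on which Re phi_t is constant; the contour then runs just
   inside the arc before zeta(t) and just outside it afterwards.) Laplace's method at zeta(t)
   shows that i^n H_n(c + i(nt + s)) / n! is asymptotic, for bounded s, to a positive factor times
   a sine wave in s of frequency |Re f(zeta(t))|. Thus a window of length M/n at t contains at least
   M |Re f(zeta(t))| / pi - 2 zeros, and averaging over t with Fatou's lemma bounds the number of
   zeros in every interval from below by the integral of this density. The density integrates
   to 1/2 over (0,T), and H_n has degree at most n with zeros t symmetric about 0, so nothing is
   left over and the lower bounds are sharp. *)
theory Submission
  imports Defs "HOL-Probability.Distributions" "HOL-Real_Asymp.Real_Asymp"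
begin

section \<open>Arguments and arc tangents\<close>

text \<open>The path of integration is never written down as a whole. On the star-shaped domain
  \<open>D\<close> every integrand has a primitive, so only end points matter: a part of the path
  below the saddle level is negligible as soon as its end points lie in one component of the
  sublevel set \<open>U t\<close>. Components are traced along the saddle curve itself, circles |z|
  = r and one radial segment, on which Re phi_t can be compared by monotonicity of arc tangents. The
  ends may slide along the imaginary axis, where the integrand contributes nothing to the imaginary
  part that is wanted. At t = T_1 < T two critical points coalesce and phi_t'' vanishes at zeta(t),
  so the local estimate omits this t; it is a null set in the averaging. The integral of the density
  is found from Theta(t) = - Im phi_t(zeta(t)) / pi. Since zeta(t) is critical, Theta' is the
  density; Theta tends to 0 where zeta -> z_1 and to 1/2 where zeta reaches the imaginary axis, on
  which Re f = 0.\<close>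

lemma arctan_add_pos:
  fixes u v :: real
  assumes "u + v > 0"
  shows "arctan u + arctan v = pi / 2 - arctan ((1 - u * v) / (u + v))"
proof -
  define S where "S = arctan u + arctan v"
  have "arctan u > arctan (- v)" using assms by (subst arctan_less_iff) simp
  hence S0: "S > 0" by (simp add: S_def arctan_minus)
  have S1: "S < pi" using arctan_ubound[of u] arctan_ubound[of v] by (simp add: S_def)
  define w where "w = 1 / (sqrt (1 + u\<^sup>2) * sqrt (1 + v\<^sup>2))"
  have w: "w \<noteq> 0" by (simp add: w_def add_nonneg_eq_0_iff)
  have "cos S = (1 - u * v) * w"
    by (simp add: S_def cos_add cos_arctan sin_arctan w_def diff_divide_distrib)
  moreover have "sin S = (u + v) * w"
    by (simp add: S_def sin_add cos_arctan sin_arctan w_def add_divide_distrib)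
  \<comment> \<open>The complementary angle pi / 2 - S stays in (-pi / 2, pi / 2), also when u v =
    1, where tan S has a pole.\<close>
  ultimately have "tan (pi / 2 - S) = (1 - u * v) / (u + v)"
    using w by (simp add: tan_def cos_diff sin_diff)
  hence "arctan ((1 - u * v) / (u + v)) = pi / 2 - S"
    using S0 S1 by (intro arctan_unique) auto
  thus ?thesis by (simp add: S_def)
qed

text \<open>With arctan (Re / Im) one formula for the argument serves the whole upper half-plane,
  including the imaginary axis, where arctan (Im / Re) breaks down.\<close>

lemma Im_Ln_upper:
  assumes "Im z > 0"
  shows "Im (Ln z) = pi / 2 - arctan (Re z / Im z)"
proof -
  define \<theta> where "\<theta> = pi / 2 - arctan (Re z / Im z)"
  have b: "0 < \<theta>" "\<theta> < pi"
    using arctan_ubound[of "Re z / Im z"] arctan_lbound[of "Re z / Im z"] by (auto simp: \<theta>_def)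
  have n: "z \<noteq> 0" using assms by auto
  have "sqrt (1 + (Re z / Im z)\<^sup>2) = cmod z / Im z"
    using assms by (intro real_sqrt_unique) (auto simp: cmod_power2 power_divide field_simps)
  hence "cos \<theta> = Re z / cmod z" "sin \<theta> = Im z / cmod z"
    using assms by (simp_all add: \<theta>_def cos_diff sin_diff cos_arctan sin_arctan)
  hence "z = of_real (cmod z) * exp (\<i> * of_real \<theta>)"
    using n by (intro complex_eqI) (auto simp: Re_exp Im_exp)
  hence "Arg z = \<theta>" using b n by (intro Arg_unique[of "cmod z"]) auto
  thus ?thesis using n by (simp add: Arg_eq_Im_Ln \<theta>_def)
qed

lemma Im_Ln_lower:
  assumes "Im z < 0"
  shows "Im (Ln z) = arctan (Re z / - Im z) - pi / 2"
proof -
  have "Im (Ln (cnj z)) = pi / 2 - arctan (Re z / - Im z)"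
    using Im_Ln_upper[of "cnj z"] assms by simp
  moreover have "Ln (cnj z) = cnj (Ln z)"
    using assms by (intro cnj_Ln[symmetric]) (auto simp: complex_nonpos_Reals_iff)
  ultimately show ?thesis by simp
qed

text \<open>The addition formula merges the two angles into one arc tangent from which Re z has
  disappeared. Two such terms make up Im f, so Re phi_t can be compared along circles and
  rays.\<close>

lemma Im_Ln_quotient:
  fixes a :: real
  assumes "a > 0" "Im z > 0"
  shows "Im (Ln (of_real a - z) - Ln (of_real a + z)) =
     - (pi / 2 + arctan (((cmod z)\<^sup>2 - a\<^sup>2) / (2 * a * Im z)))"
proof -
  have "Im (Ln (of_real a - z) - Ln (of_real a + z)) =
     arctan ((a - Re z) / Im z) + arctan ((a + Re z) / Im z) - pi"
    using assms by (simp add: Im_Ln_upper Im_Ln_lower)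
  also have "arctan ((a - Re z) / Im z) + arctan ((a + Re z) / Im z) =
     pi / 2 - arctan ((1 - ((a - Re z) / Im z) * ((a + Re z) / Im z)) /
        ((a - Re z) / Im z + (a + Re z) / Im z))"
    using assms by (intro arctan_add_pos) (simp flip: add_divide_distrib)
  also have "(1 - ((a - Re z) / Im z) * ((a + Re z) / Im z)) /
        ((a - Re z) / Im z + (a + Re z) / Im z) = ((cmod z)\<^sup>2 - a\<^sup>2) / (2 * a * Im z)"
    using assms by (simp add: cmod_power2 divide_simps) (simp add: power2_eq_square algebra_simps)
  finally show ?thesis by simp
qed

text \<open>At 0, which lies on the branch cut, |csqrt w| = sqrt |w| still gives continuity. The
  radicand in \<open>zeta\<close> can tend to 0 at T.\<close>

lemma tendsto_csqrt:
  assumes "(g \<longlongrightarrow> w) F" "w \<notin> \<real>\<^sub>\<le>\<^sub>0 \<or> w = 0"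
  shows "((\<lambda>x. csqrt (g x)) \<longlongrightarrow> csqrt w) F"
proof (cases "w = 0")
  case True
  have "((\<lambda>x. sqrt (cmod (g x))) \<longlongrightarrow> sqrt (cmod 0)) F"
    using assms(1) unfolding True by (intro tendsto_intros)
  hence "((\<lambda>x. cmod (csqrt (g x))) \<longlongrightarrow> 0) F" by simp
  thus ?thesis unfolding True by (auto intro: tendsto_norm_zero_cancel)
next
  case False
  thus ?thesis using assms continuous_at_csqrt[of w] isCont_tendsto_compose by blast
qed

lemma Re_complex_of_real_mult: "Re (of_real a * z) = a * Re z"
  by simp

lemma has_real_derivative_arctan_divide:
  fixes a h :: real
  assumes "h > 0"
  shows "((\<lambda>h. arctan (a / h)) has_real_derivative - a / (h\<^sup>2 + a\<^sup>2)) (at h)"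
proof -
  have "h\<^sup>2 + a\<^sup>2 \<noteq> 0" using assms by (simp add: add_pos_nonneg less_imp_neq[symmetric])
  thus ?thesis using assms
    by (auto intro!: derivative_eq_intros simp: divide_simps power2_eq_square)
qed

text \<open>Only the factor h^2 - a b changes sign, so the monotonicity in h switches once, at h =
  sqrt (a b). With h = Im z this governs \<open>gam\<close> on a circle |z| = r.\<close>

lemma has_real_derivative_arctan_diff:
  fixes a b h :: real
  assumes "h > 0"
  shows "((\<lambda>h. arctan (a / h) - arctan (b / h)) has_real_derivative
     (b - a) * (h\<^sup>2 - a * b) / ((h\<^sup>2 + a\<^sup>2) * (h\<^sup>2 + b\<^sup>2))) (at h)"
proof -
  have "h\<^sup>2 + a\<^sup>2 \<noteq> 0" "h\<^sup>2 + b\<^sup>2 \<noteq> 0" using assms by (simp_all add: add_pos_nonneg less_imp_neq[symmetric])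
  hence "- a / (h\<^sup>2 + a\<^sup>2) - - b / (h\<^sup>2 + b\<^sup>2) = (b - a) * (h\<^sup>2 - a * b) / ((h\<^sup>2 + a\<^sup>2) * (h\<^sup>2 + b\<^sup>2))"
    by (simp add: divide_simps) (simp add: power2_eq_square algebra_simps)
  thus ?thesis 
    using DERIV_diff[OF has_real_derivative_arctan_divide[OF assms, of a] has_real_derivative_arctan_divide[OF assms, of b]]
    by simp
qed

lemma arctan_diff_decreasing:
  fixes a b h1 h2 :: real
  assumes "b \<le> a" "0 < h1" "h1 \<le> h2" "a * b \<le> h1\<^sup>2"
  shows "arctan (a / h2) - arctan (b / h2) \<le> arctan (a / h1) - arctan (b / h1)"
proof (rule DERIV_nonpos_imp_nonincreasing[OF assms(3)])
  fix h assume h: "h1 \<le> h" "h \<le> h2"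
  have "h1\<^sup>2 \<le> h\<^sup>2" using assms h by (simp add: power_mono)
  hence "(b - a) * (h\<^sup>2 - a * b) / ((h\<^sup>2 + a\<^sup>2) * (h\<^sup>2 + b\<^sup>2)) \<le> 0"
    using assms by (intro divide_nonpos_nonneg mult_nonpos_nonneg) auto
  thus "\<exists>y. ((\<lambda>h. arctan (a / h) - arctan (b / h)) has_real_derivative y) (at h) \<and> y \<le> 0"
    using has_real_derivative_arctan_diff[of h a b] assms h by auto
qed

lemma arctan_diff_quasiconvex:
  fixes a b h1 h h2 :: real
  assumes "a \<le> b" "0 \<le> a" "0 < h1" "h1 \<le> h" "h \<le> h2"
  shows "arctan (a / h) - arctan (b / h) \<le>
    max (arctan (a / h1) - arctan (b / h1)) (arctan (a / h2) - arctan (b / h2))"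
proof (cases "h\<^sup>2 \<le> a * b")
  case True
  have "arctan (a / h) - arctan (b / h) \<le> arctan (a / h1) - arctan (b / h1)"
  proof (rule DERIV_nonpos_imp_nonincreasing[OF assms(4)])
    fix x assume x: "h1 \<le> x" "x \<le> h"
    have "x\<^sup>2 \<le> h\<^sup>2" using assms x by (simp add: power_mono)
    hence "(b - a) * (x\<^sup>2 - a * b) / ((x\<^sup>2 + a\<^sup>2) * (x\<^sup>2 + b\<^sup>2)) \<le> 0"
      using assms True by (intro divide_nonpos_nonneg mult_nonneg_nonpos) auto
    thus "\<exists>y. ((\<lambda>h. arctan (a / h) - arctan (b / h)) has_real_derivative y) (at x) \<and> y \<le> 0"
      using has_real_derivative_arctan_diff[of x a b] assms x by auto
  qed
  thus ?thesis by simp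
next
  case False
  have "arctan (a / h) - arctan (b / h) \<le> arctan (a / h2) - arctan (b / h2)"
  proof (rule DERIV_nonneg_imp_nondecreasing[OF assms(5)])
    fix x assume x: "h \<le> x" "x \<le> h2"
    have "h\<^sup>2 \<le> x\<^sup>2" using assms x by (simp add: power_mono)
    hence "(b - a) * (x\<^sup>2 - a * b) / ((x\<^sup>2 + a\<^sup>2) * (x\<^sup>2 + b\<^sup>2)) \<ge> 0"
      using assms False by (intro divide_nonneg_nonneg mult_nonneg_nonneg) auto
    thus "\<exists>y. ((\<lambda>h. arctan (a / h) - arctan (b / h)) has_real_derivative y) (at x) \<and> 0 \<le> y"
      using has_real_derivative_arctan_diff[of x a b] assms x by auto
  qed
  thus ?thesis by simp
qed

lemma connected_component_curve:
  assumes "continuous_on S g" "connected S" "\<And>x. x \<in> S \<Longrightarrow> g x \<in> U" "a \<in> S" "b \<in> S"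
  shows "connected_component U (g a) (g b)"
  unfolding connected_component_def
  using assms connected_continuous_image[OF assms(1,2)] by (intro exI[of _ "g ` S"]) auto

lemma less_of_neg_deriv:
  fixes f :: "real \<Rightarrow> real"
  assumes "a < b"
    and "\<And>x. \<lbrakk>a \<le> x; x \<le> b\<rbrakk> \<Longrightarrow> isCont f x"
    and "\<And>x. \<lbrakk>a < x; x < b\<rbrakk> \<Longrightarrow> \<exists>y. (f has_real_derivative y) (at x) \<and> y < 0"
  shows "f b < f a"
  using DERIV_neg_imp_decreasing_open[OF assms(1)] assms(2,3)
  by (simp add: continuous_at_imp_continuous_on)

lemma Im_complex_of_real_mult: "Im (of_real a * z) = a * Im z"
  by simp

lemma Arg_first_quadrant:
  assumes "Re z > 0" "Im z > 0" shows "0 < Arg z" "Arg z < pi / 2"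
proof -
  have "z \<noteq> 0" using assms by auto
  hence "Arg z = pi / 2 - arctan (Re z / Im z)" using Im_Ln_upper[OF assms(2)] by (simp add: Arg_eq_Im_Ln)
  moreover have "0 < arctan (Re z / Im z)" using assms by (simp add: zero_less_arctan_iff)
  ultimately show "0 < Arg z" "Arg z < pi / 2" using arctan_ubound[of "Re z / Im z"] by auto
qed

section \<open>Laplace's method on a segment\<close>

lemma gaussian_integral_pos:
  fixes k :: real assumes "k > 0"
  shows "integrable lborel (\<lambda>v. exp (- k * v\<^sup>2))" "0 < (\<integral>v. exp (- k * v\<^sup>2) \<partial>lborel)"
proof -
  define s where "s = 1 / sqrt (2 * k)"
  have s: "s > 0" "2 * s\<^sup>2 = 1 / k" using assms by (auto simp: s_def power_divide)
  define C where "C = sqrt (2 * pi * s\<^sup>2)"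
  have C: "C > 0" using s by (simp add: C_def)
  have eq: "exp (- k * v\<^sup>2) = C * normal_density 0 s v" for v
    using C s assms by (simp add: normal_density_def C_def field_simps)
  show "integrable lborel (\<lambda>v. exp (- k * v\<^sup>2))" unfolding eq using s by simp
  show "0 < (\<integral>v. exp (- k * v\<^sup>2) \<partial>lborel)" unfolding eq using s C by simp
qed

text \<open>Near its zero, phi' is linear up to eta |z - zeta|; the mean value inequality on the
  disc of radius |z - zeta| integrates this to a quadratic error for phi.\<close>

lemma second_order_expansion:
  fixes \<phi> \<phi>' :: "complex \<Rightarrow> complex"
  assumes "open D" "\<zeta> \<in> D" "\<And>z. z \<in> D \<Longrightarrow> (\<phi> has_field_derivative \<phi>' z) (at z)"
    and "\<phi>' \<zeta> = 0" "(\<phi>' has_field_derivative \<mu>) (at \<zeta>)" "\<eta> > 0"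
  obtains \<delta> where "\<delta> > 0" "ball \<zeta> \<delta> \<subseteq> D"
    "\<And>z. cmod (z - \<zeta>) < \<delta> \<Longrightarrow> cmod (\<phi> z - \<phi> \<zeta> - \<mu> / 2 * (z - \<zeta>)\<^sup>2) \<le> \<eta> * (cmod (z - \<zeta>))\<^sup>2"
proof -
  obtain r where r: "r > 0" "ball \<zeta> r \<subseteq> D" using assms(1,2) openE by blast
  have "\<forall>e>0. \<exists>d>0. \<forall>y. cmod (y - \<zeta>) < d \<longrightarrow> cmod (\<phi>' y - \<phi>' \<zeta> - \<mu> * (y - \<zeta>)) \<le> e * cmod (y - \<zeta>)"
    using assms(5) unfolding has_field_derivative_def has_derivative_at_alt by auto
  then obtain d where d: "d > 0" "\<And>y. cmod (y - \<zeta>) < d \<Longrightarrow> cmod (\<phi>' y - \<mu> * (y - \<zeta>)) \<le> \<eta> * cmod (y - \<zeta>)"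
    using assms(4,6) by force
  define \<delta> where "\<delta> = min r d"
  show thesis
  proof (rule that)
    show "\<delta> > 0" "ball \<zeta> \<delta> \<subseteq> D" using r d by (auto simp: \<delta>_def)
    fix z assume z: "cmod (z - \<zeta>) < \<delta>"
    define g where "g w = \<phi> w - \<phi> \<zeta> - \<mu> / 2 * (w - \<zeta>)\<^sup>2" for w
    have "cmod (g z - g \<zeta>) \<le> (\<eta> * cmod (z - \<zeta>)) * cmod (z - \<zeta>)"
    proof (rule field_differentiable_bound)
      show "convex (cball \<zeta> (cmod (z - \<zeta>)))" by simp
      fix w assume "w \<in> cball \<zeta> (cmod (z - \<zeta>))"
      hence w: "cmod (w - \<zeta>) \<le> cmod (z - \<zeta>)" by (simp add: dist_norm norm_minus_commute)
      hence wD: "w \<in> D" using z r by (auto simp: \<delta>_def dist_norm norm_minus_commute)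
      show "(g has_field_derivative \<phi>' w - \<mu> * (w - \<zeta>)) (at w within cball \<zeta> (cmod (z - \<zeta>)))"
        unfolding g_def using assms(3)[OF wD]
        by (auto intro!: derivative_eq_intros intro: has_field_derivative_at_within)
      have "cmod (\<phi>' w - \<mu> * (w - \<zeta>)) \<le> \<eta> * cmod (w - \<zeta>)" using d w z by (simp add: \<delta>_def)
      also have "\<dots> \<le> \<eta> * cmod (z - \<zeta>)" using w assms(6) by simp
      finally show "cmod (\<phi>' w - \<mu> * (w - \<zeta>)) \<le> \<eta> * cmod (z - \<zeta>)" .
    qed (auto simp: dist_norm norm_minus_commute)
    thus "cmod (\<phi> z - \<phi> \<zeta> - \<mu> / 2 * (z - \<zeta>)\<^sup>2) \<le> \<eta> * (cmod (z - \<zeta>))\<^sup>2"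
      by (simp add: g_def power2_eq_square mult_ac)
  qed
qed

text \<open>Stretching the segment by sqrt n puts the integrals for all n on the same real line,
  where dominated convergence applies.\<close>

lemma contour_integral_segment_scaled:
  fixes g :: "complex \<Rightarrow> complex"
  assumes "\<epsilon> > 0" "n > 0" "continuous_on (closed_segment (\<zeta> - of_real \<epsilon> * d) (\<zeta> + of_real \<epsilon> * d)) g"
  defines "I \<equiv> \<lambda>v. indicator {- \<epsilon> * sqrt n..\<epsilon> * sqrt n} v *\<^sub>R g (\<zeta> + of_real (v / sqrt n) * d)"
  shows "I \<in> borel_measurable borel"
    and "of_real (sqrt n) * contour_integral (linepath (\<zeta> - of_real \<epsilon> * d) (\<zeta> + of_real \<epsilon> * d)) g = d * (\<integral>v. I v \<partial>lborel)"
proof -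
  define a b where "a = \<zeta> - of_real \<epsilon> * d" and "b = \<zeta> + of_real \<epsilon> * d"
  \<comment> \<open>c is the slope of the substitution x = 1/2 + c v, which carries
    [- eps sqrt n, eps sqrt n] onto [0, 1].\<close>
  define c where "c = 1 / (2 * \<epsilon> * sqrt n)"
  have c: "c > 0" using assms by (simp add: c_def)
  define F where "F x = g (linepath a b x)" for x
  have cont: "continuous_on {0..1} F"
    unfolding F_def using assms(3)
    by (intro continuous_on_compose2[OF assms(3)] continuous_on_linepath)
       (auto simp: linepath_in_path a_def b_def)
  have lp: "linepath a b (1 / 2 + c * v) = \<zeta> + of_real (v / sqrt n) * d" for v
  proof -
    have "linepath a b (1 / 2 + c * v) = \<zeta> + of_real (2 * c * \<epsilon> * v) * d"
      by (simp add: linepath_def a_def b_def scaleR_conv_of_real algebra_simps)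
    also have "2 * c * \<epsilon> * v = v / sqrt n" using assms(1,2) by (simp add: c_def)
    finally show ?thesis .
  qed
  have ind: "1 / 2 + c * v \<in> {0..1} \<longleftrightarrow> v \<in> {- \<epsilon> * sqrt n..\<epsilon> * sqrt n}" for v
    using assms(1,2) by (auto simp: c_def field_simps)
  have I: "I v = indicator {0..1} (1 / 2 + c * v) *\<^sub>R F (1 / 2 + c * v)" for v
    unfolding I_def F_def lp using ind[of v] by (auto simp: indicator_def)
  have meas: "(\<lambda>x. indicator {0..1} x *\<^sub>R F x) \<in> borel_measurable borel"
    using cont by (intro borel_measurable_continuous_on_indicator) auto
  have "(\<lambda>v. (\<lambda>x. indicator {0..1} x *\<^sub>R F x) (1 / 2 + c * v)) \<in> borel_measurable borel"
    by (rule measurable_compose[OF _ meas]) simp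
  thus "I \<in> borel_measurable borel" unfolding I[abs_def] by simp
  have "contour_integral (linepath a b) g = (b - a) * integral {0..1} F"
  proof -
    have "F integrable_on {0..1}" using cont integrable_continuous_real by blast
    hence "((\<lambda>x. F x * (b - a)) has_integral integral {0..1} F * (b - a)) {0..1}"
      by (intro has_integral_mult_left) (rule integrable_integral)
    hence "(g has_contour_integral integral {0..1} F * (b - a)) (linepath a b)"
      by (simp add: has_contour_integral_linepath F_def)
    thus ?thesis by (simp add: contour_integral_unique mult.commute)
  qed
  also have "integral {0..1} F = (\<integral>x. indicator {0..1} x *\<^sub>R F x \<partial>lborel)"
    using set_borel_integral_eq_integral(2)[OF borel_integrable_atLeastAtMost'[OF cont]]
    by (simp add: set_lebesgue_integral_def)
  also have "\<dots> = c *\<^sub>R (\<integral>v. I v \<partial>lborel)"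
    using lborel_integral_real_affine[of c "\<lambda>x. indicator {0..1} x *\<^sub>R F x" "1/2"] c unfolding I[abs_def] by simp
  finally have "of_real (sqrt n) * contour_integral (linepath a b) g = 
      of_real (sqrt n * (2 * \<epsilon>) * c) * d * (\<integral>v. I v \<partial>lborel)"
    by (simp add: scaleR_conv_of_real a_def b_def)
  also have "sqrt n * (2 * \<epsilon>) * c = 1" using assms(1,2) by (simp add: c_def)
  finally show "of_real (sqrt n) * contour_integral (linepath (\<zeta> - of_real \<epsilon> * d) (\<zeta> + of_real \<epsilon> * d)) g = d * (\<integral>v. I v \<partial>lborel)"
    by (simp add: a_def b_def)
qed

text \<open>At distance |v d| / sqrt n from the saddle the factor n cancels the square exactly, and
  the remainder is eta |v d|^2 with eta arbitrary.\<close>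

lemma tendsto_scaled_exponent:
  fixes \<phi> \<phi>' :: "complex \<Rightarrow> complex"
  assumes "open D" "\<zeta> \<in> D" "\<And>z. z \<in> D \<Longrightarrow> (\<phi> has_field_derivative \<phi>' z) (at z)"
    and "\<phi>' \<zeta> = 0" "(\<phi>' has_field_derivative \<mu>) (at \<zeta>)"
  shows "(\<lambda>n. of_nat n * (\<phi> (\<zeta> + of_real (v / sqrt (real n)) * d) - \<phi> \<zeta>)) \<longlonglongrightarrow> \<mu> / 2 * (of_real v * d)\<^sup>2"
proof (rule LIMSEQ_I)
  fix e :: real assume e: "e > 0"
  \<comment> \<open>Chosen so that eta |v d|^2 <= e / 2; the summand 1 covers v d = 0.\<close>
  define \<eta> where "\<eta> = e / (2 * ((cmod (of_real v * d))\<^sup>2 + 1))"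
  have \<eta>: "\<eta> > 0" using e by (simp add: \<eta>_def add_nonneg_pos)
  obtain \<delta> where \<delta>: "\<delta> > 0" 
    "\<And>z. cmod (z - \<zeta>) < \<delta> \<Longrightarrow> cmod (\<phi> z - \<phi> \<zeta> - \<mu> / 2 * (z - \<zeta>)\<^sup>2) \<le> \<eta> * (cmod (z - \<zeta>))\<^sup>2"
    using second_order_expansion[OF assms \<eta>] by metis
  have "(\<lambda>n. cmod (of_real (v / sqrt (real n)) * d)) \<longlonglongrightarrow> cmod (of_real 0 * d)"
    by (intro tendsto_intros) real_asymp
  hence "\<forall>\<^sub>F n in sequentially. cmod (of_real (v / sqrt (real n)) * d) < \<delta>"
    using \<delta>(1) by (intro order_tendstoD) auto
  with eventually_gt_at_top[of 0]
  have "\<forall>\<^sub>F n in sequentially. cmod (of_nat n * (\<phi> (\<zeta> + of_real (v / sqrt (real n)) * d) - \<phi> \<zeta>) - \<mu> / 2 * (of_real v * d)\<^sup>2) < e"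
  proof eventually_elim
    case (elim n)
    define z where "z = \<zeta> + of_real (v / sqrt (real n)) * d"
    have zz: "z - \<zeta> = of_real (1 / sqrt (real n)) * (of_real v * d)" by (simp add: z_def)
    have sq: "(1 / sqrt (real n))\<^sup>2 = 1 / real n" using elim by (simp add: power_divide)
    have "(z - \<zeta>)\<^sup>2 = of_real ((1 / sqrt (real n))\<^sup>2) * (of_real v * d)\<^sup>2"
      unfolding zz power_mult_distrib of_real_power ..
    hence z2: "of_nat n * (z - \<zeta>)\<^sup>2 = (of_real v * d)\<^sup>2" unfolding sq using elim by simp
    have "(cmod (z - \<zeta>))\<^sup>2 = (1 / sqrt (real n))\<^sup>2 * (cmod (of_real v * d))\<^sup>2"
      unfolding zz norm_mult norm_of_real power_mult_distrib power2_abs by simp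
    hence c2: "real n * (cmod (z - \<zeta>))\<^sup>2 = (cmod (of_real v * d))\<^sup>2" unfolding sq using elim by simp
    have "of_nat n * (\<phi> z - \<phi> \<zeta>) - \<mu> / 2 * (of_real v * d)\<^sup>2 = of_nat n * (\<phi> z - \<phi> \<zeta> - \<mu> / 2 * (z - \<zeta>)\<^sup>2)"
      unfolding z2[symmetric] by (simp add: algebra_simps)
    hence "cmod (of_nat n * (\<phi> z - \<phi> \<zeta>) - \<mu> / 2 * (of_real v * d)\<^sup>2) = real n * cmod (\<phi> z - \<phi> \<zeta> - \<mu> / 2 * (z - \<zeta>)\<^sup>2)"
      by (simp add: norm_mult)
    also have "\<dots> \<le> real n * (\<eta> * (cmod (z - \<zeta>))\<^sup>2)"
      using elim by (intro mult_left_mono \<delta>(2)) (auto simp: z_def)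
    also have "\<dots> = \<eta> * (cmod (of_real v * d))\<^sup>2" unfolding c2[symmetric] by simp
    also have "\<dots> \<le> \<eta> * ((cmod (of_real v * d))\<^sup>2 + 1)" using \<eta> by (intro mult_left_mono) auto
    also have "\<dots> = e / 2" unfolding \<eta>_def
      using add_nonneg_pos[of "(cmod (of_real v * d))\<^sup>2" 1] by (simp add: divide_simps)
    also have "\<dots> < e" using e by simp
    finally show ?case by (simp add: z_def)
  qed
  thus "\<exists>no. \<forall>n\<ge>no. cmod (of_nat n * (\<phi> (\<zeta> + of_real (v / sqrt (real n)) * d) - \<phi> \<zeta>) - \<mu> / 2 * (of_real v * d)\<^sup>2) < e"
    by (simp add: eventually_sequentially)
qed

lemma quadratic_decay:
  fixes \<phi> \<phi>' :: "complex \<Rightarrow> complex"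
  assumes "open D" "\<zeta> \<in> D" "\<And>z. z \<in> D \<Longrightarrow> (\<phi> has_field_derivative \<phi>' z) (at z)"
    and "\<phi>' \<zeta> = 0" "(\<phi>' has_field_derivative \<mu>) (at \<zeta>)" 
    and "\<mu> / 2 * d\<^sup>2 = - of_real k" "k > 0"
  shows "\<forall>\<^sub>F \<epsilon> in at_right 0. \<forall>y. \<bar>y\<bar> \<le> \<epsilon> \<longrightarrow>
    \<zeta> + of_real y * d \<in> D \<and> Re (\<phi> (\<zeta> + of_real y * d)) - Re (\<phi> \<zeta>) \<le> - (k / 2) * y\<^sup>2"
proof -
  have d: "cmod d > 0" using assms by auto
  \<comment> \<open>The error may consume half of the quadratic term k y^2, so the rate k / 2
    survives.\<close>
  define \<eta> where "\<eta> = k / (2 * (cmod d)\<^sup>2)"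
  have \<eta>: "\<eta> > 0" using d assms by (simp add: \<eta>_def)
  obtain \<delta> where \<delta>: "\<delta> > 0" "ball \<zeta> \<delta> \<subseteq> D"
    "\<And>z. cmod (z - \<zeta>) < \<delta> \<Longrightarrow> cmod (\<phi> z - \<phi> \<zeta> - \<mu> / 2 * (z - \<zeta>)\<^sup>2) \<le> \<eta> * (cmod (z - \<zeta>))\<^sup>2"
    using second_order_expansion[OF assms(1-5) \<eta>] by metis
  have "\<forall>\<^sub>F \<epsilon> in at_right 0. 0 < \<epsilon> \<and> \<epsilon> < \<delta> / cmod d"
    using eventually_at_right_real[of 0 "\<delta> / cmod d"] \<delta>(1) d by (auto elim: eventually_mono)
  thus ?thesis
  proof eventually_elim
    case (elim \<epsilon>)
    show ?case
    proof (intro allI impI)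
      fix y :: real assume y: "\<bar>y\<bar> \<le> \<epsilon>"
      define z where "z = \<zeta> + of_real y * d"
      have zz: "z - \<zeta> = of_real y * d" by (simp add: z_def)
      have c2: "(cmod (z - \<zeta>))\<^sup>2 = y\<^sup>2 * (cmod d)\<^sup>2" unfolding zz by (simp add: norm_mult power_mult_distrib)
      have "\<bar>y\<bar> * cmod d < \<delta>" 
      proof -
        have "\<bar>y\<bar> * cmod d \<le> \<epsilon> * cmod d" using y d by (intro mult_right_mono) auto
        also have "\<dots> < \<delta>" using elim d by (simp add: pos_less_divide_eq)
        finally show ?thesis .
      qed
      hence lt: "cmod (z - \<zeta>) < \<delta>" unfolding zz by (simp add: norm_mult)
      hence zD: "z \<in> D" using \<delta>(2) by (auto simp: dist_norm norm_minus_commute)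
      have "\<mu> / 2 * (z - \<zeta>)\<^sup>2 = of_real (y\<^sup>2) * (\<mu> / 2 * d\<^sup>2)" unfolding zz by (simp add: power_mult_distrib)
      hence "Re (\<mu> / 2 * (z - \<zeta>)\<^sup>2) = - k * y\<^sup>2" unfolding assms(6) by simp
      moreover have "Re (\<phi> z - \<phi> \<zeta> - \<mu> / 2 * (z - \<zeta>)\<^sup>2) \<le> \<eta> * (y\<^sup>2 * (cmod d)\<^sup>2)"
        using \<delta>(3)[OF lt] complex_Re_le_cmod[of "\<phi> z - \<phi> \<zeta> - \<mu> / 2 * (z - \<zeta>)\<^sup>2"] unfolding c2 by linarith
      moreover have "\<eta> * (y\<^sup>2 * (cmod d)\<^sup>2) = k / 2 * y\<^sup>2" using d by (simp add: \<eta>_def)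
      ultimately show "\<zeta> + of_real y * d \<in> D \<and> Re (\<phi> (\<zeta> + of_real y * d)) - Re (\<phi> \<zeta>) \<le> - (k / 2) * y\<^sup>2"
        using zD by (simp add: z_def)
    qed
  qed
qed

text \<open>The amplitude depends on n because it will contain exp (i s_n f) with a bounded but
  otherwise arbitrary sequence s_n. Its values at zeta need not converge, so the conclusion is that
  a difference tends to 0.\<close>

lemma laplace_segment:
  fixes \<phi> \<phi>' :: "complex \<Rightarrow> complex" and K :: "nat \<Rightarrow> complex \<Rightarrow> complex"
  assumes \<phi>: "open D" "\<zeta> \<in> D" "\<And>z. z \<in> D \<Longrightarrow> (\<phi> has_field_derivative \<phi>' z) (at z)"
      "\<phi>' \<zeta> = 0" "(\<phi>' has_field_derivative \<mu>) (at \<zeta>)" "\<mu> / 2 * d\<^sup>2 = - of_real k" "k > 0"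
    and \<epsilon>: "\<epsilon> > 0" "\<And>y. \<bar>y\<bar> \<le> \<epsilon> \<Longrightarrow>
      \<zeta> + of_real y * d \<in> D \<and> Re (\<phi> (\<zeta> + of_real y * d)) - Re (\<phi> \<zeta>) \<le> - (k / 2) * y\<^sup>2"
    and K: "\<And>n. continuous_on D (K n)"
      "\<And>n y. \<bar>y\<bar> \<le> \<epsilon> \<Longrightarrow> cmod (K n (\<zeta> + of_real y * d)) \<le> B"
      "\<And>v. (\<lambda>n. K n (\<zeta> + of_real (v / sqrt (real n)) * d) - K n \<zeta>) \<longlonglongrightarrow> 0"
  shows "(\<lambda>n. of_real (sqrt (real n)) * exp (- of_nat n * \<phi> \<zeta>) *
      contour_integral (linepath (\<zeta> - of_real \<epsilon> * d) (\<zeta> + of_real \<epsilon> * d)) (\<lambda>z. K n z * exp (of_nat n * \<phi> z))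
      - K n \<zeta> * (d * of_real (\<integral>v. exp (- k * v\<^sup>2) \<partial>lborel))) \<longlonglongrightarrow> 0"
proof -
  define S where "S = closed_segment (\<zeta> - of_real \<epsilon> * d) (\<zeta> + of_real \<epsilon> * d)"
  have S: "z \<in> D" if "z \<in> S" for z
  proof -
    from that obtain x where x: "0 \<le> x" "x \<le> 1" "z = (1 - x) *\<^sub>R (\<zeta> - of_real \<epsilon> * d) + x *\<^sub>R (\<zeta> + of_real \<epsilon> * d)"
      by (auto simp: S_def closed_segment_def)
    have "z = \<zeta> + of_real ((2 * x - 1) * \<epsilon>) * d" unfolding x by (simp add: scaleR_conv_of_real algebra_simps)
    moreover have "\<bar>(2 * x - 1) * \<epsilon>\<bar> \<le> \<epsilon>" using x \<epsilon>(1) by (auto simp: abs_mult)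
    ultimately show ?thesis using \<epsilon>(2) by metis
  qed
  have cont\<phi>: "continuous_on D \<phi>" using \<phi>(3) by (meson DERIV_isCont continuous_at_imp_continuous_on)
  define E where "E n z = K n z * exp (of_nat n * (\<phi> z - \<phi> \<zeta>))" for n z
  have contE: "continuous_on S (E n)" for n
    unfolding E_def by (rule continuous_on_subset[of D]) (use S in \<open>auto intro!: continuous_intros K(1) cont\<phi>\<close>)
  define I where "I n v = indicator {- \<epsilon> * sqrt (real n)..\<epsilon> * sqrt (real n)} v *\<^sub>R E n (\<zeta> + of_real (v / sqrt (real n)) * d)" for n v
  define g where "g v = exp (- k * v\<^sup>2)" for v
  have g: "integrable lborel g" unfolding g_def using \<phi>(7) by (rule gaussian_integral_pos)
  \<comment> \<open>The Gaussian with half the rate, which is what the decay hypothesis guarantees,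
    is the dominating function.\<close>
  define g2 where "g2 v = exp (- (k / 2) * v\<^sup>2)" for v
  have g2: "integrable lborel g2" unfolding g2_def using \<phi>(7) by (intro gaussian_integral_pos) simp
  have B: "B \<ge> 0" using order_trans[OF norm_ge_zero K(2)[of 0 0]] \<epsilon>(1) by simp
  have K0: "cmod (K n \<zeta>) \<le> B" for n using K(2)[of 0 n] \<epsilon>(1) by simp
  have I_bound: "cmod (I n v) \<le> B * g2 v" if "n > 0" for n v
  proof (cases "v \<in> {- \<epsilon> * sqrt (real n)..\<epsilon> * sqrt (real n)}")
    case True
    define y where "y = v / sqrt (real n)"
    have y: "\<bar>y\<bar> \<le> \<epsilon>" using True that by (auto simp: y_def abs_le_iff field_simps)
    have "Re (of_nat n * (\<phi> (\<zeta> + of_real y * d) - \<phi> \<zeta>)) \<le> real n * (- (k / 2) * y\<^sup>2)"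
      using mult_left_mono[OF conjunct2[OF \<epsilon>(2)[OF y]], of "real n"] by simp
    also have "\<dots> = - (k / 2) * v\<^sup>2" using that by (simp add: y_def power_divide)
    finally have "cmod (exp (of_nat n * (\<phi> (\<zeta> + of_real y * d) - \<phi> \<zeta>))) \<le> g2 v"
      unfolding norm_exp_eq_Re g2_def exp_le_cancel_iff .
    moreover have "cmod (K n (\<zeta> + of_real y * d)) \<le> B" by (rule K(2)[OF y])
    ultimately have "cmod (E n (\<zeta> + of_real y * d)) \<le> B * g2 v"
      unfolding E_def norm_mult using B by (intro mult_mono) auto
    thus ?thesis using True by (simp add: I_def y_def)
  qed (use B in \<open>simp add: I_def g2_def\<close>)
  have I_meas: "I n \<in> borel_measurable borel" if "n > 0" for n
    using contour_integral_segment_scaled(1)[OF \<epsilon>(1), of "real n" \<zeta> d "E n"] contE that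
    unfolding I_def S_def by simp
  \<comment> \<open>The index is shifted because the majorant is available for n > 0 only, while
    dominated convergence asks for it at every index.\<close>
  have lim: "(\<lambda>n. \<integral>v. (I (Suc n) v - K (Suc n) \<zeta> * of_real (g v)) \<partial>lborel) \<longlonglongrightarrow> (\<integral>v. 0 \<partial>(lborel :: real measure))"
  proof (rule integral_dominated_convergence[where w = "\<lambda>v. B * g2 v + B * g v"
        and s = "\<lambda>n v. I (Suc n) v - K (Suc n) \<zeta> * of_real (g v)" and f = "\<lambda>_. 0"])
    show "integrable lborel (\<lambda>v. B * g2 v + B * g v)" using g g2 by simp
    show "AE v in lborel. (\<lambda>n. I (Suc n) v - K (Suc n) \<zeta> * of_real (g v)) \<longlonglongrightarrow> 0"
    proof (rule AE_I2)
      fix v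
      have "(\<lambda>n. I n v - K n \<zeta> * of_real (g v)) \<longlonglongrightarrow> 0"
      proof -
        define z where "z n = \<zeta> + of_real (v / sqrt (real n)) * d" for n
        have "(\<lambda>n. of_nat n * (\<phi> (z n) - \<phi> \<zeta>)) \<longlonglongrightarrow> \<mu> / 2 * (of_real v * d)\<^sup>2"
          unfolding z_def by (rule tendsto_scaled_exponent[OF \<phi>(1-5)])
        moreover have "\<mu> / 2 * (of_real v * d)\<^sup>2 = of_real (- k * v\<^sup>2)"
        proof -
          have "\<mu> / 2 * (of_real v * d)\<^sup>2 = (\<mu> / 2 * d\<^sup>2) * (of_real v)\<^sup>2" by (simp add: power_mult_distrib)
          thus ?thesis unfolding \<phi>(6) by simp
        qed
        ultimately have e: "(\<lambda>n. exp (of_nat n * (\<phi> (z n) - \<phi> \<zeta>))) \<longlonglongrightarrow> of_real (g v)"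
          unfolding g_def by (auto intro: tendsto_exp simp flip: exp_of_real)
        hence e0: "(\<lambda>n. exp (of_nat n * (\<phi> (z n) - \<phi> \<zeta>)) - of_real (g v)) \<longlonglongrightarrow> 0"
          by (simp add: LIM_zero_iff)
        have "(\<lambda>n. K n \<zeta> * (exp (of_nat n * (\<phi> (z n) - \<phi> \<zeta>)) - of_real (g v))) \<longlonglongrightarrow> 0"
        proof (rule Lim_null_comparison)
          show "\<forall>\<^sub>F n in sequentially. cmod (K n \<zeta> * (exp (of_nat n * (\<phi> (z n) - \<phi> \<zeta>)) - of_real (g v))) 
             \<le> B * cmod (exp (of_nat n * (\<phi> (z n) - \<phi> \<zeta>)) - of_real (g v))"
            by (intro always_eventually allI) (simp add: norm_mult mult_right_mono K0)
          show "(\<lambda>n. B * cmod (exp (of_nat n * (\<phi> (z n) - \<phi> \<zeta>)) - of_real (g v))) \<longlonglongrightarrow> 0"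
            using tendsto_mult_right_zero[OF tendsto_norm_zero[OF e0]] by simp
        qed
        moreover have "(\<lambda>n. (K n (z n) - K n \<zeta>) * exp (of_nat n * (\<phi> (z n) - \<phi> \<zeta>))) \<longlonglongrightarrow> 0 * of_real (g v)"
          unfolding z_def by (intro tendsto_mult K(3) e[unfolded z_def])
        ultimately have "(\<lambda>n. K n \<zeta> * (exp (of_nat n * (\<phi> (z n) - \<phi> \<zeta>)) - of_real (g v))
           + (K n (z n) - K n \<zeta>) * exp (of_nat n * (\<phi> (z n) - \<phi> \<zeta>))) \<longlonglongrightarrow> 0 + 0 * of_real (g v)"
          by (rule tendsto_add)
        moreover have "K n \<zeta> * (exp (of_nat n * (\<phi> (z n) - \<phi> \<zeta>)) - of_real (g v))
           + (K n (z n) - K n \<zeta>) * exp (of_nat n * (\<phi> (z n) - \<phi> \<zeta>)) = E n (z n) - K n \<zeta> * of_real (g v)" for n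
          by (simp add: E_def algebra_simps)
        ultimately have "(\<lambda>n. E n (z n) - K n \<zeta> * of_real (g v)) \<longlonglongrightarrow> 0" by simp
        moreover have "\<forall>\<^sub>F n in sequentially. E n (z n) - K n \<zeta> * of_real (g v) = I n v - K n \<zeta> * of_real (g v)"
        proof -
          have "filterlim (\<lambda>n. \<epsilon> * sqrt (real n)) at_top sequentially" using \<epsilon>(1) by real_asymp
          hence "\<forall>\<^sub>F n in sequentially. \<bar>v\<bar> \<le> \<epsilon> * sqrt (real n)" by (simp add: filterlim_at_top)
          thus ?thesis by eventually_elim (auto simp: I_def z_def abs_le_iff indicator_def)
        qed
        ultimately show ?thesis by (rule Lim_transform_eventually)
      qed
      thus "(\<lambda>n. I (Suc n) v - K (Suc n) \<zeta> * of_real (g v)) \<longlonglongrightarrow> 0" by (rule LIMSEQ_Suc)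
    qed
    fix n
    show "(\<lambda>v. I (Suc n) v - K (Suc n) \<zeta> * of_real (g v)) \<in> borel_measurable lborel"
      using I_meas[of "Suc n"] borel_measurable_integrable[OF g] by auto
    show "AE v in lborel. cmod (I (Suc n) v - K (Suc n) \<zeta> * of_real (g v)) \<le> B * g2 v + B * g v"
    proof (rule AE_I2)
      fix v
      have "cmod (K (Suc n) \<zeta> * of_real (g v)) \<le> B * g v"
        using K0[of "Suc n"] by (simp add: norm_mult g_def mult_right_mono)
      thus "cmod (I (Suc n) v - K (Suc n) \<zeta> * of_real (g v)) \<le> B * g2 v + B * g v"
        using I_bound[of "Suc n" v] norm_triangle_ineq4[of "I (Suc n) v" "K (Suc n) \<zeta> * of_real (g v)"] by simp
    qed
  qed auto
  have I_int: "integrable lborel (I n)" if "n > 0" for n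
    by (rule Bochner_Integration.integrable_bound[of _ "\<lambda>v. B * g2 v"])
       (use g2 I_meas[OF that] order_trans[OF I_bound[OF that] abs_ge_self] in auto)
  have "of_real (sqrt (real n)) * exp (- of_nat n * \<phi> \<zeta>) *
      contour_integral (linepath (\<zeta> - of_real \<epsilon> * d) (\<zeta> + of_real \<epsilon> * d)) (\<lambda>z. K n z * exp (of_nat n * \<phi> z))
      - K n \<zeta> * (d * of_real (\<integral>v. exp (- k * v\<^sup>2) \<partial>lborel)) = d * (\<integral>v. (I n v - K n \<zeta> * of_real (g v)) \<partial>lborel)"
    if n: "n > 0" for n
  proof -
    have "exp (- of_nat n * \<phi> \<zeta>) * (K n z * exp (of_nat n * \<phi> z)) = E n z" for z
    proof -
      have eq: "of_nat n * (\<phi> z - \<phi> \<zeta>) = - of_nat n * \<phi> \<zeta> + of_nat n * \<phi> z"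
        by (simp add: right_diff_distrib)
      show ?thesis unfolding E_def eq exp_add by (rule mult.left_commute)
    qed
    moreover have "(\<lambda>z. K n z * exp (of_nat n * \<phi> z)) contour_integrable_on linepath (\<zeta> - of_real \<epsilon> * d) (\<zeta> + of_real \<epsilon> * d)"
      by (rule contour_integrable_continuous_linepath, rule continuous_on_subset[of D])
         (use S in \<open>auto intro!: continuous_intros K(1) cont\<phi> simp: S_def\<close>)
    ultimately have "exp (- of_nat n * \<phi> \<zeta>) * contour_integral (linepath (\<zeta> - of_real \<epsilon> * d) (\<zeta> + of_real \<epsilon> * d)) (\<lambda>z. K n z * exp (of_nat n * \<phi> z))
      = contour_integral (linepath (\<zeta> - of_real \<epsilon> * d) (\<zeta> + of_real \<epsilon> * d)) (E n)"
      by (subst contour_integral_lmul[symmetric]) auto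
    hence A: "of_real (sqrt (real n)) * exp (- of_nat n * \<phi> \<zeta>) *
      contour_integral (linepath (\<zeta> - of_real \<epsilon> * d) (\<zeta> + of_real \<epsilon> * d)) (\<lambda>z. K n z * exp (of_nat n * \<phi> z))
      = d * (\<integral>v. I n v \<partial>lborel)"
      using contour_integral_segment_scaled(2)[OF \<epsilon>(1), of "real n" \<zeta> d "E n"] contE n
      by (simp add: S_def I_def mult.assoc)
    have B: "(\<integral>v. (I n v - K n \<zeta> * of_real (g v)) \<partial>lborel) = (\<integral>v. I n v \<partial>lborel) - K n \<zeta> * of_real (\<integral>v. g v \<partial>lborel)"
      using I_int[OF n] g by (subst Bochner_Integration.integral_diff) auto
    show ?thesis unfolding A B unfolding g_def by (simp only: right_diff_distrib mult.left_commute)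
  qed
  note eq = this
  have ev: "\<forall>\<^sub>F n in sequentially. d * (\<integral>v. (I n v - K n \<zeta> * of_real (g v)) \<partial>lborel) =
     of_real (sqrt (real n)) * exp (- of_nat n * \<phi> \<zeta>) *
      contour_integral (linepath (\<zeta> - of_real \<epsilon> * d) (\<zeta> + of_real \<epsilon> * d)) (\<lambda>z. K n z * exp (of_nat n * \<phi> z))
      - K n \<zeta> * (d * of_real (\<integral>v. exp (- k * v\<^sup>2) \<partial>lborel))"
    using eventually_gt_at_top[of "0::nat"] by (rule eventually_mono) (rule eq[symmetric])
  have "(\<lambda>n. \<integral>v. (I n v - K n \<zeta> * of_real (g v)) \<partial>lborel) \<longlonglongrightarrow> 0"
    using LIMSEQ_imp_Suc[OF lim] by simp
  from tendsto_mult_right_zero[OF this, of d] ev show ?thesis by (rule Lim_transform_eventually)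
qed

section \<open>Coefficients and primitives\<close>

text \<open>The reflection z -> - cnj z exchanges the two halves of the circle and conjugates i^n
  F(z) / z^n, so the halves add up to twice a real part. The factor i of dz turns it into an
  imaginary part.\<close>

lemma half_circle_coefficient:
  fixes F :: "complex \<Rightarrow> complex"
  assumes F: "F has_fps_expansion A" "F holomorphic_on ball 0 R" "0 < r" "r < R"
    and sym: "\<And>z. z \<in> ball 0 R \<Longrightarrow> F (- cnj z) = cnj (F z)"
  shows "\<i> ^ n * A $ n = of_real (Im (\<i> ^ n *
      contour_integral (part_circlepath 0 r (- pi / 2) (pi / 2)) (\<lambda>z. F z / z ^ Suc n)) / pi)"
proof -
  define K where "K \<theta> = F (of_real r * cis \<theta>) / (of_real r * cis \<theta>) ^ n" for \<theta>
  have nz: "of_real r * cis \<theta> \<noteq> 0" for \<theta> using \<open>0 < r\<close> by simp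
  have inb: "of_real r * cis \<theta> \<in> ball 0 R" for \<theta> using assms(3,4) by (simp add: norm_mult)
  have contF: "continuous_on (ball 0 R) F" using F(2) by (rule holomorphic_on_imp_continuous_on)
  have contK: "continuous_on S K" for S
  proof -
    have "continuous_on S (\<lambda>\<theta>. F (of_real r * cis \<theta>))"
      by (rule continuous_on_compose2[OF contF]) (use inb in \<open>auto intro!: continuous_intros\<close>)
    thus ?thesis unfolding K_def using nz by (intro continuous_intros) auto
  qed
  have intK: "K integrable_on {a..b}" for a b using contK by (rule integrable_continuous_real)
  have reflect: "\<i> ^ n * K (pi - \<theta>) = cnj (\<i> ^ n * K \<theta>)" for \<theta>
  proof -
    have e: "of_real r * cis (pi - \<theta>) = - cnj (of_real r * cis \<theta>)"
      by (simp add: complex_eq_iff cos_diff sin_diff)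
    have "\<i> ^ n * K (pi - \<theta>) = \<i> ^ n * (cnj (F (of_real r * cis \<theta>)) / (- cnj (of_real r * cis \<theta>)) ^ n)"
      unfolding K_def e sym[OF inb] ..
    also have "\<dots> = (- \<i>) ^ n * (cnj (F (of_real r * cis \<theta>)) / cnj (of_real r * cis \<theta>) ^ n)"
      unfolding power_minus[of "cnj (of_real r * cis \<theta>)"] power_minus[of \<i>]
      by (cases "even n") simp_all
    also have "\<dots> = cnj (\<i> ^ n * K \<theta>)" by (simp add: K_def)
    finally show ?thesis .
  qed
  have ci: "F (0 + of_real r * cis x) / (0 + of_real r * cis x) ^ Suc n * of_real r * \<i> * cis x = \<i> * K x" for x
    using nz[of x] \<open>0 < r\<close> by (simp add: K_def field_simps)
  have c1: "contour_integral (circlepath 0 r) (\<lambda>z. F z / z ^ Suc n) = \<i> * integral {0..2*pi} K"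
    unfolding circlepath_def by (subst contour_integral_part_circlepath_eq) (simp_all only: ci, simp_all)
  have c2: "contour_integral (part_circlepath 0 r (- pi / 2) (pi / 2)) (\<lambda>z. F z / z ^ Suc n) = \<i> * integral {-pi/2..pi/2} K"
    by (subst contour_integral_part_circlepath_eq) (simp_all only: ci, simp_all)
  have "((\<lambda>u. F u / (u - 0) ^ Suc n) has_contour_integral ((2 * pi * \<i>) / (fact n) * (deriv ^^ n) F 0)) (circlepath 0 r)"
    using F(2-4) by (intro Cauchy_has_contour_integral_higher_derivative_circlepath)
      (auto intro!: continuous_on_subset[OF contF] holomorphic_on_subset[OF F(2)])
  hence "contour_integral (circlepath 0 r) (\<lambda>z. F z / z ^ Suc n) = 2 * pi * \<i> * A $ n"
    using fps_nth_fps_expansion[OF F(1), of n] by (simp add: contour_integral_unique)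
  hence A: "integral {0..2*pi} K = 2 * pi * A $ n" unfolding c1 by simp
  have "integral {0..2*pi} K = integral {0..pi/2} K + integral {pi/2..3*pi/2} K + integral {3*pi/2..2*pi} K"
    using Henstock_Kurzweil_Integration.integral_combine[of 0 "pi/2" "2*pi" K]
      Henstock_Kurzweil_Integration.integral_combine[of "pi/2" "3*pi/2" "2*pi" K] intK by (simp add: add.assoc)
  also have "integral {3*pi/2..2*pi} K = integral {-pi/2..0} K"
  proof -
    have "cis (2 * pi + x) = cis x" for x by (simp flip: cis_mult)
    hence "K \<circ> (+) (2*pi) = K" by (simp add: fun_eq_iff K_def)
    thus ?thesis using integral_shift_Icc_real[where a = "-pi/2" and b = 0 and f = K and c = "2*pi"] by simp
  qed
  also have "integral {0..pi/2} K + integral {pi/2..3*pi/2} K + integral {-pi/2..0} K = 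
      integral {-pi/2..pi/2} K + integral {pi/2..3*pi/2} K"
    using Henstock_Kurzweil_Integration.integral_combine[of "-pi/2" 0 "pi/2" K, symmetric] intK
    by (simp add: add_ac)
  also have "integral {pi/2..3*pi/2} K = integral {-pi/2..pi/2} (\<lambda>x. K (pi + x))"
    using integral_shift_Icc_real[where a = "-pi/2" and b = "pi/2" and f = K and c = pi] by (simp add: o_def)
  also have "\<dots> = integral {-pi/2..pi/2} (\<lambda>x. K (pi - x))"
    using Henstock_Kurzweil_Integration.integral_reflect_real[of "-(-pi/2)" "-(pi/2)" "\<lambda>x. K (pi + x)"] by simp
  finally have S: "2 * pi * A $ n = integral {-pi/2..pi/2} K + integral {-pi/2..pi/2} (\<lambda>x. K (pi - x))"
    unfolding A .
  have "2 * pi * (\<i> ^ n * A $ n) = \<i> ^ n * (2 * pi * A $ n)" by (simp only: mult_ac)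
  also have "\<dots> = \<i> ^ n * integral {-pi/2..pi/2} K + \<i> ^ n * integral {-pi/2..pi/2} (\<lambda>x. K (pi - x))"
    unfolding S distrib_left ..
  also have "\<i> ^ n * integral {-pi/2..pi/2} (\<lambda>x. K (pi - x)) = integral {-pi/2..pi/2} (\<lambda>x. cnj (\<i> ^ n * K x))"
    unfolding reflect[symmetric] by simp
  also have "\<dots> = cnj (\<i> ^ n * integral {-pi/2..pi/2} K)"
    unfolding integral_cnj[symmetric] by simp
  finally have "2 * pi * (\<i> ^ n * A $ n) = of_real (2 * Re (\<i> ^ n * integral {-pi/2..pi/2} K))"
    by (simp only: complex_add_cnj)
  moreover have "Re (\<i> ^ n * w) = Im (\<i> ^ n * (\<i> * w))" for w
    unfolding mult.left_commute[of "\<i> ^ n" \<i>] by simp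
  ultimately have "2 * pi * (\<i> ^ n * A $ n) = of_real (2 * Im (\<i> ^ n * (\<i> * integral {-pi/2..pi/2} K)))"
    by simp
  hence "2 * of_real pi * (\<i> ^ n * A $ n) = 2 * of_real pi * of_real (Im (\<i> ^ n * (\<i> * integral {-pi/2..pi/2} K)) / pi)"
    by simp
  hence "\<i> ^ n * A $ n = of_real (Im (\<i> ^ n * (\<i> * integral {-pi/2..pi/2} K)) / pi)"
    by (subst (asm) mult_left_cancel) auto
  thus ?thesis unfolding c2 .
qed

text \<open>Being negligible is an equivalence relation between end points, and it holds on small
  discs, where Re phi is bounded by some c' < c. A connected set then has a single class, so no
  contour and no length estimate is required.\<close>

lemma primitive_difference_negligible:
  fixes \<phi> :: "complex \<Rightarrow> complex" and \<Psi> K :: "nat \<Rightarrow> complex \<Rightarrow> complex"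
  assumes U: "open U" "\<And>z. z \<in> U \<Longrightarrow> Re (\<phi> z) < c" "continuous_on U \<phi>"
    and \<Psi>: "\<And>n z. z \<in> U \<Longrightarrow> (\<Psi> n has_field_derivative K n z * exp (of_nat n * \<phi> z)) (at z)"
    and K: "\<And>z. z \<in> U \<Longrightarrow> \<exists>r>0. \<exists>B. \<forall>w\<in>ball z r. \<forall>n. cmod (K n w) \<le> B"
    and conn: "connected_component U a b"
  shows "(\<lambda>n. sqrt (real n) * exp (- real n * c) * cmod (\<Psi> n b - \<Psi> n a)) \<longlonglongrightarrow> 0"
proof -
  define m where "m n = sqrt (real n) * exp (- real n * c)" for n
  have m: "m n \<ge> 0" for n by (simp add: m_def)
  define R where "R x y \<longleftrightarrow> (\<lambda>n. m n * cmod (\<Psi> n y - \<Psi> n x)) \<longlonglongrightarrow> 0" for x y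
  obtain S where S: "connected S" "S \<subseteq> U" "a \<in> S" "b \<in> S"
    using conn by (auto simp: connected_component_def)
  have "R a b"
  proof (rule connected_equivalence_relation[OF S(1,3,4)])
    fix x y assume "R x y" thus "R y x" by (simp add: R_def norm_minus_commute)
  next
    fix x y z assume xyz: "R x y" "R y z"
    show "R x z" unfolding R_def
    proof (rule Lim_null_comparison)
      show "\<forall>\<^sub>F n in sequentially. norm (m n * cmod (\<Psi> n z - \<Psi> n x)) \<le> m n * cmod (\<Psi> n z - \<Psi> n y) + m n * cmod (\<Psi> n y - \<Psi> n x)"
      proof (intro always_eventually allI)
        fix n
        have "cmod (\<Psi> n z - \<Psi> n x) \<le> cmod (\<Psi> n z - \<Psi> n y) + cmod (\<Psi> n y - \<Psi> n x)"
          by norm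
        from mult_left_mono[OF this m[of n]]
        show "norm (m n * cmod (\<Psi> n z - \<Psi> n x)) \<le> m n * cmod (\<Psi> n z - \<Psi> n y) + m n * cmod (\<Psi> n y - \<Psi> n x)"
          using m[of n] by (simp add: abs_mult distrib_left)
      qed
      show "(\<lambda>n. m n * cmod (\<Psi> n z - \<Psi> n y) + m n * cmod (\<Psi> n y - \<Psi> n x)) \<longlonglongrightarrow> 0"
        using tendsto_add[OF xyz(2)[unfolded R_def] xyz(1)[unfolded R_def]] by simp
    qed
  next
    fix x assume "x \<in> S"
    hence xU: "x \<in> U" using S by auto
    \<comment> \<open>The gap c - c' gives an exponential decay that beats sqrt n.\<close>
    define c' where "c' = (Re (\<phi> x) + c) / 2"
    have c': "Re (\<phi> x) < c'" "c' < c" using U(2)[OF xU] by (auto simp: c'_def)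
    have "isCont (\<lambda>z. Re (\<phi> z)) x"
      using U xU by (intro isCont_Re) (simp add: continuous_on_eq_continuous_at)
    hence "((\<lambda>z. Re (\<phi> z)) \<longlongrightarrow> Re (\<phi> x)) (nhds x)"
      unfolding isCont_def by (rule iffD1[OF tendsto_at_iff_tendsto_nhds])
    hence "\<forall>\<^sub>F z in nhds x. Re (\<phi> z) < c'" using c'(1) by (rule order_tendstoD)
    moreover have "\<forall>\<^sub>F z in nhds x. z \<in> U" using U(1) xU by (rule eventually_nhds_in_open)
    ultimately have "\<forall>\<^sub>F z in nhds x. Re (\<phi> z) < c' \<and> z \<in> U" by (rule eventually_conj)
    then obtain r1 where r1: "r1 > 0" "\<And>z. dist z x < r1 \<Longrightarrow> Re (\<phi> z) < c' \<and> z \<in> U"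
      unfolding eventually_nhds_metric by blast
    obtain r2 B where r2: "r2 > 0" "\<And>w n. w \<in> ball x r2 \<Longrightarrow> cmod (K n w) \<le> B" using K[OF xU] by blast
    have B: "B \<ge> 0" using r2(2)[of x 0] r2(1) by (meson centre_in_ball norm_ge_zero order_trans)
    define r where "r = min r1 r2"
    have r: "r > 0" using r1 r2 by (simp add: r_def)
    have "R x y" if y: "y \<in> ball x r" for y
      unfolding R_def
    proof (rule Lim_null_comparison)
      show "\<forall>\<^sub>F n in sequentially. norm (m n * cmod (\<Psi> n y - \<Psi> n x)) \<le> sqrt (real n) * exp (- real n * (c - c')) * (B * r)"
      proof (intro always_eventually allI)
        fix n
        have "cmod (\<Psi> n y - \<Psi> n x) \<le> (B * exp (real n * c')) * cmod (y - x)"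
        proof (rule field_differentiable_bound[of "ball x r"])
          fix w assume w: "w \<in> ball x r"
          have "dist w x < r1" "w \<in> ball x r2" using w by (auto simp: r_def dist_commute)
          hence wU: "w \<in> U" "Re (\<phi> w) < c'" "cmod (K n w) \<le> B" using r1(2) r2(2) by auto
          show "(\<Psi> n has_field_derivative K n w * exp (of_nat n * \<phi> w)) (at w within ball x r)"
            using \<Psi>[OF wU(1)] by (rule has_field_derivative_at_within)
          have "cmod (exp (of_nat n * \<phi> w)) \<le> exp (real n * c')"
            using wU(2) by (simp add: mult_left_mono less_imp_le)
          thus "cmod (K n w * exp (of_nat n * \<phi> w)) \<le> B * exp (real n * c')"
            unfolding norm_mult using wU(3) B by (intro mult_mono) auto
        qed (use y r in auto)
        also have "\<dots> \<le> (B * exp (real n * c')) * r"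
          using y B by (intro mult_left_mono) (auto simp: dist_norm norm_minus_commute)
        finally have "m n * cmod (\<Psi> n y - \<Psi> n x) \<le> m n * ((B * exp (real n * c')) * r)"
          using m by (rule mult_left_mono)
        also have "m n * ((B * exp (real n * c')) * r) = sqrt (real n) * (exp (- real n * c) * exp (real n * c')) * (B * r)"
          by (simp add: m_def mult_ac)
        also have "exp (- real n * c) * exp (real n * c') = exp (- real n * (c - c'))"
          unfolding mult_exp_exp by (simp add: algebra_simps)
        finally show "norm (m n * cmod (\<Psi> n y - \<Psi> n x)) \<le> sqrt (real n) * exp (- real n * (c - c')) * (B * r)"
          using m[of n] by simp
      qed
      define \<delta> where "\<delta> = c - c'"
      have "\<delta> > 0" using c' by (simp add: \<delta>_def)
      hence "(\<lambda>n. sqrt (real n) * exp (- real n * \<delta>) * (B * r)) \<longlonglongrightarrow> 0" by real_asymp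
      thus "(\<lambda>n. sqrt (real n) * exp (- real n * (c - c')) * (B * r)) \<longlonglongrightarrow> 0" unfolding \<delta>_def .
    qed
    thus "\<exists>T. openin (top_of_set S) T \<and> x \<in> T \<and> (\<forall>y\<in>T. R x y)"
      using \<open>x \<in> S\<close> r by (intro exI[of _ "S \<inter> ball x r"]) auto
  qed
  thus ?thesis by (simp add: R_def m_def)
qed

section \<open>Counting zeros\<close>

lemma IVT_sign_change:
  fixes R :: "real \<Rightarrow> real"
  assumes "a < b" "continuous_on {a..b} R" "R a * R b < 0"
  obtains z where "a < z" "z < b" "R z = 0"
proof -
  have "\<exists>z\<ge>a. z \<le> b \<and> R z = 0"
  proof (cases "R a < 0")
    case True
    thus ?thesis using IVT'[of R a 0 b] assms by (auto simp: mult_less_0_iff)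
  next
    case False
    thus ?thesis using IVT2'[of R b 0 a] assms by (auto simp: mult_less_0_iff)
  qed
  then obtain z where "z \<ge> a" "z \<le> b" "R z = 0" by blast
  moreover have "z \<noteq> a" "z \<noteq> b" using \<open>R z = 0\<close> assms(3) by auto
  ultimately show ?thesis using that[of z] by simp
qed

text \<open>Where the sine is 1 or -1 the error is too small to change the sign of R, so R changes
  sign between any two consecutive such points.\<close>

lemma card_zeros_sin_perturbation:
  fixes R w :: "real \<Rightarrow> real"
  assumes cont: "continuous_on {0..M} R" and F: "F > 0"
    and close: "\<And>s. s \<in> {0..M} \<Longrightarrow> \<bar>R s - w s * sin (\<theta> + s * F)\<bar> < w s"
    and fin: "finite {s \<in> {0<..<M}. R s = 0}"
  shows "M * F / pi - 2 \<le> real (card {s \<in> {0<..<M}. R s = 0})"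
proof (cases "M * F / pi < 2")
  case False
  \<comment> \<open>The least integer with theta <= pi / 2 + k0 pi. Hence s 0 lies in [0, pi / F),
    and the s j are the extremal points of the sine from there on.\<close>
  define k0 where "k0 = \<lceil>\<theta> / pi - 1 / 2\<rceil>"
  have k0: "\<theta> / pi - 1 / 2 \<le> of_int k0" "of_int k0 < \<theta> / pi - 1 / 2 + 1"
    unfolding k0_def by linarith+
  define s where "s j = (pi / 2 + (of_int k0 + real j) * pi - \<theta>) / F" for j :: nat
  \<comment> \<open>N gaps use N + 1 extremal points, which fit into [0, M] if (N + 1) pi <= M F.
    That and the rounding cost at most 2.\<close>
  define N where "N = nat \<lfloor>M * F / pi\<rfloor> - 1"
  have N: "M * F / pi - 2 \<le> real N" "real N + 1 \<le> M * F / pi"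
    using False unfolding N_def by linarith+
  have k1: "\<theta> \<le> pi / 2 + of_int k0 * pi" "pi / 2 + of_int k0 * pi < \<theta> + pi"
    using k0 pi_gt_zero by (simp_all add: field_simps)
  have s0: "0 \<le> s j" for j
  proof -
    have "0 \<le> real j * pi" by simp
    hence "0 \<le> pi / 2 + (of_int k0 + real j) * pi - \<theta>" unfolding distrib_right using k1 by linarith
    thus ?thesis unfolding s_def using F by simp
  qed
  have sM: "s j \<le> M" if "j \<le> N" for j
  proof -
    have "pi / 2 + (of_int k0 + real j) * pi - \<theta> < pi + real j * pi" unfolding distrib_right using k1 by linarith
    also have "\<dots> = (real j + 1) * pi" by (simp add: algebra_simps)
    also have "\<dots> \<le> (M * F / pi) * pi" using that N(2) by (intro mult_right_mono) auto
    finally show ?thesis unfolding s_def using F by (simp add: field_simps)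
  qed
  have smono: "s i < s j" if "i < j" for i j
    unfolding s_def using that F by (intro divide_strict_right_mono) auto
  define g where "g j = sin (\<theta> + s j * F)" for j
  have g: "g j = sin (pi / 2 + (of_int k0 + real j) * pi)" for j
    unfolding g_def s_def using F by simp
  have gS: "g (Suc j) = - g j" for j
  proof -
    have "pi / 2 + (of_int k0 + real (Suc j)) * pi = (pi / 2 + (of_int k0 + real j) * pi) + pi"
      by (simp add: algebra_simps)
    thus ?thesis unfolding g by (simp only: sin_periodic_pi)
  qed
  have g1: "(g j)\<^sup>2 = 1" for j
  proof -
    have "(of_int k0 + real j) * pi = of_int (k0 + int j) * pi" by simp
    hence "sin ((of_int k0 + real j) * pi) = 0" by (simp only: sin_zero_iff_int2) blast
    moreover have "g j = cos ((of_int k0 + real j) * pi)" unfolding g by (simp add: sin_add)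
    ultimately show ?thesis using sin_cos_squared_add[of "(of_int k0 + real j) * pi"] by simp
  qed
  have sgn: "R (s j) * g j > 0" if "j \<le> N" for j
  proof -
    have "\<bar>R (s j) - w (s j) * g j\<bar> < w (s j)" unfolding g_def using s0 sM[OF that] by (intro close) auto
    moreover have "g j = 1 \<or> g j = -1" using g1[of j] by (simp add: power2_eq_1_iff)
    ultimately show ?thesis by auto
  qed
  have "\<exists>z. s j < z \<and> z < s (Suc j) \<and> R z = 0" if "j < N" for j
  proof -
    have "R (s j) * g j * (R (s (Suc j)) * g (Suc j)) > 0" using sgn[of j] sgn[of "Suc j"] that by simp
    hence "R (s j) * R (s (Suc j)) * (g j)\<^sup>2 < 0" unfolding gS by (simp add: power2_eq_square mult_ac)
    hence "R (s j) * R (s (Suc j)) < 0" unfolding g1 by simp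
    moreover have "continuous_on {s j..s (Suc j)} R"
      using s0 sM[of "Suc j"] that by (intro continuous_on_subset[OF cont]) (auto intro: order_trans)
    ultimately show ?thesis using IVT_sign_change[of "s j" "s (Suc j)" R] smono[of j "Suc j"] by blast
  qed
  then obtain z where z: "\<And>j. j < N \<Longrightarrow> s j < z j \<and> z j < s (Suc j) \<and> R (z j) = 0" by metis
  have zlt: "z i < z j" if "i < j" "j < N" for i j
  proof -
    have "s (Suc i) \<le> s j" using that smono[of "Suc i" j] by (cases "Suc i = j") auto
    thus ?thesis using z[of i] z[of j] that by linarith
  qed
  have "inj_on z {..<N}"
    by (rule inj_onI) (metis zlt less_irrefl lessThan_iff linorder_neqE_nat)
  moreover have "z ` {..<N} \<subseteq> {s \<in> {0<..<M}. R s = 0}"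
  proof
    fix y assume "y \<in> z ` {..<N}"
    then obtain j where j: "j < N" "y = z j" by auto
    thus "y \<in> {s \<in> {0<..<M}. R s = 0}" using z[of j] s0[of j] sM[of "Suc j"] by auto
  qed
  ultimately have "card {..<N} \<le> card {s \<in> {0<..<M}. R s = 0}"
    using card_inj_on_le fin by blast
  thus ?thesis using N(1) by simp
qed simp

text \<open>Take a violating point wherever one exists: convergence along this sequence forbids
  violations for large n. It lets the Laplace estimate be proved along sequences and used uniformly
  in the offset.\<close>

lemma uniform_from_sequences:
  fixes E :: "nat \<Rightarrow> real \<Rightarrow> real"
  assumes "\<And>s. (\<And>n. s n \<in> S) \<Longrightarrow> (\<lambda>n. E n (s n)) \<longlonglongrightarrow> 0" "S \<noteq> {}" "\<delta> > 0"
  shows "\<forall>\<^sub>F n in sequentially. \<forall>x\<in>S. \<bar>E n x\<bar> < \<delta>"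
proof -
  obtain x0 where x0: "x0 \<in> S" using assms(2) by blast
  define s where "s n = (if \<exists>x\<in>S. \<not> \<bar>E n x\<bar> < \<delta> then SOME x. x \<in> S \<and> \<not> \<bar>E n x\<bar> < \<delta> else x0)" for n
  have s: "s n \<in> S \<and> ((\<exists>x\<in>S. \<not> \<bar>E n x\<bar> < \<delta>) \<longrightarrow> \<not> \<bar>E n (s n)\<bar> < \<delta>)" for n
  proof (cases "\<exists>x\<in>S. \<not> \<bar>E n x\<bar> < \<delta>")
    case True
    hence "\<exists>x. x \<in> S \<and> \<not> \<bar>E n x\<bar> < \<delta>" by blast
    from someI_ex[OF this] show ?thesis using True by (simp add: s_def)
  qed (simp add: s_def x0)
  have "(\<lambda>n. E n (s n)) \<longlonglongrightarrow> 0" using s by (intro assms(1)) auto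
  hence "(\<lambda>n. \<bar>E n (s n)\<bar>) \<longlonglongrightarrow> 0" by (rule tendsto_rabs_zero)
  hence "\<forall>\<^sub>F n in sequentially. \<bar>E n (s n)\<bar> < \<delta>" using assms(3) by (rule order_tendstoD)
  thus ?thesis by eventually_elim (use s in blast)
qed

(* Fatou's lemma for the number of points in windows of length M / n, divided by M. *)
lemma counting_liminf:
  fixes Z :: "nat \<Rightarrow> real set" and d :: "real \<Rightarrow> real"
  assumes ab: "a < b" and Z: "\<And>n. finite (Z n)" and d: "continuous_on {a..b} d" and S: "finite S"
    and loc: "\<And>t M. \<lbrakk>a < t; t < b; t \<notin> S; M > 0\<rbrakk> \<Longrightarrow>
       \<forall>\<^sub>F n in sequentially. M * d t - 2 \<le> real (card (Z n \<inter> {t<..<t + M / real n}))"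
    and \<eta>: "\<eta> > 0"
  shows "\<forall>\<^sub>F n in sequentially. integral {a..b} d - \<eta> \<le> real (card (Z n \<inter> {a<..<b})) / real n"
proof -
  \<comment> \<open>The loss 2 per window, divided by M and integrated over [a, b], is eta /
    2.\<close>
  define M where "M = 4 * (b - a) / \<eta>"
  have M: "M > 0" using ab \<eta> by (simp add: M_def)
  have Mb: "2 * (b - a) / M = \<eta> / 2" using ab \<eta> by (simp add: M_def field_simps)
  \<comment> \<open>As a function of t this says that z lies in the window (t, t + M / n). Its
    integral is at most M / n, so the integral of \<open>g n\<close> is at most the number of points
    divided by n.\<close>
  define ind where "ind n z t = (indicator ({z - M / real n<..<z} \<inter> {a<..<b}) t :: ennreal)" for n z t
  define g where "g n t = (\<Sum>z\<in>Z n \<inter> {a<..<b}. ennreal (1 / M) * ind n z t)" for n t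
  have g_meas [measurable]: "g n \<in> borel_measurable lborel" for n
    unfolding g_def ind_def by measurable
  have int_g: "(\<integral>\<^sup>+t. g n t \<partial>lborel) \<le> ennreal (real (card (Z n \<inter> {a<..<b})) / real n)" if n: "n > 0" for n
  proof -
    have "(\<integral>\<^sup>+t. g n t \<partial>lborel) = (\<Sum>z\<in>Z n \<inter> {a<..<b}. ennreal (1 / M) * emeasure lborel ({z - M / real n<..<z} \<inter> {a<..<b}))"
      unfolding g_def ind_def by (subst nn_integral_sum) (simp_all add: nn_integral_cmult)
    also have "\<dots> \<le> (\<Sum>z\<in>Z n \<inter> {a<..<b}. ennreal (1 / M) * ennreal (M / real n))"
    proof (intro sum_mono mult_left_mono)
      fix z
      have "emeasure lborel ({z - M / real n<..<z} \<inter> {a<..<b}) \<le> emeasure lborel {z - M / real n<..<z}"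
        by (intro emeasure_mono) auto
      thus "emeasure lborel ({z - M / real n<..<z} \<inter> {a<..<b}) \<le> ennreal (M / real n)"
        using M by simp
    qed auto
    also have "\<dots> = (\<Sum>z\<in>Z n \<inter> {a<..<b}. ennreal (1 / real n))"
      using M n by (simp flip: ennreal_mult)
    also have "\<dots> = ennreal (real (card (Z n \<inter> {a<..<b})) / real n)"
      by (simp add: ennreal_of_nat_eq_real_of_nat flip: ennreal_mult)
    finally show ?thesis .
  qed
  define v where "v t = indicator {a..b} t * (d t - 2 / M)" for t
  have d_int: "set_integrable lborel {a..b} d" using d by (rule borel_integrable_atLeastAtMost')
  have c_int: "set_integrable lborel {a..b} (\<lambda>_. 2 / M)" by (rule borel_integrable_atLeastAtMost') simp
  have v_int: "integrable lborel v"
    using set_integral_diff(1)[OF d_int c_int] by (simp add: set_integrable_def v_def[abs_def])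
  have v_val: "(\<integral>t. v t \<partial>lborel) = integral {a..b} d - \<eta> / 2"
  proof -
    have "(\<integral>t. v t \<partial>lborel) = (LINT t:{a..b}|lborel. d t) - (LINT t:{a..b}|lborel. 2 / M)"
      using set_integral_diff(2)[OF d_int c_int] by (simp add: set_lebesgue_integral_def v_def[abs_def])
    also have "(LINT t:{a..b}|lborel. 2 / M) = \<eta> / 2" 
      using ab Mb by (simp add: set_lebesgue_integral_def mult.commute)
    finally show ?thesis using set_borel_integral_eq_integral(2)[OF d_int] by simp
  qed
  have lim: "ennreal (v t) \<le> liminf (\<lambda>n. g n t)" if t: "t \<notin> S \<union> {a, b}" for t
  proof (cases "t \<in> {a<..<b}")
    case True
    define r where "r = b - t"
    have r: "r > 0" using True by (simp add: r_def)
    have "(\<lambda>n. M / real n) \<longlonglongrightarrow> 0" by real_asymp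
    hence "\<forall>\<^sub>F n in sequentially. M / real n < r" using r by (rule order_tendstoD)
    moreover have "\<forall>\<^sub>F n in sequentially. M * d t - 2 \<le> real (card (Z n \<inter> {t<..<t + M / real n}))"
      using True t M by (intro loc) auto
    ultimately have "\<forall>\<^sub>F n in sequentially. ennreal (v t) \<le> g n t"
    proof eventually_elim
      case (elim n)
      have sub: "Z n \<inter> {t<..<t + M / real n} \<subseteq> Z n \<inter> {a<..<b}"
        using elim(1) True by (auto simp: r_def)
      have "g n t = (\<Sum>z\<in>Z n \<inter> {a<..<b}. ennreal (1 / M) * indicator {t<..<t + M / real n} z)"
        unfolding g_def ind_def using True
        by (intro sum.cong refl arg_cong2[of _ _ _ _ "(*)"]) (auto simp: indicator_def)
      also have "\<dots> = ennreal (1 / M) * of_nat (card (Z n \<inter> {t<..<t + M / real n}))"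
      proof -
        have "(\<Sum>z\<in>Z n \<inter> {a<..<b}. indicator {t<..<t + M / real n} z) = (of_nat (card (Z n \<inter> {a<..<b} \<inter> {t<..<t + M / real n})) :: ennreal)"
          using Z[of n] by (simp add: indicator_def sum.If_cases del: greaterThanLessThan_iff)
        moreover have "Z n \<inter> {a<..<b} \<inter> {t<..<t + M / real n} = Z n \<inter> {t<..<t + M / real n}" using sub by auto
        ultimately show ?thesis by (simp only: sum_distrib_left[symmetric])
      qed
      also have "\<dots> = ennreal (1 / M * real (card (Z n \<inter> {t<..<t + M / real n})))"
        using M by (simp add: ennreal_of_nat_eq_real_of_nat flip: ennreal_mult)
      finally have gn: "g n t = ennreal (1 / M * real (card (Z n \<inter> {t<..<t + M / real n})))" .
      have "v t = d t - 2 / M" using True by (simp add: v_def)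
      also have "\<dots> = 1 / M * (M * d t - 2)" using M by (simp add: field_simps)
      also have "\<dots> \<le> 1 / M * real (card (Z n \<inter> {t<..<t + M / real n}))"
        using elim(2) M by (intro mult_left_mono) auto
      finally show ?case unfolding gn by (rule ennreal_leI)
    qed
    thus ?thesis by (rule Liminf_bounded)
  next
    case False
    hence "v t = 0" using t by (auto simp: v_def indicator_def)
    thus ?thesis by simp
  qed
  \<comment> \<open>The conversion to \<open>ennreal\<close> cuts v off at 0, which can only
    increase the integral.\<close>
  have "ennreal (\<integral>t. v t \<partial>lborel) \<le> ennreal (\<integral>t. max (v t) 0 \<partial>lborel)"
    using v_int by (intro ennreal_leI integral_mono) auto
  also have "\<dots> = (\<integral>\<^sup>+t. ennreal (max (v t) 0) \<partial>lborel)"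
    using v_int by (intro nn_integral_eq_integral[symmetric]) auto
  also have "\<dots> = (\<integral>\<^sup>+t. ennreal (v t) \<partial>lborel)"
    by (intro nn_integral_cong) (simp add: max_def ennreal_neg)
  also have "\<dots> \<le> (\<integral>\<^sup>+t. liminf (\<lambda>n. g n t) \<partial>lborel)"
  proof (rule nn_integral_mono_AE)
    have "AE t in lborel. t \<notin> S \<union> {a, b}"
      using S by (intro AE_not_in) (auto intro!: finite_imp_null_set_lborel)
    thus "AE t in lborel. ennreal (v t) \<le> liminf (\<lambda>n. g n t)" by eventually_elim (rule lim)
  qed
  also have "\<dots> \<le> liminf (\<lambda>n. \<integral>\<^sup>+t. g n t \<partial>lborel)" by (rule nn_integral_liminf) simp
  also have "\<dots> \<le> liminf (\<lambda>n. ennreal (real (card (Z n \<inter> {a<..<b})) / real n))"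
    by (rule Liminf_mono, rule eventually_mono[OF eventually_gt_at_top[of 0]]) (rule int_g)
  finally have le: "ennreal (integral {a..b} d - \<eta> / 2) \<le> liminf (\<lambda>n. ennreal (real (card (Z n \<inter> {a<..<b})) / real n))"
    unfolding v_val .
  show ?thesis
  proof (cases "integral {a..b} d - \<eta> \<le> 0")
    case True
    have "integral {a..b} d - \<eta> \<le> real (card (Z n \<inter> {a<..<b})) / real n" for n
      using True divide_nonneg_nonneg[of "real (card (Z n \<inter> {a<..<b}))" "real n"] by linarith
    thus ?thesis by (intro always_eventually allI)
  next
    case False
    hence "ennreal (integral {a..b} d - \<eta>) < ennreal (integral {a..b} d - \<eta> / 2)"
      using \<eta> by (intro ennreal_lessI) auto
    also note le
    finally have "\<forall>\<^sub>F n in sequentially. ennreal (integral {a..b} d - \<eta>) < ennreal (real (card (Z n \<inter> {a<..<b})) / real n)"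
      by (rule less_LiminfD)
    thus ?thesis
    proof eventually_elim
      case (elim n)
      thus ?case using False by (subst (asm) ennreal_less_iff) auto
    qed
  qed
qed

text \<open>Since f 0 = 0, the power f^k starts at order k, so s^k enters the n-th coefficient only
  for k <= n.\<close>

lemma degree_gen_polys_le:
  assumes "gen_polys h f H" "h analytic_on {0}" "f analytic_on {0}" "f 0 = 0"
  shows "degree (H n) \<le> n"
proof -
  obtain G where G: "h has_fps_expansion G"
    using analytic_at_imp_has_fps_expansion_0[OF assms(2)] by blast
  obtain F where F: "f has_fps_expansion F"
    using analytic_at_imp_has_fps_expansion_0[OF assms(3)] by blast
  have F0: "F $ 0 = 0"
    using has_fps_expansion_imp_0_eq_fps_nth_0[OF F] assms(4) by simp
  define p where "p = (\<Sum>i=0..n. \<Sum>k=0..n - i. monom (fact n * (G $ i) * ((F ^ k) $ (n - i)) / fact k) k)"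
  have "poly (H n) s = poly p s" for s
  proof -
    have "((\<lambda>z. exp (s * z)) \<circ> f) has_fps_expansion (fps_exp s oo F)"
      by (intro has_fps_expansion_compose has_fps_expansion_exp F F0)
    hence "(\<lambda>z. h z * exp (s * f z)) has_fps_expansion G * (fps_exp s oo F)"
      using has_fps_expansion_mult[OF G] by (simp add: o_def)
    moreover have "(\<lambda>z. h z * exp (s * f z)) has_fps_expansion Abs_fps (\<lambda>n. poly (H n) s / fact n)"
      using assms(1) by (simp add: gen_polys_def)
    ultimately have "Abs_fps (\<lambda>n. poly (H n) s / fact n) = G * (fps_exp s oo F)"
      by (blast intro: fps_expansion_unique_complex)
    from arg_cong[OF this, of "\<lambda>A. A $ n"] 
    have "poly (H n) s = fact n * ((G * (fps_exp s oo F)) $ n)" by (simp add: field_simps)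
    also have "\<dots> = poly p s"
      by (simp add: p_def fps_mult_nth fps_compose_nth poly_sum poly_monom sum_distrib_left field_simps)
    finally show ?thesis .
  qed
  hence "H n = p" using poly_eq_poly_eq_iff by blast
  moreover have "degree p \<le> n"
    unfolding p_def by (intro degree_sum_le) (auto intro: order_trans[OF degree_monom_le])
  ultimately show ?thesis by simp
qed

lemma card_line_zeros_le:
  fixes p :: "complex poly" and k :: real
  assumes "p \<noteq> 0" "k \<noteq> 0"
  shows "finite {u :: real. poly p (of_real a + \<i> * of_real k * of_real u) = 0}"
    and "card {u :: real. poly p (of_real a + \<i> * of_real k * of_real u) = 0} \<le> degree p"
proof -
  define g where "g u = complex_of_real a + \<i> * of_real k * of_real u" for u
  have inj: "inj_on g S" for S using assms(2) by (auto simp: g_def inj_on_def)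
  have fin: "finite {x. poly p x = 0}" using assms(1) by (rule poly_roots_finite)
  have sub: "g ` {u. poly p (g u) = 0} \<subseteq> {x. poly p x = 0}" by auto
  have "finite {u. poly p (g u) = 0}" by (rule finite_imageD[OF finite_subset[OF sub fin] inj])
  moreover have "card {u. poly p (g u) = 0} \<le> degree p"
    using card_inj_on_le[OF inj sub fin] card_poly_roots_bound[OF assms(1)] by simp
  ultimately show "finite {u :: real. poly p (of_real a + \<i> * of_real k * of_real u) = 0}"
    "card {u :: real. poly p (of_real a + \<i> * of_real k * of_real u) = 0} \<le> degree p"
    by (simp_all add: g_def)
qed

lemma card_pos_symmetric_le:
  fixes Z :: "real set"
  assumes "finite Z" "\<And>u. u \<in> Z \<Longrightarrow> - u \<in> Z" "card Z \<le> n"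
  shows "real (card (Z \<inter> {0<..})) \<le> real n / 2"
proof -
  have "uminus ` (Z \<inter> {0<..}) \<subseteq> Z \<inter> {..<0}" using assms(2) by auto
  hence "card (Z \<inter> {0<..}) \<le> card (Z \<inter> {..<0})"
    using assms(1) by (intro card_inj_on_le[of uminus]) auto
  moreover have "card (Z \<inter> {0<..}) + card (Z \<inter> {..<0}) = card ((Z \<inter> {0<..}) \<union> (Z \<inter> {..<0}))"
    using assms(1) by (intro card_Un_disjoint[symmetric]) auto
  moreover have "card ((Z \<inter> {0<..}) \<union> (Z \<inter> {..<0})) \<le> card Z"
    using assms(1) by (intro card_mono) auto
  ultimately have "2 * card (Z \<inter> {0<..}) \<le> n" using assms(3) by linarith
  thus ?thesis by linarith
qed

text \<open>The upper bound on (x, y) comes from the lower bounds on neighbouring intervals (a, x)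
  and (y, b): if these nearly exhaust (0, T), the total 1/2 leaves no room for additional
  points.\<close>

lemma counting_squeeze:
  fixes Z :: "nat \<Rightarrow> real set" and \<Theta> :: "real \<Rightarrow> real"
  assumes low: "\<And>a b \<eta>. \<lbrakk>0 < a; a < b; b < T; \<eta> > 0\<rbrakk> \<Longrightarrow>
      \<forall>\<^sub>F n in sequentially. \<Theta> b - \<Theta> a - \<eta> \<le> real (card (Z n \<inter> {a<..<b})) / real n"
    and up: "\<And>n. finite (Z n)" "\<And>n. real (card (Z n \<inter> {0<..})) \<le> real n / 2"
    and lim: "(\<Theta> \<longlongrightarrow> 0) (at_right 0)" "(\<Theta> \<longlongrightarrow> 1 / 2) (at_left T)"
    and xy: "0 < x" "x < y" "y < T"
  shows "(\<lambda>n. real (card (Z n \<inter> {x<..<y})) / real n) \<longlonglongrightarrow> \<Theta> y - \<Theta> x"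
proof (rule LIMSEQ_I)
  fix r :: real assume r: "r > 0"
  \<comment> \<open>The upper estimate loses less than 4 eta: one for each outer interval and one
    for each of the end values at a and b.\<close>
  define \<eta> where "\<eta> = r / 8"
  have \<eta>: "\<eta> > 0" using r by (simp add: \<eta>_def)
  have "\<forall>\<^sub>F a in at_right 0. \<Theta> a < \<eta>" using lim(1) \<eta> by (rule order_tendstoD)
  moreover have "\<forall>\<^sub>F a in at_right 0. a \<in> {0<..<x}" using xy(1) by (rule eventually_at_right_real)
  ultimately have "\<forall>\<^sub>F a in at_right 0. \<Theta> a < \<eta> \<and> a \<in> {0<..<x}" by (rule eventually_conj)
  from eventually_happens'[OF trivial_limit_at_right_real this]
  obtain a where a: "\<Theta> a < \<eta>" "0 < a" "a < x" by auto
  have "\<forall>\<^sub>F b in at_left T. \<Theta> b > 1 / 2 - \<eta>" using lim(2) \<eta> by (intro order_tendstoD(1)[OF lim(2)]) simp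
  moreover have "\<forall>\<^sub>F b in at_left T. b \<in> {y<..<T}" using xy(3) by (rule eventually_at_left_real)
  ultimately have "\<forall>\<^sub>F b in at_left T. \<Theta> b > 1 / 2 - \<eta> \<and> b \<in> {y<..<T}" by (rule eventually_conj)
  from eventually_happens'[OF trivial_limit_at_left_real this]
  obtain b where b: "\<Theta> b > 1 / 2 - \<eta>" "y < b" "b < T" by auto
  have axT: "x < T" "0 < y" using xy by auto
  have "\<forall>\<^sub>F n in sequentially. norm (real (card (Z n \<inter> {x<..<y})) / real n - (\<Theta> y - \<Theta> x)) < r"
    using low[OF a(2,3) axT(1) \<eta>] low[OF xy \<eta>] low[OF axT(2) b(2,3) \<eta>] eventually_gt_at_top[of "0::nat"]
  proof eventually_elim
    case (elim n)
    define A B C where "A = Z n \<inter> {a<..<x}" and "B = Z n \<inter> {x<..<y}" and "C = Z n \<inter> {y<..<b}"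
    have fin: "finite A" "finite B" "finite C" using up(1) by (auto simp: A_def B_def C_def)
    have "card A + card B + card C = card (A \<union> B \<union> C)"
      using fin xy by (subst card_Un_disjoint; (subst card_Un_disjoint)?) (auto simp: A_def B_def C_def)
    also have "\<dots> \<le> card (Z n \<inter> {0<..})"
      using up(1)[of n] a b xy by (intro card_mono) (auto simp: A_def B_def C_def)
    finally have "real (card A) + real (card B) + real (card C) \<le> real n / 2" using up(2)[of n] by linarith
    hence "(real (card A) + real (card B) + real (card C)) / real n \<le> (real n / 2) / real n"
      using elim(4) by (intro divide_right_mono) auto
    hence sum: "real (card A) / real n + real (card B) / real n + real (card C) / real n \<le> 1 / 2"
      using elim(4) by (simp add: add_divide_distrib)
    have l: "\<Theta> x - \<Theta> a - \<eta> \<le> real (card A) / real n" "\<Theta> y - \<Theta> x - \<eta> \<le> real (card B) / real n"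
       "\<Theta> b - \<Theta> y - \<eta> \<le> real (card C) / real n"
      using elim by (simp_all add: A_def B_def C_def)
    have "8 * \<eta> = r" by (simp add: \<eta>_def)
    hence "\<bar>real (card B) / real n - (\<Theta> y - \<Theta> x)\<bar> < r"
      using l sum a(1) b(1) \<eta> by linarith
    thus ?case by (simp add: B_def)
  qed
  thus "\<exists>no. \<forall>n\<ge>no. norm (real (card (Z n \<inter> {x<..<y})) / real n - (\<Theta> y - \<Theta> x)) < r"
    by (simp add: eventually_sequentially)
qed

text \<open>With a = p + c and b = q + c this is G = h e^(c f): because p' = p + 2 c, the factors z1
  - z and z1 + z receive the same exponent, and likewise for z2. Written with \<open>exp\<close> and
  \<open>Ln\<close> it is visibly even in z and never 0.\<close>

definition even_weight :: "real \<Rightarrow> real \<Rightarrow> real \<Rightarrow> real \<Rightarrow> nat \<Rightarrow> (nat \<Rightarrow> real) \<Rightarrow> (nat \<Rightarrow> real) \<Rightarrow> complex \<Rightarrow> complex" where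
  "even_weight z1 z2 a b m \<alpha> r z =
     exp (of_real a * (Ln (of_real z1 - z) + Ln (of_real z1 + z)) + of_real b * (Ln (of_real z2 - z) + Ln (of_real z2 + z))) *
     (\<Prod>i=1..m. exp (of_real (r i) * Ln (of_real (\<alpha> i) - z\<^sup>2)))"

section \<open>The saddle point curve\<close>

locale two_radii =
  fixes z1 z2 :: real
  assumes z1_pos: "0 < z1" and z1_less: "z1 < z2"
begin

definition \<sigma> :: real where "\<sigma> = z1 + z2"

definition P :: real where "P = z1 * z2"

abbreviation "\<tau> \<equiv> T1 z1 z2"
abbreviation "\<zeta> \<equiv> zeta z1 z2"
abbreviation "f \<equiv> f_fun z1 z2"
abbreviation "T \<equiv> T_end z1 z2"

definition B :: real where "B = 1 - \<tau>\<^sup>2"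

(* The saddle point equation becomes quadratic in V = (zeta - z1 z2 / zeta) / sigma. *)
definition V :: "real \<Rightarrow> complex" where
  "V t = (if t < \<tau> then \<i> * of_real t - of_real (sqrt (\<tau>\<^sup>2 - t\<^sup>2))
          else \<i> * of_real t + \<i> * of_real (sqrt (t\<^sup>2 - \<tau>\<^sup>2)))"

text \<open>The companion of V: it will turn out to be (zeta + P / zeta) / sigma.\<close>

definition Q :: "real \<Rightarrow> complex" where
  "Q t = csqrt ((V t)\<^sup>2 + of_real B)"

section \<open>Algebra of V and Q, and the position of zeta(t)\<close>

lemma z2_pos: "0 < z2" and sigma_pos: "0 < \<sigma>" and P_pos: "0 < P"
  using z1_pos z1_less by (auto simp: \<sigma>_def P_def)

lemma tau_pos: "0 < \<tau>"
  using z1_pos z1_less by (auto simp: T1_def field_simps)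

lemma B_eq: "B = 4 * P / \<sigma>\<^sup>2"
proof -
  have "(z1 + z2)\<^sup>2 \<noteq> 0" using z1_pos z2_pos by simp
  thus ?thesis
    by (simp add: B_def \<sigma>_def P_def T1_def power_divide field_simps) (simp add: power2_eq_square algebra_simps)
qed

lemma B_pos: "0 < B"
  unfolding B_eq using P_pos sigma_pos by simp

text \<open>This is the saddle point equation in disguise. Its roots are i t +- sqrt (tau^2 - t^2);
  V takes the one with negative real part before tau and the higher one on the imaginary axis after
  tau.\<close>

lemma V_quad:
  assumes "0 \<le> t" shows "(V t)\<^sup>2 = 2 * \<i> * of_real t * V t + of_real (\<tau>\<^sup>2)"
proof (cases "t < \<tau>")
  case True
  hence "t\<^sup>2 \<le> \<tau>\<^sup>2" using assms by (simp add: power_mono)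
  hence s: "(complex_of_real (sqrt (\<tau>\<^sup>2 - t\<^sup>2)))\<^sup>2 = of_real (\<tau>\<^sup>2 - t\<^sup>2)"
    by (simp flip: of_real_power)
  show ?thesis using True s
    by (simp add: V_def power2_diff power_mult_distrib algebra_simps)
       (simp add: power2_eq_square algebra_simps)
next
  case False
  hence "\<tau>\<^sup>2 \<le> t\<^sup>2" using tau_pos by (simp add: power_mono)
  hence s: "(complex_of_real (sqrt (t\<^sup>2 - \<tau>\<^sup>2)))\<^sup>2 = of_real (t\<^sup>2 - \<tau>\<^sup>2)"
    by (simp flip: of_real_power)
  show ?thesis using False s
    by (simp add: V_def power2_sum power_mult_distrib algebra_simps)
       (simp add: power2_eq_square algebra_simps)
qed

lemma Q_sq: "(Q t)\<^sup>2 = (V t)\<^sup>2 + of_real B"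
  by (simp add: Q_def)

text \<open>Since tau^2 + B = 1, \<open>V_quad\<close> turns the radicand 1 + 2 i t V in
  \<open>zeta\<close> into V^2 + B.\<close>

lemma zeta_eq:
  assumes "0 \<le> t" shows "\<zeta> t = of_real (\<sigma> / 2) * (V t + Q t)"
proof -
  have "1 - 2 * (complex_of_real t)\<^sup>2 - 2 * \<i> * of_real t * of_real (sqrt (\<tau>\<^sup>2 - t\<^sup>2)) =
     (V t)\<^sup>2 + of_real B" if "t < \<tau>"
    unfolding V_quad[OF assms] using that
    by (simp add: V_def B_def algebra_simps power2_eq_square)
  moreover have "1 - 2 * (complex_of_real t)\<^sup>2 - 2 * of_real t * of_real (sqrt (t\<^sup>2 - \<tau>\<^sup>2)) =
     (V t)\<^sup>2 + of_real B" if "\<not> t < \<tau>"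
    unfolding V_quad[OF assms] using that
    by (simp add: V_def B_def algebra_simps power2_eq_square)
  ultimately show ?thesis unfolding zeta_def Q_def \<sigma>_def 
    by (cases "t < \<tau>") (simp_all add: V_def)
qed

text \<open>As B = 4 P / sigma^2, this identifies sigma / 2 * (Q t - V t) with P / zeta t, so V and
  Q are difference and sum of zeta and P / zeta, up to the factor sigma.\<close>

lemma V_plus_Q_times: "(V t + Q t) * (Q t - V t) = of_real B"
  using Q_sq[of t] by (simp add: algebra_simps power2_eq_square)

lemma zeta_nz: assumes "0 \<le> t" shows "\<zeta> t \<noteq> 0"
proof -
  have "complex_of_real B \<noteq> 0" using B_pos by simp
  hence "V t + Q t \<noteq> 0"
    using V_plus_Q_times[of t] by (metis mult_zero_left)
  thus ?thesis unfolding zeta_eq[OF assms] using sigma_pos by simp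
qed

lemma P_eq: "complex_of_real P = of_real (\<sigma>\<^sup>2 / 4) * ((V t + Q t) * (Q t - V t))"
  unfolding V_plus_Q_times B_eq using sigma_pos by simp

lemma zeta_minus:
  assumes "0 \<le> t" shows "(\<zeta> t)\<^sup>2 - of_real P = of_real \<sigma> * V t * \<zeta> t"
  unfolding zeta_eq[OF assms] P_eq[of t] 
  by (simp add: field_simps power2_eq_square)

lemma zeta_plus:
  assumes "0 \<le> t" shows "(\<zeta> t)\<^sup>2 + of_real P = of_real \<sigma> * Q t * \<zeta> t"
  unfolding zeta_eq[OF assms] P_eq[of t]
  by (simp add: field_simps power2_eq_square)

lemma V_Q_inverse:
  assumes "0 \<le> t" 
  shows "of_real \<sigma> * V t = \<zeta> t - of_real P / \<zeta> t" 
        "of_real \<sigma> * Q t = \<zeta> t + of_real P / \<zeta> t"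
  using zeta_minus[OF assms] zeta_plus[OF assms] zeta_nz[OF assms]
  by (simp_all add: field_simps power2_eq_square)

lemma Re_inverse_part:
  "Re (z - of_real a / z) = Re z * (1 - a / (cmod z)\<^sup>2)"
  "Im (z - of_real a / z) = Im z * (1 + a / (cmod z)\<^sup>2)"
  "Re (z + of_real a / z) = Re z * (1 + a / (cmod z)\<^sup>2)"
  "Im (z + of_real a / z) = Im z * (1 - a / (cmod z)\<^sup>2)"
  by (simp_all add: Re_divide Im_divide cmod_power2 algebra_simps)

text \<open>V and Q are Joukowski images of zeta. The signs of their parts therefore reveal the
  quadrant of zeta and on which side of the circle |z|^2 = P it lies.\<close>

lemma parts_zeta:
  assumes "0 \<le> t" 
  shows "\<sigma> * Re (V t) = Re (\<zeta> t) * (1 - P / (cmod (\<zeta> t))\<^sup>2)"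
        "\<sigma> * Im (V t) = Im (\<zeta> t) * (1 + P / (cmod (\<zeta> t))\<^sup>2)"
        "\<sigma> * Re (Q t) = Re (\<zeta> t) * (1 + P / (cmod (\<zeta> t))\<^sup>2)"
        "\<sigma> * Im (Q t) = Im (\<zeta> t) * (1 - P / (cmod (\<zeta> t))\<^sup>2)"
proof -
  have 1: "of_real \<sigma> * V t = \<zeta> t - of_real P / \<zeta> t" 
       and 2: "of_real \<sigma> * Q t = \<zeta> t + of_real P / \<zeta> t"
    using V_Q_inverse[OF assms] by auto
  have "Re (of_real \<sigma> * V t) = \<sigma> * Re (V t)" "Im (of_real \<sigma> * V t) = \<sigma> * Im (V t)"
       "Re (of_real \<sigma> * Q t) = \<sigma> * Re (Q t)" "Im (of_real \<sigma> * Q t) = \<sigma> * Im (Q t)"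
    by simp_all
  thus "\<sigma> * Re (V t) = Re (\<zeta> t) * (1 - P / (cmod (\<zeta> t))\<^sup>2)"
        "\<sigma> * Im (V t) = Im (\<zeta> t) * (1 + P / (cmod (\<zeta> t))\<^sup>2)"
        "\<sigma> * Re (Q t) = Re (\<zeta> t) * (1 + P / (cmod (\<zeta> t))\<^sup>2)"
        "\<sigma> * Im (Q t) = Im (\<zeta> t) * (1 - P / (cmod (\<zeta> t))\<^sup>2)"
    using 1 2 Re_inverse_part[of "\<zeta> t" "P"] by metis+
qed

lemma cmod_factor_pos: "1 + P / (cmod w)\<^sup>2 > 0"
  using P_pos by (simp add: add_pos_nonneg)

text \<open>Put b = sqrt B = 2 sqrt P / sigma. Then T2 = 1 / (2 b) and (b - t)^2 - (t^2 - tau^2) = 1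
  - 2 b t, so T2 is the time at which t + sqrt (t^2 - tau^2) would reach b. The case condition z1^2
  - 6 z1 z2 + z2^2 < 0 is sigma^2 < 8 P, that is b^2 > 1/2, and gives T2 < b.\<close>

lemma after_tau:
  assumes "\<tau> \<le> t" "t < T"
  shows "(t + sqrt (t\<^sup>2 - \<tau>\<^sup>2))\<^sup>2 < B" "T = T2 z1 z2" "\<sigma>\<^sup>2 < 8 * P"
proof -
  have cond: "\<not> z1\<^sup>2 - 6 * z1 * z2 + z2\<^sup>2 \<ge> 0"
    using assms by (auto simp: T_end_def)
  thus T: "T = T2 z1 z2" by (simp add: T_end_def)
  show s8: "\<sigma>\<^sup>2 < 8 * P" using cond by (simp add: \<sigma>_def P_def power2_eq_square algebra_simps)
  define b where "b = 2 * sqrt P / \<sigma>"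
  have b0: "b > 0" using P_pos sigma_pos by (simp add: b_def)
  have b2: "b\<^sup>2 = B" unfolding B_eq b_def
    using P_pos by (simp add: power_divide power_mult_distrib)
  have T2b: "T2 z1 z2 = 1 / (2 * b)"
    using P_pos sigma_pos by (simp add: T2_def b_def field_simps \<sigma>_def P_def)
  have "b\<^sup>2 > 1/2" unfolding b2 B_eq using s8 sigma_pos by (simp add: field_simps)
  hence "1 / (2 * b) < b" using b0 by (simp add: field_simps power2_eq_square)
  hence tb: "t < b" using assms(2) unfolding T T2b by simp
  have tb2: "2 * b * t < 1" using assms(2) b0 unfolding T T2b by (simp add: field_simps)
  have "t\<^sup>2 - \<tau>\<^sup>2 < (b - t)\<^sup>2" using tb2 b2 by (simp add: B_def power2_diff algebra_simps)
  hence "sqrt (t\<^sup>2 - \<tau>\<^sup>2) < b - t" using tb by (simp add: real_less_lsqrt)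
  hence "t + sqrt (t\<^sup>2 - \<tau>\<^sup>2) < b" by simp
  moreover have "0 \<le> t + sqrt (t\<^sup>2 - \<tau>\<^sup>2)" using assms tau_pos
    by (smt (verit, best) power_mono real_sqrt_ge_zero)
  ultimately show "(t + sqrt (t\<^sup>2 - \<tau>\<^sup>2))\<^sup>2 < B"
    unfolding b2[symmetric] by (simp add: power_strict_mono)
qed

lemma Q_arg_before:
  assumes "0 \<le> t" "t < \<tau>"
  shows "Im ((V t)\<^sup>2 + of_real B) = - 2 * t * sqrt (\<tau>\<^sup>2 - t\<^sup>2)"
  unfolding V_quad[OF assms(1)] using assms by (simp add: V_def)

lemma V_sq_after:
  assumes "\<tau> \<le> t"
  shows "(V t)\<^sup>2 = - of_real ((t + sqrt (t\<^sup>2 - \<tau>\<^sup>2))\<^sup>2)"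
proof -
  have "(\<i> * a + \<i> * b)\<^sup>2 = - (a + b)\<^sup>2" for a b :: complex
    by (simp add: power2_eq_square algebra_simps)
  thus ?thesis using assms by (simp add: V_def)
qed

text \<open>Before tau the radicand is off the real axis, afterwards it is real and positive, so the
  whole curve uses \<open>csqrt\<close> where it is holomorphic.\<close>

lemma Q_arg_slit:
  assumes "0 < t" "t < T"
  shows "(V t)\<^sup>2 + of_real B \<notin> \<real>\<^sub>\<le>\<^sub>0"
proof (cases "t < \<tau>")
  case True
  hence "t\<^sup>2 < \<tau>\<^sup>2" using assms(1) by (simp add: power_strict_mono)
  hence "Im ((V t)\<^sup>2 + of_real B) \<noteq> 0"
    using Q_arg_before[of t] True assms(1) by simp
  thus ?thesis by (auto simp: complex_nonpos_Reals_iff)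
next
  case False
  hence "Re ((V t)\<^sup>2 + of_real B) > 0"
    unfolding V_sq_after[OF False[unfolded not_less]]
    using after_tau(1)[of t] assms by simp
  thus ?thesis by (auto simp: complex_nonpos_Reals_iff)
qed

lemma Re_Q_pos:
  assumes "0 < t" "t < T"
  shows "Re (Q t) > 0"
proof (rule ccontr)
  assume "\<not> ?thesis"
  moreover have "Re (Q t) \<ge> 0" unfolding Q_def using csqrt_principal[of "((V t)\<^sup>2 + of_real B)"] by auto
  ultimately have "Re (Q t) = 0" by simp
  hence "(Q t)\<^sup>2 \<in> \<real>\<^sub>\<le>\<^sub>0" by (auto simp: complex_nonpos_Reals_iff power2_eq_square)
  thus False using Q_arg_slit[OF assms] Q_sq by simp
qed

lemma Re_zeta_pos: assumes "0 < t" "t < T" shows "Re (\<zeta> t) > 0"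
  using parts_zeta(3)[of t] Re_Q_pos[OF assms] cmod_factor_pos[of "\<zeta> t"] sigma_pos assms(1)
  by (smt (verit) mult_pos_pos zero_less_mult_pos2)

lemma Im_V_ge: assumes "0 < t" shows "Im (V t) \<ge> t" "t < \<tau> \<Longrightarrow> Im (V t) = t"
proof -
  have "t\<^sup>2 \<ge> \<tau>\<^sup>2" if "\<not> t < \<tau>" using that tau_pos by (simp add: power_mono)
  thus "Im (V t) \<ge> t" "t < \<tau> \<Longrightarrow> Im (V t) = t" by (auto simp: V_def)
qed

lemma Im_zeta_pos: assumes "0 < t" shows "Im (\<zeta> t) > 0"
proof -
  have "\<sigma> * Im (V t) > 0" using sigma_pos Im_V_ge(1)[OF assms] assms by simp
  thus ?thesis using parts_zeta(2)[of t] cmod_factor_pos[of "\<zeta> t"] assms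
    by (smt (verit) mult_pos_pos zero_less_mult_pos2)
qed

lemma cmod_zeta_before:
  assumes "0 < t" "t < \<tau>" "t < T" shows "(cmod (\<zeta> t))\<^sup>2 < P"
proof -
  have "t\<^sup>2 < \<tau>\<^sup>2" using assms by (simp add: power_strict_mono)
  hence "\<sigma> * Re (V t) < 0" using sigma_pos assms(2) by (simp add: V_def mult_pos_neg)
  hence "Re (\<zeta> t) * (1 - P / (cmod (\<zeta> t))\<^sup>2) < 0" using parts_zeta(1)[of t] assms by simp
  hence "1 - P / (cmod (\<zeta> t))\<^sup>2 < 0" using Re_zeta_pos[of t] assms
    by (simp add: mult_less_0_iff)
  thus ?thesis using zeta_nz[of t] assms by (simp add: field_simps)
qed

lemma cmod_zeta_after:
  assumes "\<tau> \<le> t" "t < T" shows "(cmod (\<zeta> t))\<^sup>2 = P"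
proof -
  have "0 < t" using assms tau_pos by simp
  have "\<sigma> * Re (V t) = 0" using assms(1) by (simp add: V_def)
  hence "1 - P / (cmod (\<zeta> t))\<^sup>2 = 0" 
    using parts_zeta(1)[of t] Re_zeta_pos[of t] assms \<open>0 < t\<close>
    by (metis less_imp_le mult_eq_0_iff order_less_irrefl)
  thus ?thesis using zeta_nz[of t] \<open>0 < t\<close> by (metis P_pos divide_eq_1_iff eq_iff_diff_eq_0 order_less_irrefl)
qed

section \<open>Derivative of the curve\<close>

lemma V_nz: assumes "0 < t" shows "V t \<noteq> 0"
  using Im_V_ge(1)[OF assms] assms by auto

text \<open>The square root in the denominator vanishes at tau, where the two roots of the quadratic
  for V coincide; all derivatives along the curve therefore exclude tau.\<close>

definition V' :: "real \<Rightarrow> complex" where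
  "V' t = (if t < \<tau> then - \<i> * V t / of_real (sqrt (\<tau>\<^sup>2 - t\<^sup>2)) else V t / of_real (sqrt (t\<^sup>2 - \<tau>\<^sup>2)))"

lemma has_vector_derivative_V:
  assumes "0 < t" "t \<noteq> \<tau>"
  shows "(V has_vector_derivative V' t) (at t)"
proof (cases "t < \<tau>")
  case True
  have "t\<^sup>2 < \<tau>\<^sup>2" using True assms by (simp add: power_strict_mono)
  define s where "s = sqrt (\<tau>\<^sup>2 - t\<^sup>2)"
  have s0: "s > 0" using \<open>t\<^sup>2 < \<tau>\<^sup>2\<close> by (simp add: s_def)
  have d: "((\<lambda>t. sqrt (\<tau>\<^sup>2 - t\<^sup>2)) has_real_derivative - t / s) (at t)"
    using \<open>t\<^sup>2 < \<tau>\<^sup>2\<close> unfolding s_def by (auto intro!: derivative_eq_intros simp: field_simps)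
  have "((\<lambda>t. \<i> * of_real t - of_real (sqrt (\<tau>\<^sup>2 - t\<^sup>2))) has_vector_derivative
       (\<i> * 1 - of_real (- t / s))) (at t)"
    using d by (intro has_vector_derivative_diff has_vector_derivative_mult_right
      has_vector_derivative_of_real has_real_derivative_iff_has_vector_derivative[THEN iffD1])
      (auto intro!: derivative_eq_intros)
  moreover have "\<i> * 1 - of_real (- t / s) = V' t"
    using True s0 by (simp add: V'_def V_def flip: s_def) (simp add: field_simps)
  ultimately have "((\<lambda>t. \<i> * of_real t - of_real (sqrt (\<tau>\<^sup>2 - t\<^sup>2))) has_vector_derivative V' t) (at t)"
    by simp
  thus ?thesis
    by (rule has_vector_derivative_transform_within_open[of _ _ _ "{..<\<tau>}"])
       (use True in \<open>auto simp: V_def\<close>)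
next
  case False
  hence gt: "t > \<tau>" using assms by simp
  have "\<tau>\<^sup>2 < t\<^sup>2" using gt tau_pos by (simp add: power_strict_mono)
  define s where "s = sqrt (t\<^sup>2 - \<tau>\<^sup>2)"
  have s0: "s > 0" using \<open>\<tau>\<^sup>2 < t\<^sup>2\<close> by (simp add: s_def)
  have d: "((\<lambda>t. sqrt (t\<^sup>2 - \<tau>\<^sup>2)) has_real_derivative t / s) (at t)"
    using \<open>\<tau>\<^sup>2 < t\<^sup>2\<close> unfolding s_def by (auto intro!: derivative_eq_intros simp: field_simps)
  have "((\<lambda>t. \<i> * of_real t + \<i> * of_real (sqrt (t\<^sup>2 - \<tau>\<^sup>2))) has_vector_derivative
       (\<i> * 1 + \<i> * of_real (t / s))) (at t)"
    using d by (intro has_vector_derivative_add has_vector_derivative_mult_right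
      has_vector_derivative_of_real has_real_derivative_iff_has_vector_derivative[THEN iffD1])
      (auto intro!: derivative_eq_intros)
  moreover have "\<i> * 1 + \<i> * of_real (t / s) = V' t"
    using False s0 by (simp add: V'_def V_def flip: s_def) (simp add: field_simps)
  ultimately have "((\<lambda>t. \<i> * of_real t + \<i> * of_real (sqrt (t\<^sup>2 - \<tau>\<^sup>2))) has_vector_derivative V' t) (at t)"
    by simp
  thus ?thesis
    by (rule has_vector_derivative_transform_within_open[of _ _ _ "{\<tau><..}"])
       (use gt in \<open>auto simp: V_def\<close>)
qed

lemma Q_nz: assumes "0 < t" "t < T" shows "Q t \<noteq> 0"
  using Re_Q_pos[OF assms] by auto

text \<open>Since sigma / 2 * (1 + V / Q) = zeta / Q, the logarithmic derivative of zeta is simply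
  V' / Q.\<close>

lemma has_vector_derivative_zeta:
  assumes "0 < t" "t < T" "t \<noteq> \<tau>"
  shows "(\<zeta> has_vector_derivative (\<zeta> t * (V' t / Q t))) (at t)"
proof -
  have "((\<lambda>w. of_real (\<sigma>/2) * (w + csqrt (w\<^sup>2 + of_real B))) has_field_derivative
        of_real (\<sigma>/2) * (1 + V t / Q t)) (at (V t))"
    using Q_arg_slit[OF assms(1,2)] Q_nz[OF assms(1,2)]
    by (auto intro!: derivative_eq_intros simp add: Q_def)
  hence "((\<lambda>w. of_real (\<sigma>/2) * (w + csqrt (w\<^sup>2 + of_real B))) \<circ> V has_vector_derivative
        (V' t * (of_real (\<sigma>/2) * (1 + V t / Q t)))) (at t)"
    by (intro field_vector_diff_chain_at has_vector_derivative_V) (use assms in auto)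
  moreover have "V' t * (of_real (\<sigma>/2) * (1 + V t / Q t)) = \<zeta> t * (V' t / Q t)"
    using zeta_eq[of t] assms(1) Q_nz[OF assms(1,2)] by (simp add: divide_simps)
  ultimately have "((\<lambda>w. of_real (\<sigma>/2) * (w + csqrt (w\<^sup>2 + of_real B))) \<circ> V has_vector_derivative
      \<zeta> t * (V' t / Q t)) (at t)" by simp
  thus ?thesis
    by (rule has_vector_derivative_transform_within_open[of _ _ _ "{0<..}"])
       (use assms in \<open>auto simp: zeta_eq Q_def\<close>)
qed

lemma isCont_V: assumes "0 < t" shows "isCont V t"
proof -
  have c1: "continuous_on {0..\<tau>} (\<lambda>t. \<i> * complex_of_real t - of_real (sqrt (\<tau>\<^sup>2 - t\<^sup>2)))"
    by (intro continuous_intros)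
  have c2: "continuous_on {\<tau>..} (\<lambda>t. \<i> * complex_of_real t + \<i> * of_real (sqrt (t\<^sup>2 - \<tau>\<^sup>2)))"
    by (intro continuous_intros)
  have "continuous_on ({0..\<tau>} \<union> {\<tau>..})
     (\<lambda>t. if t < \<tau> then \<i> * complex_of_real t - of_real (sqrt (\<tau>\<^sup>2 - t\<^sup>2)) 
          else \<i> * complex_of_real t + \<i> * of_real (sqrt (t\<^sup>2 - \<tau>\<^sup>2)))"
  proof (rule continuous_on_cases[OF _ _ c1 c2], goal_cases)
    case 3
    have "x = \<tau>" if "x \<in> {0..\<tau>} \<and> \<not> x < \<tau> \<or> x \<in> {\<tau>..} \<and> x < \<tau>" for x using that by auto
    thus ?case by auto
  qed auto
  hence "continuous_on {0<..} V" 
    unfolding V_def by (rule continuous_on_subset) auto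
  thus ?thesis using assms by (simp add: continuous_on_eq_continuous_at)
qed

lemma isCont_zeta:
  assumes "0 < t" "t < T" shows "isCont \<zeta> t"
proof -
  have "isCont (\<lambda>t. of_real (\<sigma> / 2) * (V t + csqrt ((V t)\<^sup>2 + of_real B))) t"
    using isCont_V[OF assms(1)] Q_arg_slit[OF assms]
    by (intro continuous_intros isCont_o2[OF isCont_V[OF assms(1)]]) auto
  moreover have "\<forall>\<^sub>F x in nhds t. \<zeta> x = of_real (\<sigma> / 2) * (V x + csqrt ((V x)\<^sup>2 + of_real B))"
    using eventually_nhds_in_open[of "{0<..}" t] assms(1)
    by (auto elim!: eventually_mono simp: zeta_eq Q_def)
  ultimately show ?thesis using isCont_cong by fastforce
qed

text \<open>V / Q = (zeta^2 - P) / (zeta^2 + P) has positive imaginary part because zeta lies in the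
  open first quadrant, and V' is - i V over a positive number. So |zeta| increases up to
  tau.\<close>

lemma log_deriv_zeta_before:
  assumes "0 < t" "t < \<tau>" "t < T"
  shows "Re (V' t / Q t) > 0"
proof -
  have "t\<^sup>2 < \<tau>\<^sup>2" using assms by (simp add: power_strict_mono)
  define s where "s = sqrt (\<tau>\<^sup>2 - t\<^sup>2)"
  have s0: "s > 0" using \<open>t\<^sup>2 < \<tau>\<^sup>2\<close> by (simp add: s_def)
  define w where "w = \<zeta> t"
  have w: "Re w > 0" "Im w > 0" using Re_zeta_pos[of t] Im_zeta_pos[of t] assms by (auto simp: w_def)
  have vq: "V t / Q t = (w\<^sup>2 - of_real (P)) / (w\<^sup>2 + of_real (P))"
    using zeta_minus[of t] zeta_plus[of t] zeta_nz[of t] assms sigma_pos Q_nz[of t]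
    by (simp add: w_def mult_ac)
  have "w\<^sup>2 + of_real (P) \<noteq> 0"
    using zeta_plus[of t] zeta_nz[of t] assms sigma_pos Q_nz[of t]
    by (auto simp: w_def)
  hence n: "(cmod (w\<^sup>2 + of_real (P)))\<^sup>2 > 0" by simp
  have "Im (V t / Q t) = 4 * Re w * Im w * P / (cmod (w\<^sup>2 + of_real (P)))\<^sup>2"
    unfolding vq by (simp add: Im_divide cmod_power2) (simp add: power2_eq_square algebra_simps)
  also have "\<dots> > 0" using n w P_pos by simp
  finally have Im_pos: "Im (V t / Q t) > 0" .
  have "V' t / Q t = of_real (1 / s) * (- \<i> * (V t / Q t))"
    using assms by (simp add: V'_def s_def)
  moreover have "Re (of_real a * (- \<i> * w)) = a * Im w" for a w by simp
  ultimately have "Re (V' t / Q t) = (1 / s) * Im (V t / Q t)"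
    by metis
  thus ?thesis using s0 Im_pos by simp
qed

text \<open>Here V' is positive imaginary and Q is positive: zeta runs counterclockwise on the
  circle |z|^2 = P.\<close>

lemma log_deriv_zeta_after:
  assumes "\<tau> < t" "t < T"
  shows "Re (V' t / Q t) = 0" "Im (V' t / Q t) > 0"
proof -
  have t0: "t > 0" using assms tau_pos by simp
  have "\<tau>\<^sup>2 < t\<^sup>2" using assms tau_pos by (simp add: power_strict_mono)
  define s where "s = sqrt (t\<^sup>2 - \<tau>\<^sup>2)"
  have s0: "s > 0" using \<open>\<tau>\<^sup>2 < t\<^sup>2\<close> by (simp add: s_def)
  have Vp: "V' t = \<i> * of_real ((t + s) / s)"
    using assms s0 by (simp add: V'_def V_def flip: s_def) (simp add: field_simps)
  define q where "q = sqrt (B - (t + s)\<^sup>2)"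
  have "B - (t + s)\<^sup>2 > 0" using after_tau(1)[of t] assms by (simp add: s_def)
  hence q0: "q > 0" by (simp add: q_def)
  have "Q t = csqrt (of_real (B - (t + s)\<^sup>2))"
    unfolding Q_def using V_sq_after[of t] assms by (simp add: s_def)
  hence Qt: "Q t = of_real q"
    unfolding q_def by (simp only:, subst csqrt_of_real_nonneg) (use \<open>B - (t + s)\<^sup>2 > 0\<close> in simp_all)
  have "V' t / Q t = \<i> * of_real ((t + s) / s / q)" unfolding Vp Qt by simp
  thus "Re (V' t / Q t) = 0" "Im (V' t / Q t) > 0" using t0 s0 q0 by simp_all
qed

section \<open>The function f, its domains and the critical point equation\<close>

lemma T_pos: "0 < T"
  using tau_pos z1_pos z2_pos by (auto simp: T_end_def T2_def)

(* Unlike Dsym, on which f is holomorphic, D omits the negative real axis, so that Ln is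
   holomorphic on it as well. *)
definition D :: "complex set" where
  "D = {z. Im z \<noteq> 0 \<or> (0 < Re z \<and> Re z < z1)}"

definition Dsym :: "complex set" where
  "Dsym = {z. Im z \<noteq> 0 \<or> \<bar>Re z\<bar> < z1}"

lemma D_subset: "D \<subseteq> Dsym" by (auto simp: D_def Dsym_def)

lemma open_D: "open D"
proof -
  have "D = - {z. Im z = 0} \<union> ({z. 0 < Re z} \<inter> {z. Re z < z1})" by (auto simp: D_def)
  moreover have "closed {z. Im z = 0}" by (intro closed_Collect_eq continuous_intros)
  ultimately show ?thesis
    by (auto intro!: open_Un open_Int open_halfspace_Re_gt open_halfspace_Re_lt)
qed

lemma open_Dsym: "open Dsym"
proof -
  have "Dsym = - {z. Im z = 0} \<union> ({z. - z1 < Re z} \<inter> {z. Re z < z1})" by (auto simp: Dsym_def)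
  moreover have "closed {z. Im z = 0}" by (intro closed_Collect_eq continuous_intros)
  ultimately show ?thesis
    by (auto intro!: open_Un open_Int open_halfspace_Re_gt open_halfspace_Re_lt)
qed

lemma slit:
  assumes "z \<in> Dsym"
  shows "of_real z1 - z \<notin> \<real>\<^sub>\<le>\<^sub>0" "of_real z2 - z \<notin> \<real>\<^sub>\<le>\<^sub>0" "of_real z1 + z \<notin> \<real>\<^sub>\<le>\<^sub>0" "of_real z2 + z \<notin> \<real>\<^sub>\<le>\<^sub>0"
  using assms z1_less by (auto simp: Dsym_def complex_nonpos_Reals_iff)

lemma slit_nz:
  assumes "z \<in> Dsym"
  shows "of_real z1 - z \<noteq> 0" "of_real z2 - z \<noteq> 0" "of_real z1 + z \<noteq> 0" "of_real z2 + z \<noteq> 0"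
  using slit[OF assms] by (metis complex_nonpos_Reals_iff order_refl zero_complex.sel)+

lemma D_slit: assumes "z \<in> D" shows "z \<notin> \<real>\<^sub>\<le>\<^sub>0" "z \<noteq> 0"
  using assms by (auto simp: D_def complex_nonpos_Reals_iff)

definition f' :: "complex \<Rightarrow> complex" where
  "f' z = - 1 / (of_real z1 - z) - 1 / (of_real z2 - z) - 1 / (of_real z1 + z) - 1 / (of_real z2 + z)"

lemma has_field_derivative_f:
  assumes "z \<in> Dsym" shows "(f has_field_derivative f' z) (at z)"
  unfolding f_fun_def f'_def
  using slit[OF assms] slit_nz[OF assms]
  by (auto intro!: derivative_eq_intros simp: divide_simps)

lemma holomorphic_f: "f holomorphic_on Dsym"
  using has_field_derivative_f open_Dsym by (auto simp: holomorphic_on_open)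

lemma holomorphic_f': "f' holomorphic_on Dsym"
  unfolding f'_def using slit_nz by (intro holomorphic_intros) auto

text \<open>For V = (z - P / z) / sigma the factor on the left is (sigma z)^2 (V^2 - tau^2) and the
  right-hand side is 2 sigma^2 z V. This is why the saddle point equation is quadratic in V.\<close>

lemma f'_eq:
  assumes "z \<in> Dsym"
  shows "f' z * (((of_real P - z\<^sup>2)\<^sup>2 - (of_real (\<sigma> * \<tau>) * z)\<^sup>2)) = - 2 * of_real \<sigma> * (of_real P - z\<^sup>2)"
proof -
  have st: "\<sigma> * \<tau> = z2 - z1" using sigma_pos by (simp add: T1_def \<sigma>_def)
  define a b where "a = complex_of_real z1" and "b = complex_of_real z2"
  have n: "a - z \<noteq> 0" "b - z \<noteq> 0" "a + z \<noteq> 0" "b + z \<noteq> 0" using slit_nz[OF assms] by (auto simp: a_def b_def)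
  have "(of_real P - z\<^sup>2)\<^sup>2 - (of_real (\<sigma> * \<tau>) * z)\<^sup>2 = (a - z) * (a + z) * (b - z) * (b + z)"
    unfolding st P_def by (simp add: a_def b_def power2_eq_square algebra_simps)
  moreover have "f' z * ((a - z) * (a + z) * (b - z) * (b + z)) =
      - (a + z) * (b - z) * (b + z) - (a - z) * (a + z) * (b + z) - (a - z) * (b - z) * (b + z) 
      - (a - z) * (a + z) * (b - z)"
    unfolding f'_def a_def[symmetric] b_def[symmetric] using n by (simp add: divide_simps) (simp add: algebra_simps)
  moreover have "\<dots> = - 2 * of_real \<sigma> * (of_real P - z\<^sup>2)"
    unfolding \<sigma>_def P_def by (simp add: a_def b_def power2_eq_square algebra_simps)
  ultimately show ?thesis by metis
qed

lemma zeta_in_D: assumes "0 < t" shows "\<zeta> t \<in> D" "\<zeta> t \<in> Dsym"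
  using Im_zeta_pos[OF assms] by (auto simp: D_def Dsym_def)

text \<open>\<open>V_quad\<close> replaces V^2 - tau^2 in \<open>f'_eq\<close> by 2 i t V, and a
  nonzero common factor cancels.\<close>

lemma saddle:
  assumes "0 < t"
  shows "\<i> * of_real t * f' (\<zeta> t) = 1 / \<zeta> t"
proof -
  have t0: "0 \<le> t" using assms by simp
  have n: "\<zeta> t \<noteq> 0" "V t \<noteq> 0" "\<sigma> \<noteq> 0" using zeta_nz[OF t0] V_nz[OF assms] sigma_pos by auto
  have e: "of_real P - (\<zeta> t)\<^sup>2 = - (of_real \<sigma> * V t * \<zeta> t)" using zeta_minus[OF t0] by (simp add: algebra_simps)
  have "(of_real P - (\<zeta> t)\<^sup>2)\<^sup>2 - (of_real (\<sigma> * \<tau>) * \<zeta> t)\<^sup>2 = (of_real \<sigma> * \<zeta> t)\<^sup>2 * ((V t)\<^sup>2 - of_real (\<tau>\<^sup>2))"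
    unfolding e by (simp add: power2_eq_square algebra_simps)
  also have "(V t)\<^sup>2 - of_real (\<tau>\<^sup>2) = 2 * \<i> * of_real t * V t" using V_quad[OF t0] by simp
  finally have "f' (\<zeta> t) * ((of_real \<sigma> * \<zeta> t)\<^sup>2 * (2 * \<i> * of_real t * V t)) = 2 * of_real \<sigma> * (of_real \<sigma> * V t * \<zeta> t)"
    using f'_eq[OF zeta_in_D(2)[OF assms]] unfolding e by simp
  hence "(2 * (of_real \<sigma>)\<^sup>2 * V t * \<zeta> t) * (\<zeta> t * (\<i> * of_real t * f' (\<zeta> t))) = (2 * (of_real \<sigma>)\<^sup>2 * V t * \<zeta> t) * 1"
    by (simp add: power2_eq_square algebra_simps)
  hence "\<zeta> t * (\<i> * of_real t * f' (\<zeta> t)) = 1"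
    using n by (subst (asm) mult_left_cancel) auto
  thus ?thesis using n by (simp add: field_simps)
qed

(* In the upper half-plane gam = - Im f, so that Re (phi t z) = t * gam z - ln |z| depends
   on |z| and Im z only. *)
definition gam :: "complex \<Rightarrow> real" where
  "gam z = pi + arctan (((cmod z)\<^sup>2 - z1\<^sup>2) / (2 * z1 * Im z)) + arctan (((cmod z)\<^sup>2 - z2\<^sup>2) / (2 * z2 * Im z))"

lemma Im_f_upper: assumes "Im z > 0" shows "Im (f z) = - gam z"
  using Im_Ln_quotient[OF z1_pos assms] Im_Ln_quotient[OF z2_pos assms]
  by (simp add: f_fun_def gam_def)

lemma gam_pos: "gam z > 0"
  unfolding gam_def
  using arctan_lbound[of "((cmod z)\<^sup>2 - z1\<^sup>2) / (2 * z1 * Im z)"] arctan_lbound[of "((cmod z)\<^sup>2 - z2\<^sup>2) / (2 * z2 * Im z)"]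
  by linarith

lemma f_cnj: assumes "z \<in> Dsym" shows "f (cnj z) = cnj (f z)"
  using slit[OF assms] by (simp add: f_fun_def cnj_Ln)

lemma f_minus: "f (- z) = - f z"
  by (simp add: f_fun_def)

text \<open>Hence Re phi_t z <= - ln |z| in the lower half-plane and on the gap of the real axis,
  which makes that side of the contour cheap.\<close>

lemma Im_f_lower: assumes "z \<in> Dsym" "Im z \<le> 0" shows "Im (f z) \<ge> 0"
proof (cases "Im z = 0")
  case True
  hence "cnj z = z" by (simp add: complex_eq_iff)
  hence "cnj (f z) = f z" using f_cnj[OF assms(1)] by simp
  thus ?thesis by (simp add: complex_eq_iff)
next
  case False
  hence "Im (f (cnj z)) = - gam (cnj z)" using assms by (intro Im_f_upper) auto
  thus ?thesis using gam_pos[of "cnj z"] f_cnj[OF assms(1)] by simp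
qed

section \<open>The exponent phi_t along the curve\<close>

definition phi :: "real \<Rightarrow> complex \<Rightarrow> complex" where
  "phi t z = \<i> * of_real t * f z - Ln z"

lemma has_field_derivative_phi:
  assumes "z \<in> D" shows "(phi t has_field_derivative (\<i> * of_real t * f' z - 1 / z)) (at z)"
  unfolding phi_def
  using has_field_derivative_f[of z] assms D_slit[OF assms] D_subset
  by (auto intro!: derivative_eq_intros simp: field_simps)

lemma holomorphic_phi: "phi t holomorphic_on D"
  using has_field_derivative_phi open_D by (auto simp: holomorphic_on_open)

lemma Re_phi: assumes "z \<noteq> 0" shows "Re (phi t z) = - t * Im (f z) - ln (cmod z)"
  using assms by (simp add: phi_def)

lemma Re_phi_upper: assumes "Im z > 0" shows "Re (phi t z) = t * gam z - ln (cmod z)"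
  using assms by (subst Re_phi) (auto simp: Im_f_upper)

lemma phi_crit: assumes "0 < t" shows "\<i> * of_real t * f' (\<zeta> t) - 1 / \<zeta> t = 0"
  using saddle[OF assms] by simp

lemma phi_zeta_deriv:
  assumes "0 < u" "u < T" "u \<noteq> \<tau>"
  shows "((\<lambda>u. phi t (\<zeta> u)) has_vector_derivative of_real (t / u - 1) * (V' u / Q u)) (at u)"
proof -
  have main: "((phi t \<circ> \<zeta>) has_vector_derivative (\<zeta> u * (V' u / Q u)) * (\<i> * of_real t * f' (\<zeta> u) - 1 / \<zeta> u)) (at u)"
    by (intro field_vector_diff_chain_at has_vector_derivative_zeta has_field_derivative_phi zeta_in_D assms)
  have "\<i> * of_real t * f' (\<zeta> u) = of_real (t / u) * (1 / \<zeta> u)"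
    unfolding saddle[OF assms(1), symmetric] using assms(1) by simp
  note eq = this
  have "(\<zeta> u * (V' u / Q u)) * (\<i> * of_real t * f' (\<zeta> u) - 1 / \<zeta> u) = of_real (t / u - 1) * (V' u / Q u)"
  proof -
    have "(z * w) * (a * (1 / z) - 1 / z) = (a - 1) * w" if "z \<noteq> 0" for z w a :: complex
      using that by (simp add: field_simps)
    from this[of "\<zeta> u" "V' u / Q u" "of_real (t / u)"] show ?thesis 
      unfolding eq using zeta_nz[of u] assms by simp
  qed
  from main[unfolded this o_def] show ?thesis .
qed

lemma Re_phi_zeta_deriv:
  assumes "0 < u" "u < T" "u \<noteq> \<tau>"
  shows "((\<lambda>u. Re (phi t (\<zeta> u))) has_real_derivative (t / u - 1) * Re (V' u / Q u)) (at u)"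
proof -
  have "((\<lambda>u. Re (phi t (\<zeta> u))) has_vector_derivative Re (of_real (t / u - 1) * (V' u / Q u))) (at u)"
    by (rule bounded_linear.has_vector_derivative[OF bounded_linear_Re phi_zeta_deriv[OF assms]])
  thus ?thesis unfolding has_real_derivative_iff_has_vector_derivative Re_complex_of_real_mult .
qed

lemma isCont_f: "z \<in> Dsym \<Longrightarrow> isCont f z"
  using has_field_derivative_f DERIV_isCont by blast

lemma isCont_phi: "z \<in> D \<Longrightarrow> isCont (phi t) z"
  using has_field_derivative_phi DERIV_isCont by blast

lemma isCont_phi_zeta: assumes "0 < u" "u < T" shows "isCont (\<lambda>u. phi t (\<zeta> u)) u"
  using isCont_o2[OF isCont_zeta[OF assms] isCont_phi] zeta_in_D assms by auto

section \<open>Limits of the curve at 0 and at T\<close>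

lemma tendsto_V_at_0: "(V \<longlongrightarrow> - of_real \<tau>) (at_right 0)"
proof -
  have "((\<lambda>t. \<i> * of_real t - of_real (sqrt (\<tau>\<^sup>2 - t\<^sup>2))) \<longlongrightarrow> 
      \<i> * of_real 0 - of_real (sqrt (\<tau>\<^sup>2 - 0\<^sup>2))) (at_right 0)"
    by (intro tendsto_intros)
  moreover have "\<forall>\<^sub>F t in at_right 0. V t = \<i> * of_real t - of_real (sqrt (\<tau>\<^sup>2 - t\<^sup>2))"
    using eventually_at_right_less[of 0] eventually_at_right_field[of "\<lambda>t. t < \<tau>" 0] tau_pos
    by (auto simp: V_def elim!: eventually_mono)
  ultimately show ?thesis using tau_pos 
    by (simp add: tendsto_cong)
qed

lemma tendsto_zeta_at_0: "(\<zeta> \<longlongrightarrow> of_real z1) (at_right 0)"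
proof -
  have "((\<lambda>t. of_real (\<sigma> / 2) * (V t + csqrt ((V t)\<^sup>2 + of_real B))) \<longlongrightarrow>
     of_real (\<sigma> / 2) * (- of_real \<tau> + csqrt ((- of_real \<tau>)\<^sup>2 + of_real B))) (at_right 0)"
    by (intro tendsto_intros tendsto_csqrt tendsto_V_at_0) (auto simp: B_def)
  moreover have "of_real (\<sigma> / 2) * (- of_real \<tau> + csqrt ((- of_real \<tau>)\<^sup>2 + of_real B)) = complex_of_real z1"
  proof -
    have "\<sigma> / 2 * (1 - \<tau>) = z1" using z1_pos z2_pos by (simp add: \<sigma>_def T1_def field_simps)
    hence "complex_of_real (\<sigma> / 2 * (1 - \<tau>)) = of_real z1" by (rule arg_cong)
    thus ?thesis by (simp add: B_def)
  qed
  moreover have "\<forall>\<^sub>F t in at_right 0. of_real (\<sigma> / 2) * (V t + csqrt ((V t)\<^sup>2 + of_real B)) = \<zeta> t"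
    using eventually_at_right_less[of 0] by eventually_elim (auto simp: zeta_eq Q_def)
  ultimately show ?thesis by (simp only:) (rule Lim_transform_eventually)
qed

text \<open>T1 <= T2 amounts to (sigma^2 - 8 P)^2 >= 0, with equality where the two cases of
  \<open>T_end\<close> meet.\<close>

lemma tau_le_T: "\<tau> \<le> T"
proof (cases "z1\<^sup>2 - 6 * z1 * z2 + z2\<^sup>2 \<ge> 0")
  case False
  have "(\<sigma>\<^sup>2)\<^sup>2 - 16 * P * (\<sigma>\<^sup>2 - 4 * P) = (\<sigma>\<^sup>2 - 8 * P)\<^sup>2" by (simp add: power2_eq_square algebra_simps)
  hence "16 * P * (\<sigma>\<^sup>2 - 4 * P) \<le> (\<sigma>\<^sup>2)\<^sup>2" by (metis diff_ge_0_iff_ge zero_le_power2)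
  moreover have "\<sigma>\<^sup>2 - 4 * P = (z2 - z1)\<^sup>2" by (simp add: \<sigma>_def P_def power2_eq_square algebra_simps)
  ultimately have "(4 * sqrt P * (z2 - z1))\<^sup>2 \<le> (\<sigma>\<^sup>2)\<^sup>2" using P_pos by (simp add: power_mult_distrib)
  hence "4 * sqrt P * (z2 - z1) \<le> \<sigma> * \<sigma>" 
    using power2_le_imp_le[of "4 * sqrt P * (z2 - z1)" "\<sigma>\<^sup>2"] by (simp add: power2_eq_square)
  hence "(z2 - z1) / \<sigma> \<le> \<sigma> / (4 * sqrt P)" using P_pos sigma_pos
    by (simp add: divide_simps) (simp add: algebra_simps)
  moreover have "\<tau> = (z2 - z1) / \<sigma>" by (simp add: T1_def \<sigma>_def)
  moreover have "T = \<sigma> / (4 * sqrt P)" using False by (simp add: T_end_def T2_def \<sigma>_def P_def)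
  ultimately show ?thesis by simp
qed (simp add: T_end_def)

text \<open>At T the value V is imaginary and Q has lost its real part: its limit is imaginary if T
  = T1, and 0 if T = T2.\<close>

lemma tendsto_zeta_at_T: "\<exists>b>0. (\<zeta> \<longlongrightarrow> \<i> * of_real b) (at_left T)"
proof -
  have contV: "(V \<longlongrightarrow> V T) (at_left T)"
    using isCont_V[OF T_pos] unfolding isCont_def by (rule tendsto_mono[OF at_le, rotated]) auto
  have ev: "\<forall>\<^sub>F t in at_left T. 0 < t \<and> t < T"
    using eventually_at_left_real[OF T_pos] by eventually_elim auto
  have gt: "\<tau> \<le> T" by (rule tau_le_T)
  show ?thesis
  proof (cases "z1\<^sup>2 - 6 * z1 * z2 + z2\<^sup>2 \<ge> 0")
    case True
    hence T: "T = \<tau>" by (simp add: T_end_def)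
    have VT: "V T = \<i> * of_real \<tau>" by (simp add: T V_def)
    have "8 * P \<le> \<sigma>\<^sup>2" using True by (simp add: \<sigma>_def P_def power2_eq_square algebra_simps)
    hence "B \<le> 1 / 2" unfolding B_eq using sigma_pos by (simp add: field_simps)
    hence B: "B \<le> \<tau>\<^sup>2" by (simp add: B_def)
    define w where "w = \<tau>\<^sup>2 - B"
    have w: "w \<ge> 0" using B by (simp add: w_def)
    \<comment> \<open>The radicand tends to a point of the branch cut (or to 0) from below. There
      csqrt w = - i csqrt (- w), and the right-hand side is continuous at the limit.\<close>
    have "((\<lambda>t. - \<i> * csqrt (- ((V t)\<^sup>2 + of_real B))) \<longlongrightarrow> - \<i> * csqrt (- ((V T)\<^sup>2 + of_real B))) (at_left T)"
    proof (intro tendsto_intros tendsto_csqrt contV)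
      have "- ((V T)\<^sup>2 + of_real B) = of_real w" by (simp add: VT w_def power_mult_distrib)
      thus "- ((V T)\<^sup>2 + of_real B) \<notin> \<real>\<^sub>\<le>\<^sub>0 \<or> - ((V T)\<^sup>2 + of_real B) = 0"
        using w by (auto simp: complex_nonpos_Reals_iff)
    qed
    moreover have "- \<i> * csqrt (- ((V T)\<^sup>2 + of_real B)) = - \<i> * of_real (sqrt w)"
    proof -
      have "- ((V T)\<^sup>2 + of_real B) = of_real w" by (simp add: VT w_def power_mult_distrib)
      thus ?thesis using w by (simp add: csqrt_of_real_nonneg)
    qed
    moreover have "\<forall>\<^sub>F t in at_left T. - \<i> * csqrt (- ((V t)\<^sup>2 + of_real B)) = Q t"
      using ev
    proof eventually_elim
      case (elim t)
      have "t\<^sup>2 < \<tau>\<^sup>2" using elim by (simp add: T power_strict_mono)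
      hence "Im ((V t)\<^sup>2 + of_real B) < 0" using Q_arg_before[of t] elim by (simp add: T)
      hence "csqrt (- ((V t)\<^sup>2 + of_real B)) = \<i> * csqrt ((V t)\<^sup>2 + of_real B)"
        by (intro csqrt_minus) auto
      thus ?case by (simp add: Q_def)
    qed
    ultimately have "(Q \<longlongrightarrow> - \<i> * of_real (sqrt w)) (at_left T)"
      by (simp add: tendsto_cong)
    hence "((\<lambda>t. of_real (\<sigma> / 2) * (V t + Q t)) \<longlongrightarrow> of_real (\<sigma> / 2) * (V T + - \<i> * of_real (sqrt w))) (at_left T)"
      by (intro tendsto_intros contV)
    moreover have "\<forall>\<^sub>F t in at_left T. of_real (\<sigma> / 2) * (V t + Q t) = \<zeta> t"
      using ev by eventually_elim (auto simp: zeta_eq)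
    ultimately have "(\<zeta> \<longlongrightarrow> of_real (\<sigma> / 2) * (V T + - \<i> * of_real (sqrt w))) (at_left T)"
      by (rule Lim_transform_eventually)
    moreover have "of_real (\<sigma> / 2) * (V T + - \<i> * of_real (sqrt w)) = \<i> * of_real (\<sigma> / 2 * (\<tau> - sqrt w))"
      by (simp add: VT algebra_simps)
    moreover have "sqrt w < \<tau>" using B_pos tau_pos by (intro real_less_lsqrt) (auto simp: w_def)
    ultimately show ?thesis using sigma_pos 
      by (intro exI[of _ "\<sigma> / 2 * (\<tau> - sqrt w)"] conjI) (simp, metis)
  next
    case False
    hence T: "T = T2 z1 z2" by (simp add: T_end_def)
    define s where "s = sqrt (T\<^sup>2 - \<tau>\<^sup>2)"
    have T2: "\<tau>\<^sup>2 \<le> T\<^sup>2" using gt tau_pos by (simp add: power_mono)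
    have VT: "V T = \<i> * of_real (T + s)" using gt by (simp add: V_def s_def algebra_simps)
    define b where "b = 2 * sqrt P / \<sigma>"
    have b0: "b > 0" using P_pos sigma_pos by (simp add: b_def)
    have b2: "b\<^sup>2 = B" unfolding B_eq b_def using P_pos by (simp add: power_divide power_mult_distrib)
    have Tb: "T = 1 / (2 * b)" unfolding T
      using P_pos sigma_pos by (simp add: T2_def b_def field_simps \<sigma>_def P_def)
    have "\<sigma>\<^sup>2 < 8 * P" using False by (simp add: \<sigma>_def P_def power2_eq_square algebra_simps)
    hence "b\<^sup>2 > 1/2" unfolding b2 B_eq using sigma_pos by (simp add: field_simps)
    hence "T < b" unfolding Tb using b0 by (simp add: field_simps power2_eq_square)
    \<comment> \<open>Because 2 b T = 1: the identity of \<open>after_tau\<close> at its boundary.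
      It makes the radicand vanish at T.\<close>
    moreover have "T\<^sup>2 - \<tau>\<^sup>2 = (b - T)\<^sup>2" using b2 b0 Tb by (simp add: B_def power2_diff)
    ultimately have "T + s = b" by (simp add: s_def)
    hence VT: "V T = \<i> * of_real b" using VT by simp
    have "((\<lambda>t. of_real (\<sigma> / 2) * (V t + csqrt ((V t)\<^sup>2 + of_real B))) \<longlongrightarrow>
       of_real (\<sigma> / 2) * (V T + csqrt ((V T)\<^sup>2 + of_real B))) (at_left T)"
      by (intro tendsto_intros tendsto_csqrt contV) (auto simp: VT power_mult_distrib simp flip: b2)
    moreover have "\<forall>\<^sub>F t in at_left T. of_real (\<sigma> / 2) * (V t + csqrt ((V t)\<^sup>2 + of_real B)) = \<zeta> t"
      using ev by eventually_elim (auto simp: zeta_eq Q_def)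
    ultimately have "(\<zeta> \<longlongrightarrow> of_real (\<sigma> / 2) * (V T + csqrt ((V T)\<^sup>2 + of_real B))) (at_left T)"
      by (rule Lim_transform_eventually)
    moreover have "of_real (\<sigma> / 2) * (V T + csqrt ((V T)\<^sup>2 + of_real B)) = \<i> * of_real (\<sigma> / 2 * b)"
      by (simp add: VT power_mult_distrib flip: b2)
    ultimately show ?thesis using sigma_pos b0 
      by (intro exI[of _ "\<sigma> / 2 * b"] conjI) (simp, metis)
  qed
qed

section \<open>Paths below the saddle level\<close>

abbreviation c :: "real \<Rightarrow> real" where "c t \<equiv> Re (phi t (\<zeta> t))"

text \<open>The region in which the integrand is exponentially small against its size at the saddle.
  Only its connected components are used.\<close>

definition U :: "real \<Rightarrow> complex set" where
  "U t = {z \<in> D. Re (phi t z) < c t}"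

lemma isCont_Re_phi_zeta: assumes "0 < u" "u < T" shows "isCont (\<lambda>u. Re (phi t (\<zeta> u))) u"
  using isCont_phi_zeta[OF assms] by (rule isCont_Re)

lemma Re_phi_zeta_strict_mono:
  assumes "0 < u" "u < v" "v \<le> t" "v \<le> \<tau>" "v < T"
  shows "Re (phi t (\<zeta> u)) < Re (phi t (\<zeta> v))"
proof (rule DERIV_pos_imp_increasing_open[OF assms(2)])
  fix x assume x: "u < x" "x < v"
  show "\<exists>y. ((\<lambda>u. Re (phi t (\<zeta> u))) has_real_derivative y) (at x) \<and> 0 < y"
    using Re_phi_zeta_deriv[of x t] log_deriv_zeta_before[of x] x assms
    by (intro exI[of _ "(t / x - 1) * Re (V' x / Q x)"]) auto
next
  show "continuous_on {u..v} (\<lambda>u. Re (phi t (\<zeta> u)))"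
    using isCont_Re_phi_zeta assms by (intro continuous_at_imp_continuous_on) auto
qed

lemma Re_phi_zeta_strict_antimono:
  assumes "0 < t" "t \<le> u" "u < v" "v \<le> \<tau>" "v < T"
  shows "Re (phi t (\<zeta> v)) < Re (phi t (\<zeta> u))"
proof (rule less_of_neg_deriv[OF assms(3)])
  fix x assume x: "u < x" "x < v"
  show "\<exists>y. ((\<lambda>u. Re (phi t (\<zeta> u))) has_real_derivative y) (at x) \<and> y < 0"
    using Re_phi_zeta_deriv[of x t] log_deriv_zeta_before[of x] x assms
    by (intro exI[of _ "(t / x - 1) * Re (V' x / Q x)"]) (auto simp: mult_neg_pos)
next
  fix x assume "u \<le> x" "x \<le> v"
  thus "isCont (\<lambda>u. Re (phi t (\<zeta> u))) x"
    using isCont_Re_phi_zeta assms by auto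
qed

lemma P_bounds: "z1\<^sup>2 < P" "P < z2\<^sup>2" 
  using z1_pos z1_less by (auto simp: P_def power2_eq_square)

text \<open>On this circle the two arc tangents in \<open>gam\<close> are opposite. Hence Re phi_t
  is constant on its upper half and so along the curve after tau.\<close>

lemma gam_circle: 
  assumes "(cmod z)\<^sup>2 = P" shows "gam z = pi"
proof -
  have "(P - z2\<^sup>2) / (2 * z2 * Im z) = - ((P - z1\<^sup>2) / (2 * z1 * Im z))"
    using z1_pos z2_pos by (cases "Im z = 0") (simp_all add: P_def power2_eq_square field_simps)
  thus ?thesis unfolding gam_def assms by (simp add: arctan_minus)
qed

lemma Re_phi_circle:
  assumes "(cmod z)\<^sup>2 = P" "Im z > 0"
  shows "Re (phi t z) = t * pi - ln (sqrt P)"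
proof -
  have "cmod z = sqrt P" using assms(1) by (simp add: real_sqrt_unique)
  thus ?thesis using assms by (subst Re_phi_upper) (auto simp: gam_circle)
qed

lemma Re_phi_zeta_before_less:
  assumes "0 < u" "u < t" "u < \<tau>" "t < T"
  shows "Re (phi t (\<zeta> u)) < c t"
proof (cases "t \<le> \<tau>")
  case True
  thus ?thesis using Re_phi_zeta_strict_mono[of u t t] assms by auto
next
  case False
  have "Re (phi t (\<zeta> u)) < Re (phi t (\<zeta> \<tau>))"
    using Re_phi_zeta_strict_mono[of u \<tau> t] assms False by auto
  also have "\<dots> = c t"
    using assms False tau_pos by (simp add: Re_phi_circle cmod_zeta_after Im_zeta_pos)
  finally show ?thesis .
qed

lemma Re_phi_zeta_after_less:
  assumes "0 < t" "t < u" "t < \<tau>" "u < T"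
  shows "Re (phi t (\<zeta> u)) < c t"
proof (cases "u \<le> \<tau>")
  case True
  thus ?thesis using Re_phi_zeta_strict_antimono[of t t u] assms by auto
next
  case False
  have "Re (phi t (\<zeta> u)) = Re (phi t (\<zeta> \<tau>))"
    using assms False tau_pos by (simp add: Re_phi_circle cmod_zeta_after Im_zeta_pos)
  also have "\<dots> < c t" 
    using Re_phi_zeta_strict_antimono[of t t \<tau>] assms False by auto
  finally show ?thesis .
qed

lemma cmod_zeta_strict_mono:
  assumes "0 < u" "u < v" "v \<le> \<tau>" "v < T"
  shows "cmod (\<zeta> u) < cmod (\<zeta> v)"
proof -
  \<comment> \<open>As phi_0 = - Ln, the derivative formula for t = 0 is about - ln |zeta|.\<close>
  have "Re (phi 0 (\<zeta> v)) < Re (phi 0 (\<zeta> u))"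
  proof (rule less_of_neg_deriv[OF assms(2)])
    fix x assume x: "u < x" "x < v"
    show "\<exists>y. ((\<lambda>u. Re (phi 0 (\<zeta> u))) has_real_derivative y) (at x) \<and> y < 0"
      using Re_phi_zeta_deriv[of x 0] log_deriv_zeta_before[of x] x assms
      by (intro exI[of _ "(0 / x - 1) * Re (V' x / Q x)"]) auto
  next
    fix x assume "u \<le> x" "x \<le> v"
    thus "isCont (\<lambda>u. Re (phi 0 (\<zeta> u))) x"
      using isCont_Re_phi_zeta assms by auto
  qed
  thus ?thesis using zeta_nz[of u] zeta_nz[of v] assms by (simp add: Re_phi)
qed

lemma tendsto_cmod_zeta_at_0: "((\<lambda>u. cmod (\<zeta> u)) \<longlongrightarrow> z1) (at_right 0)"
  using tendsto_norm[OF tendsto_zeta_at_0] z1_pos by simp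

lemma eventually_at_right_0_less: 
  assumes "0 < (v::real)" shows "\<forall>\<^sub>F u in at_right 0. 0 < u \<and> u < v"
  using eventually_at_right_real[OF assms] by eventually_elim auto

lemma cmod_zeta_gt:
  assumes "0 < u" "u < T" shows "z1 < cmod (\<zeta> u)"
proof (cases "\<tau> \<le> u")
  case True
  thus ?thesis using cmod_zeta_after[of u] assms P_bounds(1) 
    by (simp add: power2_less_imp_less)
next
  case False
  have "z1 \<le> cmod (\<zeta> (u / 2))"
  proof (rule tendsto_upperbound[OF tendsto_cmod_zeta_at_0])
    show "\<forall>\<^sub>F v in at_right 0. cmod (\<zeta> v) \<le> cmod (\<zeta> (u / 2))"
      using eventually_at_right_0_less[OF half_gt_zero[OF assms(1)]]
    proof eventually_elim
      case (elim v)
      thus ?case using cmod_zeta_strict_mono[of v "u/2"] False assms by auto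
    qed
  qed auto
  also have "\<dots> < cmod (\<zeta> u)" using cmod_zeta_strict_mono[of "u/2" u] assms False by auto
  finally show ?thesis .
qed

text \<open>The curve starts at z1 and \<open>gam\<close> is positive, so Re phi_t on it starts no
  lower than - ln z1 and increases. Consequently circles of radius just below z1 stay under the
  saddle level in the lower half-plane.\<close>

lemma c_gt:
  assumes "0 < t" "t < T" shows "c t > - ln z1"
proof -
  define v where "v = min t \<tau> / 2"
  have v: "0 < v" "v < t" "v < \<tau>" using assms tau_pos by (auto simp: v_def)
  have "- ln z1 \<le> Re (phi t (\<zeta> v))"
  proof (rule tendsto_upperbound)
    show "((\<lambda>u. - ln (cmod (\<zeta> u))) \<longlongrightarrow> - ln z1) (at_right 0)"
      using z1_pos by (intro tendsto_intros tendsto_cmod_zeta_at_0) auto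
    show "\<forall>\<^sub>F u in at_right 0. - ln (cmod (\<zeta> u)) \<le> Re (phi t (\<zeta> v))"
      using eventually_at_right_0_less[OF v(1)]
    proof eventually_elim
      case (elim u)
      have "- ln (cmod (\<zeta> u)) \<le> t * gam (\<zeta> u) - ln (cmod (\<zeta> u))" using gam_pos[of "\<zeta> u"] assms by simp
      also have "\<dots> = Re (phi t (\<zeta> u))" using elim by (simp add: Re_phi_upper Im_zeta_pos)
      also have "\<dots> < Re (phi t (\<zeta> v))" using Re_phi_zeta_strict_mono[of u v t] elim v assms by auto
      finally show ?case by simp
    qed
  qed auto
  also have "\<dots> < c t" using Re_phi_zeta_before_less[of v t] v assms by auto
  finally show ?thesis .
qed

lemma open_U: "open (U t)"
proof -
  have "continuous_on D (\<lambda>z. Re (phi t z))"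
    using isCont_phi by (intro continuous_at_imp_continuous_on ballI continuous_intros) auto
  from continuous_open_preimage[OF this open_D open_lessThan, of "c t"]
  show ?thesis by (simp add: U_def vimage_def Int_def)
qed

lemma in_U_upper: "Im z > 0 \<Longrightarrow> z \<in> U t \<longleftrightarrow> t * gam z - ln (cmod z) < c t"
  by (simp add: U_def D_def Re_phi_upper)

lemma continuous_on_zeta: "A \<subseteq> {0<..<T} \<Longrightarrow> continuous_on A \<zeta>"
  using isCont_zeta by (intro continuous_at_imp_continuous_on) auto

section \<open>Connections inside the sublevel set to both halves of the imaginary axis\<close>

lemma conn_low:
  assumes "0 < t" "t < T" "0 < u" "u < min t \<tau>" "0 < v" "v < min t \<tau>"
  shows "connected_component (U t) (\<zeta> u) (\<zeta> v)"
proof (rule connected_component_curve[of "{0<..<min t \<tau>}"])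
  show "continuous_on {0<..<min t \<tau>} \<zeta>" using assms by (intro continuous_on_zeta) auto
  fix x assume "x \<in> {0<..<min t \<tau>}"
  thus "\<zeta> x \<in> U t" using Re_phi_zeta_before_less[of x t] assms zeta_in_D by (auto simp: U_def)
qed (use assms in auto)

text \<open>Allows moving straight towards 0: shrinking z lowers both arc tangents, and only the
  term - ln |z| can grow.\<close>

lemma gam_mono_radial:
  assumes "Im z > 0" "0 < l" "l \<le> 1"
  shows "gam (of_real l * z) \<le> gam z"
proof -
  have "((cmod (of_real l * z))\<^sup>2 - a\<^sup>2) / (2 * a * Im (of_real l * z)) \<le> ((cmod z)\<^sup>2 - a\<^sup>2) / (2 * a * Im z)"
    if "a > 0" for a :: real
  proof -
    have "l * l * (cmod z)\<^sup>2 - a\<^sup>2 \<le> l * ((cmod z)\<^sup>2 - a\<^sup>2)"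
    proof -
      have "l * l * (cmod z)\<^sup>2 \<le> l * 1 * (cmod z)\<^sup>2" using assms by (intro mult_mono) auto
      moreover have "l * a\<^sup>2 \<le> 1 * a\<^sup>2" using assms by (intro mult_mono) auto
      ultimately show ?thesis by (simp add: algebra_simps)
    qed
    hence "(l * l * (cmod z)\<^sup>2 - a\<^sup>2) / (2 * a * (l * Im z)) \<le> l * ((cmod z)\<^sup>2 - a\<^sup>2) / (2 * a * (l * Im z))"
      using assms that by (intro divide_right_mono) auto
    also have "\<dots> = ((cmod z)\<^sup>2 - a\<^sup>2) / (2 * a * Im z)" using assms by simp
    finally show ?thesis using assms by (simp add: norm_mult power2_eq_square mult_ac)
  qed
  from this[OF z1_pos] this[OF z2_pos] show ?thesis unfolding gam_def
    by (intro add_mono order.refl) (simp_all only: arctan_le_iff)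
qed

text \<open>Inside |z| < z1 both numerators are negative, so going down along the circle makes both
  quotients smaller.\<close>

lemma gam_mono_height:
  assumes "cmod w = cmod z" "cmod z < z1" "0 < Im w" "Im w \<le> Im z"
  shows "gam w \<le> gam z"
proof -
  have "((cmod w)\<^sup>2 - a\<^sup>2) / (2 * a * Im w) \<le> ((cmod z)\<^sup>2 - a\<^sup>2) / (2 * a * Im z)"
    if "a > 0" "cmod z < a" for a :: real
  proof -
    have "(cmod z)\<^sup>2 \<le> a\<^sup>2" using that by (intro power_mono) auto
    hence "(a\<^sup>2 - (cmod z)\<^sup>2) / (2 * a * Im z) \<le> (a\<^sup>2 - (cmod z)\<^sup>2) / (2 * a * Im w)"
      using assms that by (intro divide_left_mono) (auto intro!: mult_left_mono mult_pos_pos)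
    thus ?thesis unfolding assms(1)
      by (metis minus_diff_eq minus_divide_left neg_le_iff_le)
  qed
  from this[OF z1_pos] this[OF z2_pos] show ?thesis unfolding gam_def using assms z1_less
    by (intro add_mono order.refl) (simp_all only: arctan_le_iff)
qed

text \<open>The curve begins at the branch point z1, which must be avoided. The path leaves the
  curve shortly after its start, goes radially into the disc |z| < z1, and follows the circle |z| =
  z0 across the real axis down to - i z0.\<close>

lemma conn_start:
  assumes "0 < t" "t < T"
  obtains z0 u where "0 < z0" "0 < u" "u < min t \<tau>" "connected_component (U t) (- \<i> * of_real z0) (\<zeta> u)"
proof -
  define v where "v = min t \<tau> / 2"
  have v: "0 < v" "v < t" "v < \<tau>" "v < min t \<tau>" using assms tau_pos by (auto simp: v_def)
  define m where "m = Re (phi t (\<zeta> v))"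
  have m: "m < c t" using Re_phi_zeta_before_less[of v t] v assms by (auto simp: m_def)
  \<comment> \<open>The radial segment runs between moduli within e of z1 on the logarithmic scale,
    so it raises Re phi_t by less than 2 e, which the first entry allows for. The second keeps - ln
    z0 = e - ln z1 below c t.\<close>
  define e where "e = min ((c t - m) / 3) ((c t + ln z1) / 2)"
  have e0: "e > 0" using m c_gt[OF assms] by (auto simp: e_def)
  have e1: "2 * e < c t - m" "e < c t + ln z1" using m c_gt[OF assms] by (auto simp: e_def min_def)
  define z0 where "z0 = z1 * exp (- e)"
  have z0: "0 < z0" "z0 < z1" "ln z0 = ln z1 - e" using z1_pos e0 by (auto simp: z0_def ln_mult)
  have "((\<lambda>u. ln (cmod (\<zeta> u))) \<longlongrightarrow> ln z1) (at_right 0)"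
    using z1_pos by (intro tendsto_intros tendsto_cmod_zeta_at_0) auto
  hence "\<forall>\<^sub>F u in at_right 0. ln (cmod (\<zeta> u)) < ln z1 + e" using e0 by (intro order_tendstoD) auto
  with eventually_at_right_0_less[OF v(1)]
  have "\<forall>\<^sub>F u in at_right 0. (0 < u \<and> u < v) \<and> ln (cmod (\<zeta> u)) < ln z1 + e" by (rule eventually_conj)
  then obtain u where u: "0 < u" "u < v" "ln (cmod (\<zeta> u)) < ln z1 + e"
    using eventually_happens[of _ "at_right (0::real)"] by auto
  define w where "w = \<zeta> u"
  define r where "r = cmod w"
  have uT: "u < T" "u < t" using u v assms by auto
  have Imw: "Im w > 0" "Re w > 0" using Im_zeta_pos Re_zeta_pos u uT by (auto simp: w_def)
  have r: "r > z1" using cmod_zeta_gt[of u] u uT by (simp add: r_def w_def)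
  have "Re (phi t w) < m" unfolding w_def m_def
    using Re_phi_zeta_strict_mono[of u v t] u v assms by auto
  hence gw: "t * gam w - ln r < m" using Imw by (simp add: Re_phi_upper r_def)
  have radial: "of_real l * w \<in> U t" if "z0 / r \<le> l" "l \<le> 1" for l
  proof -
    have l0: "l > 0" using that z0 r z1_pos by (smt (verit) divide_pos_pos)
    have "t * gam (of_real l * w) \<le> t * gam w" using gam_mono_radial[of w l] Imw that l0 assms by simp
    moreover have "z0 \<le> l * r" using that r z1_pos by (simp add: field_simps)
    hence "ln z0 \<le> ln (l * r)" using z0(1) by (intro ln_mono) auto
    ultimately have "t * gam (of_real l * w) - ln (l * r) < m + 2 * e" using gw u(3) z0 by (simp add: r_def w_def)
    thus ?thesis using Imw l0 e1 by (subst in_U_upper) (auto simp: norm_mult r_def)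
  qed
  define w0 where "w0 = of_real (z0 / r) * w"
  have "z0 / r < 1" using z0 r z1_pos by simp
  have w0U: "w0 \<in> U t" using radial[of "z0 / r"] \<open>z0 / r < 1\<close> by (simp add: w0_def)
  have "continuous_on {z0/r..1} (\<lambda>l. of_real l * w)" by (intro continuous_intros)
  from connected_component_curve[OF this, of "U t" "z0 / r" 1]
  have conn1: "connected_component (U t) w0 w"
    using radial \<open>z0 / r < 1\<close> by (auto simp: w0_def)
  have w0: "Im w0 > 0" "Re w0 > 0" "cmod w0 = z0" 
  proof -
    have l: "z0 / r > 0" "z0 / r * cmod w = z0" using z0(1) less_trans[OF z1_pos r] by (auto simp: r_def[symmetric])
    show "cmod w0 = z0" unfolding w0_def norm_mult norm_of_real using l by (simp only: abs_of_pos)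
    show "Im w0 > 0" "Re w0 > 0" unfolding w0_def using l(1) Imw
      by (metis Im_complex_of_real_mult Re_complex_of_real_mult mult_pos_pos)+
  qed
  define \<theta> where "\<theta> = Arg w0"
  have \<theta>: "0 < \<theta>" "\<theta> < pi / 2" 
    using Arg_first_quadrant[OF w0(2,1)] by (auto simp: \<theta>_def)
  have w0_cis: "w0 = of_real z0 * cis \<theta>" using w0(3) rcis_cmod_Arg[of w0] by (simp add: rcis_def \<theta>_def)
  \<comment> \<open>Above the real axis \<open>gam_mono_height\<close> compares with w0; on and
    below it Im f >= 0, and - ln z0 < c t suffices.\<close>
  have arc: "of_real z0 * cis x \<in> U t" if "- pi / 2 \<le> x" "x \<le> \<theta>" for x
  proof (cases "x > 0")
    case True
    have "sin x > 0" using True that \<theta> by (intro sin_gt_zero) auto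
    moreover have "sin x \<le> sin \<theta>" using True that \<theta> by (intro sin_monotone_2pi_le) auto
    ultimately have "gam (of_real z0 * cis x) \<le> gam w0"
      using z0 w0 by (intro gam_mono_height) (auto simp: w0_cis norm_mult)
    hence "t * gam (of_real z0 * cis x) \<le> t * gam w0" using assms by simp
    moreover have "t * gam w0 - ln z0 < c t" using w0U w0 by (simp add: in_U_upper)
    ultimately show ?thesis using z0 \<open>sin x > 0\<close> by (subst in_U_upper) (auto simp: norm_mult)
  next
    case False
    define z where "z = of_real z0 * cis x"
    have "Im z \<noteq> 0 \<or> Re z = z0"
    proof (cases "x = 0")
      case False
      hence "sin (- x) > 0" using \<open>\<not> x > 0\<close> that by (intro sin_gt_zero) auto
      thus ?thesis using z0 by (auto simp: z_def)
    qed (auto simp: z_def)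
    hence zD: "z \<in> D" using z0 by (auto simp: D_def)
    have "sin (- x) \<ge> 0" using False that by (intro sin_ge_zero) auto
    hence "Im z \<le> 0" using z0 by (auto simp: z_def mult_nonneg_nonpos)
    hence "Im (f z) \<ge> 0" using zD D_subset by (intro Im_f_lower) auto
    moreover have "cmod z = z0" "z \<noteq> 0" using z0 by (auto simp: z_def norm_mult)
    ultimately have "Re (phi t z) \<le> - ln z0" using assms by (simp add: Re_phi)
    also have "\<dots> < c t" using e1 z0 by simp
    finally show ?thesis using zD by (simp add: U_def z_def)
  qed
  have "continuous_on {-pi/2..\<theta>} (\<lambda>x. of_real z0 * cis x)" by (intro continuous_intros)
  from connected_component_curve[OF this, of "U t" "-pi/2" \<theta>]
  have "connected_component (U t) (of_real z0 * cis (-pi/2)) w0"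
    using arc \<theta> by (auto simp: w0_cis)
  moreover have "of_real z0 * cis (-pi/2) = - \<i> * of_real z0" by (simp add: complex_eq_iff)
  ultimately have "connected_component (U t) (- \<i> * of_real z0) w" 
    using conn1 connected_component_trans by metis
  thus ?thesis using that[of z0 u] z0 u v by (auto simp: w_def)
qed

lemma gam_cis:
  assumes "0 < r" "sin x \<noteq> 0"
  shows "gam (of_real r * cis x) = pi + (arctan ((r\<^sup>2 - z1\<^sup>2) / (2 * z1) / (r * sin x)) - arctan ((z2\<^sup>2 - r\<^sup>2) / (2 * z2) / (r * sin x)))"
proof -
  have "(r\<^sup>2 - z2\<^sup>2) / (2 * z2 * (r * sin x)) = - ((z2\<^sup>2 - r\<^sup>2) / (2 * z2) / (r * sin x))"
    by (simp add: minus_divide_left)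
  thus ?thesis using assms by (simp add: gam_def norm_mult arctan_minus)
qed

text \<open>The two numerators in \<open>gam_cis\<close> agree exactly when r^2 = P, the circle on
  which \<open>gam\<close> is constant; their order decides the monotonicity of \<open>gam\<close>
  on other circles.\<close>

lemma weights_le:
  assumes "0 < r" "r\<^sup>2 \<le> P" shows "(r\<^sup>2 - z1\<^sup>2) / (2 * z1) \<le> (z2\<^sup>2 - r\<^sup>2) / (2 * z2)"
proof -
  have "(z2\<^sup>2 - r\<^sup>2) / (2 * z2) - (r\<^sup>2 - z1\<^sup>2) / (2 * z1) = \<sigma> * (P - r\<^sup>2) / (2 * P)"
    using z1_pos z2_pos by (simp add: \<sigma>_def P_def field_simps power2_eq_square)
  also have "\<dots> \<ge> 0" using assms sigma_pos P_pos by simp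
  finally show ?thesis by simp
qed

lemma weights_ge:
  assumes "0 < r" "P \<le> r\<^sup>2" shows "(z2\<^sup>2 - r\<^sup>2) / (2 * z2) \<le> (r\<^sup>2 - z1\<^sup>2) / (2 * z1)"
proof -
  have "(r\<^sup>2 - z1\<^sup>2) / (2 * z1) - (z2\<^sup>2 - r\<^sup>2) / (2 * z2) = \<sigma> * (r\<^sup>2 - P) / (2 * P)"
    using z1_pos z2_pos by (simp add: \<sigma>_def P_def field_simps power2_eq_square)
  also have "\<dots> \<ge> 0" using assms sigma_pos P_pos by simp
  finally show ?thesis by simp
qed

(* If r^2 <= P, then on the arc |z| = r the function gam first decreases and then increases
   with Im z, so it is at most its larger value at the end points. *)
lemma conn_circle:
  assumes "a \<in> U t" "b \<in> U t" "Re a > 0" "Im a > 0" "Re b > 0" "Im b > 0" 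
    and "cmod a = cmod b" "z1 < cmod a" "(cmod a)\<^sup>2 \<le> P" "0 < t"
  shows "connected_component (U t) a b"
proof -
  have main: "connected_component (U t) a b"
    if a: "a \<in> U t" "Re a > 0" "Im a > 0" and b: "b \<in> U t" "Re b > 0" "Im b > 0"
      and r: "cmod a = r" "cmod b = r" "z1 < r" "r\<^sup>2 \<le> P" and le: "Arg a \<le> Arg b" for a b r
  proof -
    have A: "0 < Arg a" "Arg b < pi / 2" using Arg_first_quadrant a b by auto
    have acis: "a = of_real r * cis (Arg a)" and bcis: "b = of_real r * cis (Arg b)"
      using rcis_cmod_Arg[of a] rcis_cmod_Arg[of b] r by (auto simp: rcis_def)
    have r0: "r > 0" using r z1_pos by simp
    have "of_real r * cis x \<in> U t" if x: "Arg a \<le> x" "x \<le> Arg b" for x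
    proof -
      have s: "0 < sin (Arg a)" using A le by (intro sin_gt_zero) auto
      have s1: "sin (Arg a) \<le> sin x" "sin x \<le> sin (Arg b)" using A x le by (auto intro!: sin_monotone_2pi_le)
      define g where "g h = arctan ((r\<^sup>2 - z1\<^sup>2) / (2 * z1) / h) - arctan ((z2\<^sup>2 - r\<^sup>2) / (2 * z2) / h)" for h
      have G: "gam (of_real r * cis y) = pi + g (r * sin y)" if "sin y > 0" for y
        unfolding g_def using r0 that by (intro gam_cis) auto
      have "z1\<^sup>2 \<le> r\<^sup>2" using r z1_pos by (intro power_mono) auto
      hence "g (r * sin x) \<le> max (g (r * sin (Arg a))) (g (r * sin (Arg b)))"
        unfolding g_def using r0 r s s1 z1_pos by (intro arctan_diff_quasiconvex weights_le) auto
      hence "t * g (r * sin x) \<le> max (t * g (r * sin (Arg a))) (t * g (r * sin (Arg b)))"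
        using assms(10) by (auto simp: max_def split: if_splits)
      moreover have "t * gam a - ln r < c t" "t * gam b - ln r < c t" 
        using a b r by (auto simp: in_U_upper)
      moreover have "gam a = pi + g (r * sin (Arg a))" "gam b = pi + g (r * sin (Arg b))"
         "gam (of_real r * cis x) = pi + g (r * sin x)"
        using G[of "Arg a", folded acis] G[of "Arg b", folded bcis] G[of x] s s1 by auto
      ultimately have "t * gam (of_real r * cis x) - ln r < c t" by (auto simp: algebra_simps)
      thus ?thesis using r0 s s1 by (subst in_U_upper) (auto simp: norm_mult)
    qed
    moreover have "continuous_on {Arg a..Arg b} (\<lambda>x. of_real r * cis x)" by (intro continuous_intros)
    ultimately have "connected_component (U t) (of_real r * cis (Arg a)) (of_real r * cis (Arg b))"
      using le by (intro connected_component_curve[where S = "{Arg a..Arg b}"]) auto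
    thus ?thesis using acis bcis by simp
  qed
  show ?thesis
  proof (cases "Arg a \<le> Arg b")
    case True thus ?thesis by (rule main[OF assms(1,3,4,2,5,6) refl assms(7)[symmetric] assms(8,9)])
  next
    case False 
    hence "Arg b \<le> Arg a" by simp
    from main[OF assms(2,5,6,1,3,4) assms(7)[symmetric] refl assms(8,9) this]
    show ?thesis by (rule connected_component_sym)
  qed
qed

(* If r^2 >= P, then gam decreases with Im z on the upper part of the arc |z| = r. *)
lemma conn_top:
  assumes "a \<in> U t" "Re a > 0" "Im a > 0" "P \<le> (cmod a)\<^sup>2" "0 < t"
    and "((cmod a)\<^sup>2 - z1\<^sup>2) / (2 * z1) * ((z2\<^sup>2 - (cmod a)\<^sup>2) / (2 * z2)) \<le> (Im a)\<^sup>2"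
  shows "connected_component (U t) a (\<i> * of_real (cmod a))"
proof -
  define r where "r = cmod a"
  have r0: "r > 0" using assms by (auto simp: r_def)
  have A: "0 < Arg a" "Arg a < pi / 2" using Arg_first_quadrant assms by auto
  have acis: "a = of_real r * cis (Arg a)"
    using rcis_cmod_Arg[of a] by (auto simp: rcis_def r_def)
  have "of_real r * cis x \<in> U t" if x: "Arg a \<le> x" "x \<le> pi / 2" for x
  proof -
    have s: "0 < sin (Arg a)" using A by (intro sin_gt_zero) auto
    have s1: "sin (Arg a) \<le> sin x" using A x by (auto intro!: sin_monotone_2pi_le)
    have "Im a = r * sin (Arg a)" by (subst acis) simp
    hence "arctan ((r\<^sup>2 - z1\<^sup>2) / (2 * z1) / (r * sin x)) - arctan ((z2\<^sup>2 - r\<^sup>2) / (2 * z2) / (r * sin x))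
       \<le> arctan ((r\<^sup>2 - z1\<^sup>2) / (2 * z1) / (r * sin (Arg a))) - arctan ((z2\<^sup>2 - r\<^sup>2) / (2 * z2) / (r * sin (Arg a)))"
      using assms r0 s s1 by (intro arctan_diff_decreasing weights_ge) (auto simp: r_def[symmetric])
    hence "gam (of_real r * cis x) \<le> gam (of_real r * cis (Arg a))"
      using gam_cis[of r x] gam_cis[of r "Arg a"] r0 s s1 by auto
    hence "t * gam (of_real r * cis x) \<le> t * gam a" using assms(5) by (simp flip: acis)
    moreover have "t * gam a - ln r < c t"
      using assms by (auto simp: in_U_upper r_def)
    ultimately have "t * gam (of_real r * cis x) - ln r < c t" by simp
    thus ?thesis using r0 s s1 by (subst in_U_upper) (auto simp: norm_mult)
  qed
  moreover have "continuous_on {Arg a..pi/2} (\<lambda>x. of_real r * cis x)" by (intro continuous_intros)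
  ultimately have "connected_component (U t) (of_real r * cis (Arg a)) (of_real r * cis (pi/2))"
    using A by (intro connected_component_curve[where S = "{Arg a..pi/2}"]) auto
  moreover have "of_real r * cis (pi/2) = \<i> * of_real r" by (simp add: complex_eq_iff)
  ultimately have "connected_component (U t) a (\<i> * of_real r)" using acis by metis
  thus ?thesis unfolding r_def .
qed

text \<open>The curve beyond t lies in U t and so does its end point on the imaginary axis; a small
  disc around the end point closes the connection.\<close>

lemma conn_high:
  assumes "0 < t" "t < \<tau>" 
  obtains b where "b > 0" "\<And>u. \<lbrakk>t < u; u < T\<rbrakk> \<Longrightarrow> connected_component (U t) (\<zeta> u) (\<i> * of_real b)"
proof -
  obtain b where b: "b > 0" "(\<zeta> \<longlongrightarrow> \<i> * of_real b) (at_left T)" using tendsto_zeta_at_T by blast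
  have tT: "t < T" using assms tau_le_T by simp
  have inU: "\<zeta> u \<in> U t" if "t < u" "u < T" for u
    using Re_phi_zeta_after_less[of t u] assms that zeta_in_D[of u] by (auto simp: U_def)
  have bD: "\<i> * of_real b \<in> D" using b by (auto simp: D_def)
  have bU: "\<i> * of_real b \<in> U t"
  proof -
    \<comment> \<open>An intermediate point whose value lies strictly between: the bound by Re phi_t
      at v survives the limit u -> T and still leaves a gap below c t.\<close>
    define v where "v = (t + \<tau>) / 2"
    have v: "t < v" "v < \<tau>" "v < T" using assms tau_le_T by (auto simp: v_def)
    have "((\<lambda>u. Re (phi t (\<zeta> u))) \<longlongrightarrow> Re (phi t (\<i> * of_real b))) (at_left T)"
      by (intro tendsto_intros isCont_tendsto_compose[OF isCont_phi[OF bD]] b)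
    moreover have "\<forall>\<^sub>F u in at_left T. Re (phi t (\<zeta> u)) \<le> Re (phi t (\<zeta> v))"
      using eventually_at_left_real[OF v(3)]
    proof eventually_elim
      case (elim u)
      show ?case
      proof (cases "u \<le> \<tau>")
        case True
        thus ?thesis using Re_phi_zeta_strict_antimono[of t v u] elim v assms by auto
      next
        case False
        have "Re (phi t (\<zeta> u)) = Re (phi t (\<zeta> \<tau>))"
          using assms False elim tau_pos by (simp add: Re_phi_circle cmod_zeta_after Im_zeta_pos)
        also have "\<dots> < Re (phi t (\<zeta> v))"
          using Re_phi_zeta_strict_antimono[of t v \<tau>] elim v assms False by auto
        finally show ?thesis by simp
      qed
    qed
    ultimately have "Re (phi t (\<i> * of_real b)) \<le> Re (phi t (\<zeta> v))"
      by (intro tendsto_upperbound) auto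
    also have "\<dots> < c t" using Re_phi_zeta_after_less[of t v] v assms by auto
    finally show ?thesis using bD by (simp add: U_def)
  qed
  obtain e where e: "e > 0" "ball (\<i> * of_real b) e \<subseteq> U t"
    using open_U bU openE by blast
  have "\<forall>\<^sub>F u in at_left T. \<zeta> u \<in> ball (\<i> * of_real b) e"
    using b(2) e(1) by (intro topological_tendstoD) auto
  hence "\<forall>\<^sub>F u in at_left T. \<zeta> u \<in> ball (\<i> * of_real b) e \<and> t < u \<and> u < T"
    using eventually_at_left_real[OF tT] by eventually_elim auto
  then obtain u0 where u0: "\<zeta> u0 \<in> ball (\<i> * of_real b) e" "t < u0" "u0 < T"
    using eventually_happens[of _ "at_left T"] trivial_limit_at_left_real by blast
  have conn0: "connected_component (U t) (\<zeta> u0) (\<i> * of_real b)"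
    unfolding connected_component_def using e u0 by (intro exI[of _ "ball (\<i> * of_real b) e"]) auto
  show thesis
  proof (rule that[OF b(1)])
    fix u assume u: "t < u" "u < T"
    have "connected_component (U t) (\<zeta> u) (\<zeta> u0)"
      using u u0 inU assms by (intro connected_component_curve[where S = "{t<..<T}"] continuous_on_zeta) auto
    thus "connected_component (U t) (\<zeta> u) (\<i> * of_real b)" using conn0 connected_component_trans by metis
  qed
qed

(* A direction of steepest descent: differentiating phi_t'(zeta(t)) = 0 in t gives
   phi_t''(zeta) * zeta' * zeta = - 1 / t, so (dir t)^2 = zeta' * zeta makes the second-order term negative. *)
definition dir :: "real \<Rightarrow> complex" where "dir t = \<zeta> t * csqrt (V' t / Q t)"

text \<open>So dir t / zeta t has positive real part: the descent segment crosses the circle through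
  zeta t transversally, with one end inside and one outside.\<close>

lemma Re_csqrt_log_deriv_pos:
  assumes "0 < t" "t < T" "t \<noteq> \<tau>"
  shows "Re (csqrt (V' t / Q t)) > 0"
proof -
  define w where "w = V' t / Q t"
  have "w \<notin> \<real>\<^sub>\<le>\<^sub>0"
  proof (cases "t < \<tau>")
    case True
    thus ?thesis using log_deriv_zeta_before[of t] assms unfolding w_def[symmetric] 
      by (auto simp: complex_nonpos_Reals_iff)
  next
    case False
    thus ?thesis using log_deriv_zeta_after[of t] assms unfolding w_def[symmetric] 
      by (auto simp: complex_nonpos_Reals_iff)
  qed
  show ?thesis unfolding w_def[symmetric]
  proof (rule ccontr)
    assume "\<not> Re (csqrt w) > 0"
    hence "Re (csqrt w) = 0" using csqrt_principal[of w] by auto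
    hence "(csqrt w)\<^sup>2 \<in> \<real>\<^sub>\<le>\<^sub>0" by (auto simp: complex_nonpos_Reals_iff power2_eq_square)
    thus False using \<open>w \<notin> \<real>\<^sub>\<le>\<^sub>0\<close> by simp
  qed
qed

lemma dir_nz:
  assumes "0 < t" "t < T" "t \<noteq> \<tau>" shows "dir t \<noteq> 0"
  using Re_csqrt_log_deriv_pos[OF assms] zeta_nz[of t] assms by (auto simp: dir_def)

lemma cmod_step:
  assumes "0 < t" "t < T" "t \<noteq> \<tau>"
  shows "\<forall>\<^sub>F \<epsilon> in at_right 0. cmod (\<zeta> t - of_real \<epsilon> * dir t) < cmod (\<zeta> t) \<and>
    cmod (\<zeta> t) < cmod (\<zeta> t + of_real \<epsilon> * dir t)"
proof -
  define k where "k = csqrt (V' t / Q t)"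
  have k: "Re k > 0" using Re_csqrt_log_deriv_pos[OF assms] by (simp add: k_def)
  have k0: "(cmod k)\<^sup>2 > 0" using k by auto
  have z: "cmod (\<zeta> t) > 0" using zeta_nz[of t] assms by simp
  have "\<forall>\<^sub>F \<epsilon> in at_right 0. 0 < \<epsilon> \<and> \<epsilon> < Re k / (cmod k)\<^sup>2"
    using k k0 by (intro eventually_at_right_0_less) simp
  thus ?thesis
  proof eventually_elim
    case (elim \<epsilon>)
    have sq: "(cmod (1 + of_real e * k))\<^sup>2 = 1 + 2 * e * Re k + e\<^sup>2 * (cmod k)\<^sup>2" for e
      unfolding cmod_power2 by (simp add: power2_eq_square algebra_simps)
    have "\<epsilon> * (cmod k)\<^sup>2 < Re k" using elim k0 by (simp add: field_simps)
    hence "\<epsilon> * (\<epsilon> * (cmod k)\<^sup>2) < \<epsilon> * (2 * Re k)" using elim k by (intro mult_strict_left_mono) auto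
    hence "(cmod (1 + of_real (- \<epsilon>) * k))\<^sup>2 < 1\<^sup>2" unfolding sq by (simp add: power2_eq_square)
    hence 1: "cmod (1 + of_real (- \<epsilon>) * k) < 1" by (rule power2_less_imp_less) simp
    have "1\<^sup>2 < (cmod (1 + of_real \<epsilon> * k))\<^sup>2" unfolding sq using elim k by (simp add: add_pos_nonneg)
    hence 2: "1 < cmod (1 + of_real \<epsilon> * k)" by (rule power2_less_imp_less) simp
    have "\<zeta> t - of_real \<epsilon> * dir t = \<zeta> t * (1 + of_real (- \<epsilon>) * k)"
         "\<zeta> t + of_real \<epsilon> * dir t = \<zeta> t * (1 + of_real \<epsilon> * k)"
      by (simp_all add: dir_def k_def algebra_simps)
    thus ?case using 1 2 z by (simp add: norm_mult)
  qed
qed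

lemma tendsto_step:
  "((\<lambda>\<epsilon>. \<zeta> t + of_real \<epsilon> * dir t) \<longlongrightarrow> \<zeta> t) (at_right 0)"
  "((\<lambda>\<epsilon>. \<zeta> t - of_real \<epsilon> * dir t) \<longlongrightarrow> \<zeta> t) (at_right 0)"
proof -
  have "((\<lambda>\<epsilon>. \<zeta> t + of_real \<epsilon> * dir t) \<longlongrightarrow> \<zeta> t + of_real 0 * dir t) (at_right 0)"
       "((\<lambda>\<epsilon>. \<zeta> t - of_real \<epsilon> * dir t) \<longlongrightarrow> \<zeta> t - of_real 0 * dir t) (at_right 0)"
    by (intro tendsto_intros)+
  thus "((\<lambda>\<epsilon>. \<zeta> t + of_real \<epsilon> * dir t) \<longlongrightarrow> \<zeta> t) (at_right 0)"
  "((\<lambda>\<epsilon>. \<zeta> t - of_real \<epsilon> * dir t) \<longlongrightarrow> \<zeta> t) (at_right 0)" by simp_all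
qed

lemma eventually_first_quadrant:
  assumes "(g \<longlongrightarrow> w) F" "Re w > 0" "Im w > 0"
  shows "\<forall>\<^sub>F x in F. Re (g x) > 0 \<and> Im (g x) > 0"
  using order_tendstoD(1)[OF tendsto_Re[OF assms(1)] assms(2)] order_tendstoD(1)[OF tendsto_Im[OF assms(1)] assms(3)]
  by (rule eventually_conj)

lemma IVT_cmod_zeta:
  assumes "0 < u" "u < v" "v < T" "cmod (\<zeta> u) < r" "r < cmod (\<zeta> v)"
  obtains x where "u < x" "x < v" "cmod (\<zeta> x) = r"
proof -
  have "\<exists>x\<ge>u. x \<le> v \<and> cmod (\<zeta> x) = r"
    using assms isCont_zeta by (intro IVT) auto
  then obtain x where "u \<le> x" "x \<le> v" "cmod (\<zeta> x) = r" by blast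
  thus ?thesis using that[of x] assms by (cases "x = u"; cases "x = v") auto
qed

text \<open>The inner end of the segment is joined along its own circle to the point of the curve
  with the same modulus, which belongs to a smaller parameter, and then along the curve to its
  start.\<close>

lemma conn_below:
  assumes "0 < t" "t < T" "t \<noteq> \<tau>"
  obtains z0 where "z0 > 0" "\<forall>\<^sub>F \<epsilon> in at_right 0. \<zeta> t - of_real \<epsilon> * dir t \<in> U t \<longrightarrow>
    connected_component (U t) (- \<i> * of_real z0) (\<zeta> t - of_real \<epsilon> * dir t)"
proof -
  obtain z0 u0 where z0: "0 < z0" "0 < u0" "u0 < min t \<tau>" "connected_component (U t) (- \<i> * of_real z0) (\<zeta> u0)"
    using conn_start[OF assms(1,2)] by blast
  \<comment> \<open>After tau the modulus of zeta is constant, so the curve up to v takes every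
    modulus between |zeta u0| and |zeta t|.\<close>
  define v where "v = min t \<tau>"
  have v: "0 < v" "v \<le> \<tau>" "v < T" "cmod (\<zeta> v) = cmod (\<zeta> t)" "u0 < v" "v \<le> t"
  proof -
    show "cmod (\<zeta> v) = cmod (\<zeta> t)"
    proof (cases "t < \<tau>")
      case False
      hence "(cmod (\<zeta> v))\<^sup>2 = (cmod (\<zeta> t))\<^sup>2" using assms by (simp add: v_def cmod_zeta_after)
      thus ?thesis by simp
    qed (simp add: v_def)
  qed (use assms tau_pos z0 in \<open>auto simp: v_def\<close>)
  have lim: "((\<lambda>\<epsilon>. \<zeta> t - of_real \<epsilon> * dir t) \<longlongrightarrow> \<zeta> t) (at_right 0)" by (rule tendsto_step)
  have "cmod (\<zeta> u0) < cmod (\<zeta> t)" using cmod_zeta_strict_mono[of u0 v] v z0 by auto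
  hence "\<forall>\<^sub>F \<epsilon> in at_right 0. cmod (\<zeta> u0) < cmod (\<zeta> t - of_real \<epsilon> * dir t)"
    using tendsto_norm[OF lim] by (intro order_tendstoD(1)) auto
  moreover have "\<forall>\<^sub>F \<epsilon> in at_right 0. Re (\<zeta> t - of_real \<epsilon> * dir t) > 0 \<and> Im (\<zeta> t - of_real \<epsilon> * dir t) > 0"
    using Re_zeta_pos Im_zeta_pos assms by (intro eventually_first_quadrant[OF lim]) auto
  ultimately have "\<forall>\<^sub>F \<epsilon> in at_right 0. \<zeta> t - of_real \<epsilon> * dir t \<in> U t \<longrightarrow>
    connected_component (U t) (- \<i> * of_real z0) (\<zeta> t - of_real \<epsilon> * dir t)"
    using cmod_step[OF assms]
  proof eventually_elim
    case (elim \<epsilon>)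
    show ?case
    proof
      define a where "a = \<zeta> t - of_real \<epsilon> * dir t"
      assume aU: "\<zeta> t - of_real \<epsilon> * dir t \<in> U t"
      obtain x where x: "u0 < x" "x < v" "cmod (\<zeta> x) = cmod a"
        using IVT_cmod_zeta[of u0 v "cmod a"] elim v z0 by (auto simp: a_def)
      have xU: "\<zeta> x \<in> U t" 
        using Re_phi_zeta_before_less[of x t] x v z0 assms zeta_in_D[of x] by (auto simp: U_def v_def)
      have "(cmod a)\<^sup>2 \<le> P" unfolding x(3)[symmetric]
        using cmod_zeta_before[of x] x v z0 by auto
      moreover have "z1 < cmod a" unfolding x(3)[symmetric] using cmod_zeta_gt[of x] x v z0 by auto
      moreover have "Re a > 0" "Im a > 0" using elim by (auto simp: a_def)
      moreover have "Re (\<zeta> x) > 0" "Im (\<zeta> x) > 0" using Re_zeta_pos[of x] Im_zeta_pos[of x] x v z0 by auto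
      ultimately have "connected_component (U t) (\<zeta> x) a"
        using x aU xU assms by (intro conn_circle) (auto simp: a_def)
      moreover have "connected_component (U t) (\<zeta> u0) (\<zeta> x)"
        using x v z0 assms by (intro conn_low) (auto simp: v_def)
      ultimately have "connected_component (U t) (- \<i> * of_real z0) a"
        using z0(4) connected_component_trans by metis
      thus "connected_component (U t) (- \<i> * of_real z0) (\<zeta> t - of_real \<epsilon> * dir t)"
        unfolding a_def .
    qed
  qed
  thus ?thesis using that z0 by blast
qed

text \<open>Before tau the outer end is joined along its circle to a later point of the curve. After
  tau it lies outside |z|^2 = P, which the curve no longer leaves, so the path climbs its own circle
  to the imaginary axis.\<close>

lemma conn_above:
  assumes "0 < t" "t < T" "t \<noteq> \<tau>"
  shows "\<forall>\<^sub>F \<epsilon> in at_right 0. \<zeta> t + of_real \<epsilon> * dir t \<in> U t \<longrightarrow>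
    (\<exists>b>0. connected_component (U t) (\<zeta> t + of_real \<epsilon> * dir t) (\<i> * of_real b))"
proof (cases "t < \<tau>")
  case True
  have lim: "((\<lambda>\<epsilon>. \<zeta> t + of_real \<epsilon> * dir t) \<longlongrightarrow> \<zeta> t) (at_right 0)" by (rule tendsto_step)
  obtain b where b: "b > 0" "\<And>u. \<lbrakk>t < u; u < T\<rbrakk> \<Longrightarrow> connected_component (U t) (\<zeta> u) (\<i> * of_real b)"
    using conn_high[OF assms(1) True] by blast
  define v where "v = (t + \<tau>) / 2"
  have v: "t < v" "v < \<tau>" "v < T" using True assms tau_le_T by (auto simp: v_def)
  have "cmod (\<zeta> t) < cmod (\<zeta> v)" using cmod_zeta_strict_mono[of t v] v assms by auto
  hence "\<forall>\<^sub>F \<epsilon> in at_right 0. cmod (\<zeta> t + of_real \<epsilon> * dir t) < cmod (\<zeta> v)"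
    using tendsto_norm[OF lim] by (intro order_tendstoD(2)) auto
  moreover have "\<forall>\<^sub>F \<epsilon> in at_right 0. Re (\<zeta> t + of_real \<epsilon> * dir t) > 0 \<and> Im (\<zeta> t + of_real \<epsilon> * dir t) > 0"
    using Re_zeta_pos Im_zeta_pos assms by (intro eventually_first_quadrant[OF lim]) auto
  ultimately show ?thesis using cmod_step[OF assms]
  proof eventually_elim
    case (elim \<epsilon>)
    show ?case
    proof
      define a where "a = \<zeta> t + of_real \<epsilon> * dir t"
      assume aU: "\<zeta> t + of_real \<epsilon> * dir t \<in> U t"
      obtain x where x: "t < x" "x < v" "cmod (\<zeta> x) = cmod a"
        using IVT_cmod_zeta[of t v "cmod a"] elim v assms by (auto simp: a_def)
      have xU: "\<zeta> x \<in> U t" 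
        using Re_phi_zeta_after_less[of t x] x v True assms zeta_in_D[of x] by (auto simp: U_def)
      have "(cmod a)\<^sup>2 \<le> P" unfolding x(3)[symmetric]
        using cmod_zeta_before[of x] x v assms by auto
      moreover have "z1 < cmod a" unfolding x(3)[symmetric] using cmod_zeta_gt[of x] x v assms by auto
      moreover have "Re a > 0" "Im a > 0" using elim by (auto simp: a_def)
      moreover have "Re (\<zeta> x) > 0" "Im (\<zeta> x) > 0" using Re_zeta_pos[of x] Im_zeta_pos[of x] x v assms by auto
      ultimately have "connected_component (U t) a (\<zeta> x)"
        using x aU xU assms by (intro conn_circle) (auto simp: a_def)
      hence "connected_component (U t) a (\<i> * of_real b)"
        using b(2)[of x] x v connected_component_trans by (metis less_trans)
      thus "\<exists>b>0. connected_component (U t) (\<zeta> t + of_real \<epsilon> * dir t) (\<i> * of_real b)"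
        unfolding a_def using b by blast
    qed
  qed
next
  case False
  hence gt: "\<tau> < t" using assms by simp
  have lim: "((\<lambda>\<epsilon>. \<zeta> t + of_real \<epsilon> * dir t) \<longlongrightarrow> \<zeta> t) (at_right 0)" by (rule tendsto_step)
  \<comment> \<open>F > 0 supplies the last hypothesis of \<open>conn_top\<close>. On |z|^2 = P both
    factors equal (z2 - z1) / 2 = sigma tau / 2, whereas Im zeta = sigma Im V / 2 is larger after
    tau; by continuity F stays positive nearby.\<close>
  define F where "F z = (Im z)\<^sup>2 - ((cmod z)\<^sup>2 - z1\<^sup>2) / (2 * z1) * ((z2\<^sup>2 - (cmod z)\<^sup>2) / (2 * z2))" for z
  have "F (\<zeta> t) > 0"
  proof -
    have P2: "(cmod (\<zeta> t))\<^sup>2 = P" using cmod_zeta_after[of t] gt assms by auto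
    have "(P - z1\<^sup>2) / (2 * z1) = (z2 - z1) / 2" "(z2\<^sup>2 - P) / (2 * z2) = (z2 - z1) / 2"
      using z1_pos z2_pos by (auto simp: P_def power2_eq_square field_simps)
    hence "F (\<zeta> t) = (Im (\<zeta> t))\<^sup>2 - ((z2 - z1) / 2)\<^sup>2" 
      unfolding F_def P2 by (simp only: power2_eq_square[of "(z2 - z1) / 2"])
    moreover have "\<sigma> * Im (V t) = 2 * Im (\<zeta> t)" using parts_zeta(2)[of t] assms P_pos unfolding P2 by simp
    moreover have "\<sigma> * \<tau> < \<sigma> * Im (V t)" using Im_V_ge(1)[OF assms(1)] gt sigma_pos by simp
    moreover have "\<sigma> * \<tau> = z2 - z1" using sigma_pos by (simp add: \<sigma>_def T1_def)
    ultimately show ?thesis using z1_less by (simp add: power_strict_mono)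
  qed
  moreover have "((\<lambda>\<epsilon>. F (\<zeta> t + of_real \<epsilon> * dir t)) \<longlongrightarrow> F (\<zeta> t)) (at_right 0)"
    unfolding F_def using z1_pos z2_pos by (intro tendsto_intros lim) auto
  ultimately have "\<forall>\<^sub>F \<epsilon> in at_right 0. F (\<zeta> t + of_real \<epsilon> * dir t) > 0"
    by (intro order_tendstoD(1)) auto
  moreover have "\<forall>\<^sub>F \<epsilon> in at_right 0. Re (\<zeta> t + of_real \<epsilon> * dir t) > 0 \<and> Im (\<zeta> t + of_real \<epsilon> * dir t) > 0"
    using Re_zeta_pos Im_zeta_pos assms by (intro eventually_first_quadrant[OF lim]) auto
  ultimately show ?thesis using cmod_step[OF assms]
  proof eventually_elim
    case (elim \<epsilon>)
    show ?case
    proof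
      define a where "a = \<zeta> t + of_real \<epsilon> * dir t"
      assume aU: "\<zeta> t + of_real \<epsilon> * dir t \<in> U t"
      have "P \<le> (cmod a)\<^sup>2"
      proof -
        have "(cmod (\<zeta> t))\<^sup>2 \<le> (cmod a)\<^sup>2" using elim by (intro power_mono) (auto simp: a_def)
        thus ?thesis using cmod_zeta_after[of t] gt assms by auto
      qed
      moreover have "Re a > 0" "Im a > 0" "F a > 0" using elim by (auto simp: a_def)
      ultimately have "connected_component (U t) a (\<i> * of_real (cmod a))"
        using aU assms by (intro conn_top) (auto simp: a_def F_def)
      moreover have "cmod a > 0" using \<open>Re a > 0\<close> by auto
      ultimately show "\<exists>b>0. connected_component (U t) (\<zeta> t + of_real \<epsilon> * dir t) (\<i> * of_real b)"
        unfolding a_def by blast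
    qed
  qed
qed

section \<open>Second derivative at the saddle; phase function and density\<close>

definition phi2 :: "real \<Rightarrow> complex" where
  "phi2 t = \<i> * of_real t * deriv f' (\<zeta> t) + 1 / (\<zeta> t)\<^sup>2"

lemma has_field_derivative_f':
  assumes "z \<in> Dsym" shows "(f' has_field_derivative deriv f' z) (at z)"
  using holomorphic_derivI[OF holomorphic_f' open_Dsym assms] by simp

lemma phi_second_deriv:
  assumes "0 < t"
  shows "((\<lambda>z. \<i> * of_real t * f' z - 1 / z) has_field_derivative phi2 t) (at (\<zeta> t))"
  unfolding phi2_def using has_field_derivative_f'[OF zeta_in_D(2)[OF assms]] zeta_nz[of t] assms
  by (auto intro!: derivative_eq_intros simp: power2_eq_square)

lemma phi2_dir:
  assumes "0 < t" "t < T" "t \<noteq> \<tau>"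
  shows "phi2 t * (dir t)\<^sup>2 = - of_real (1 / t)"
proof -
  define w where "w = V' t / Q t"
  define z where "z = \<zeta> t"
  have z: "z \<noteq> 0" using zeta_nz[of t] assms by (simp add: z_def)
  have dz: "(\<zeta> has_vector_derivative z * w) (at t)"
    using has_vector_derivative_zeta[OF assms] by (simp add: z_def w_def)
  have df: "((f' \<circ> \<zeta>) has_vector_derivative (z * w) * deriv f' z) (at t)"
    unfolding z_def by (intro field_vector_diff_chain_at dz[unfolded z_def] has_field_derivative_f' zeta_in_D assms)
  have "((\<lambda>u. of_real u * (f' (\<zeta> u) * \<zeta> u)) has_vector_derivative
      (of_real t * ((f' (\<zeta> t)) * (z * w) + (z * w) * deriv f' z * \<zeta> t) + 1 * (f' (\<zeta> t) * \<zeta> t))) (at t)"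
    using df dz by (intro has_vector_derivative_mult has_vector_derivative_of_real) 
      (auto simp: o_def intro!: derivative_eq_intros)
  \<comment> \<open>The critical point equation says that u f'(zeta u) zeta u is the constant -
    i.\<close>
  moreover have "((\<lambda>u. of_real u * (f' (\<zeta> u) * \<zeta> u)) has_vector_derivative 0) (at t)"
  proof (rule has_vector_derivative_transform_within_open[of "\<lambda>_. - \<i>" _ _ "{0<..}"])
    fix u :: real assume "u \<in> {0<..}"
    hence one: "\<i> * of_real u * f' (\<zeta> u) * \<zeta> u = 1"
      using saddle[of u] zeta_nz[of u] by simp
    have "of_real u * (f' (\<zeta> u) * \<zeta> u) = - \<i> * (\<i> * of_real u * f' (\<zeta> u) * \<zeta> u)"
      by (simp add: mult.assoc)
    thus "- \<i> = of_real u * (f' (\<zeta> u) * \<zeta> u)" unfolding one by simp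
  qed (use assms in auto)
  ultimately have "of_real t * ((f' z) * (z * w) + (z * w) * deriv f' z * z) + f' z * z = 0"
    unfolding z_def using vector_derivative_unique_at by fastforce
  hence "of_real t * f' z * z * w + of_real t * deriv f' z * z\<^sup>2 * w = - (f' z * z)"
    unfolding eq_neg_iff_add_eq_0 by (simp add: algebra_simps power2_eq_square)
  hence moved: "\<i> * (of_real t * f' z * z * w + of_real t * deriv f' z * z\<^sup>2 * w) = \<i> * - (f' z * z)" by simp
  have fz: "\<i> * of_real t * f' z * z = 1" using saddle[of t] z assms by (simp add: z_def)
  have *: "w + \<i> * of_real t * deriv f' z * z\<^sup>2 * w = - (\<i> * f' z * z)"
  proof -
    have "w + \<i> * of_real t * deriv f' z * z\<^sup>2 * w = (\<i> * of_real t * f' z * z) * w + \<i> * of_real t * deriv f' z * z\<^sup>2 * w"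
      unfolding fz by simp
    also have "\<dots> = \<i> * (of_real t * f' z * z * w + of_real t * deriv f' z * z\<^sup>2 * w)"
      by (simp only: distrib_left mult.assoc)
    also have "\<dots> = \<i> * - (f' z * z)" by (rule moved)
    finally show ?thesis by simp
  qed
  have "phi2 t * (dir t)\<^sup>2 = w + \<i> * of_real t * deriv f' z * z\<^sup>2 * w"
    using z by (simp add: phi2_def dir_def power_mult_distrib field_simps flip: z_def w_def)
  also have "\<dots> = - (\<i> * f' z * z)" by (rule *)
  also have "\<i> * f' z * z = of_real (1 / t)" using fz assms(1) by (simp add: field_simps)
  finally show ?thesis .
qed

text \<open>The phase of the saddle value in half turns. It serves as the limiting proportion of
  zeros in (0, t), one zero for each half turn.\<close>

definition Theta :: "real \<Rightarrow> real" where "Theta t = - Im (phi t (\<zeta> t)) / pi"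

definition dens :: "real \<Rightarrow> real" where "dens t = - Re (f (\<zeta> t)) / pi"

lemma Re_f: assumes "z \<in> Dsym"
  shows "Re (f z) = ln (cmod (of_real z1 - z)) + ln (cmod (of_real z2 - z)) - ln (cmod (of_real z1 + z)) - ln (cmod (of_real z2 + z))"
  using slit_nz[OF assms] by (simp add: f_fun_def)

lemma dens_eq:
  assumes "0 < t"
  shows "dens t = 1 / pi * ln (cmod (((of_real z1 + \<zeta> t) * (of_real z2 + \<zeta> t)) /
                                 ((of_real z1 - \<zeta> t) * (of_real z2 - \<zeta> t))))"
proof -
  have "ln (cmod ((a * b) / (c * d))) = - (ln (cmod c) + ln (cmod d) - ln (cmod a) - ln (cmod b))"
    if "a \<noteq> 0" "b \<noteq> 0" "c \<noteq> 0" "d \<noteq> 0" for a b c d :: complex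
    using that by (simp add: norm_mult norm_divide ln_mult ln_div)
  from this[OF slit_nz(3,4,1,2)[OF zeta_in_D(2)[OF assms]]] show ?thesis
    by (simp add: dens_def Re_f[OF zeta_in_D(2)[OF assms]])
qed

text \<open>With Re zeta > 0 the point zeta is nearer to z1 and z2 than to their negatives. So the
  sine wave of the local asymptotics has a positive frequency.\<close>

lemma dens_pos:
  assumes "0 < t" "t < T" shows "dens t > 0"
proof -
  have "cmod (of_real a - \<zeta> t) < cmod (of_real a + \<zeta> t)" if "a > 0" for a
  proof (rule power2_less_imp_less)
    have "a * Re (\<zeta> t) > 0" using that Re_zeta_pos[OF assms] by simp
    thus "(cmod (of_real a - \<zeta> t))\<^sup>2 < (cmod (of_real a + \<zeta> t))\<^sup>2"
      unfolding cmod_power2 by (simp add: power2_eq_square algebra_simps)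
  qed auto
  hence "ln (cmod (of_real z1 - \<zeta> t)) < ln (cmod (of_real z1 + \<zeta> t))"
        "ln (cmod (of_real z2 - \<zeta> t)) < ln (cmod (of_real z2 + \<zeta> t))"
    using z1_pos z2_pos slit_nz[OF zeta_in_D(2)[OF assms(1)]] by simp_all
  hence "Re (f (\<zeta> t)) < 0" unfolding Re_f[OF zeta_in_D(2)[OF assms(1)]] by simp
  thus ?thesis by (simp add: dens_def divide_neg_pos)
qed

lemma isCont_f_zeta:
  assumes "0 < t" "t < T" shows "isCont (\<lambda>t. f (\<zeta> t)) t"
  using isCont_o2[OF isCont_zeta[OF assms] isCont_f[OF zeta_in_D(2)[OF assms(1)]]] .

lemma isCont_dens:
  assumes "0 < t" "t < T" shows "isCont dens t"
  unfolding dens_def by (intro continuous_intros isCont_Re isCont_f_zeta assms) auto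

text \<open>The motion of zeta contributes nothing, because zeta t is critical for phi_t; only the
  explicit factor t in phi_t is differentiated, leaving i f.\<close>

lemma Theta_deriv:
  assumes "0 < t" "t < T" "t \<noteq> \<tau>"
  shows "(Theta has_real_derivative dens t) (at t)"
proof -
  define w where "w = V' t / Q t"
  define z where "z = \<zeta> t"
  have z: "z \<noteq> 0" using zeta_nz[of t] assms by (simp add: z_def)
  have dz: "(\<zeta> has_vector_derivative z * w) (at t)"
    using has_vector_derivative_zeta[OF assms] by (simp add: z_def w_def)
  have df: "((f \<circ> \<zeta>) has_vector_derivative (z * w) * f' z) (at t)"
    unfolding z_def by (intro field_vector_diff_chain_at dz[unfolded z_def] has_field_derivative_f zeta_in_D assms)
  have "(Ln has_field_derivative 1 / z) (at z)"
    using D_slit[OF zeta_in_D(1)[OF assms(1)]] unfolding z_def by (auto intro!: derivative_eq_intros simp: field_simps)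
  hence dl: "((Ln \<circ> \<zeta>) has_vector_derivative (z * w) * (1 / z)) (at t)"
    unfolding z_def by (intro field_vector_diff_chain_at dz[unfolded z_def])
  have "((\<lambda>u. \<i> * (of_real u * f (\<zeta> u)) - Ln (\<zeta> u)) has_vector_derivative
      (\<i> * (of_real t * ((z * w) * f' z) + 1 * f (\<zeta> t)) - (z * w) * (1 / z))) (at t)"
    using df dl by (intro has_vector_derivative_mult has_vector_derivative_of_real has_vector_derivative_diff has_vector_derivative_mult_right) 
      (auto simp: o_def intro!: derivative_eq_intros)
  moreover have "\<i> * (of_real t * ((z * w) * f' z) + 1 * f (\<zeta> t)) - (z * w) * (1 / z) = \<i> * f z"
  proof -
    have "\<i> * of_real t * f' z * z = 1" using saddle[of t] z assms by (simp add: z_def)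
    hence "w * (\<i> * of_real t * f' z * z) = w" by simp
    thus ?thesis using z by (simp add: algebra_simps z_def)
  qed
  ultimately have "((\<lambda>u. phi u (\<zeta> u)) has_vector_derivative \<i> * f z) (at t)"
    by (simp add: phi_def mult.assoc)
  from bounded_linear.has_vector_derivative[OF bounded_linear_Im this]
  have "((\<lambda>u. Im (phi u (\<zeta> u))) has_real_derivative Re (f z)) (at t)"
    by (simp add: has_real_derivative_iff_has_vector_derivative)
  thus ?thesis unfolding Theta_def[abs_def] dens_def z_def[symmetric]
    by (rule DERIV_cdivide[OF DERIV_minus])
qed

lemma Theta_eq: assumes "0 < t" shows "Theta t = (Im (Ln (\<zeta> t)) - t * Re (f (\<zeta> t))) / pi"
  by (simp add: Theta_def phi_def)

lemma isCont_Theta: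
  assumes "0 < t" "t < T" shows "isCont Theta t"
  unfolding Theta_def phi_def using D_slit[OF zeta_in_D(1)[OF assms(1)]]
  by (intro continuous_intros isCont_Im isCont_f_zeta isCont_zeta isCont_Ln' assms) auto

text \<open>f is odd and commutes with conjugation, so it is imaginary on the imaginary axis; what
  remains of Theta is the argument pi / 2 divided by pi.\<close>

lemma Theta_at_T: "(Theta \<longlongrightarrow> 1 / 2) (at_left T)"
proof -
  obtain b where b: "b > 0" "(\<zeta> \<longlongrightarrow> \<i> * of_real b) (at_left T)" using tendsto_zeta_at_T by blast
  define w where "w = \<i> * complex_of_real b"
  have wD: "w \<in> D" "w \<in> Dsym" using b by (auto simp: w_def D_def Dsym_def)
  have "cnj w = - w" by (simp add: w_def)
  hence "cnj (f w) = - f w" using f_cnj[OF wD(2)] f_minus[of w] by simp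
  hence Re0: "Re (f w) = 0" by (simp add: complex_eq_iff)
  have "((\<lambda>t. (Im (Ln (\<zeta> t)) - t * Re (f (\<zeta> t))) / pi) \<longlongrightarrow> (Im (Ln w) - T * Re (f w)) / pi) (at_left T)"
    using D_slit[OF wD(1)] b(2)
    by (intro tendsto_intros isCont_tendsto_compose[OF isCont_f[OF wD(2)]]) (auto simp: w_def)
  moreover have "\<forall>\<^sub>F t in at_left T. (Im (Ln (\<zeta> t)) - t * Re (f (\<zeta> t))) / pi = Theta t"
    using eventually_at_left_real[OF T_pos] by eventually_elim (auto simp: Theta_eq)
  moreover have "(Im (Ln w) - T * Re (f w)) / pi = 1 / 2"
    using b(1) unfolding Re0 by (simp add: w_def Im_Ln_upper)
  ultimately show ?thesis by (simp only:) (rule Lim_transform_eventually)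
qed

text \<open>f has a logarithmic singularity at the limit z1 of zeta. Still t Re f tends to 0,
  because |z1 - zeta t| is at least a multiple of t and t ln t -> 0.\<close>

lemma Theta_at_0: "(Theta \<longlongrightarrow> 0) (at_right 0)"
proof -
  let ?l2 = "\<lambda>t. ln (cmod (of_real z2 - \<zeta> t)) - ln (cmod (of_real z1 + \<zeta> t)) - ln (cmod (of_real z2 + \<zeta> t))"
  let ?l1 = "\<lambda>t. ln (cmod (of_real z1 - \<zeta> t))"
  have ev: "\<forall>\<^sub>F t in at_right 0. 0 < t \<and> t < T" using T_pos by (rule eventually_at_right_0_less)
  \<comment> \<open>From Im zeta * (1 + P / |zeta|^2) = sigma Im V >= sigma t and |zeta| > z1 one
    gets Im zeta >= c0 t.\<close>
  define c0 where "c0 = \<sigma> / (1 + P / z1\<^sup>2)"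
  have c0: "c0 > 0" using sigma_pos P_pos by (auto simp: c0_def add_pos_nonneg intro!: divide_pos_pos)
  have lb: "c0 * t \<le> cmod (of_real z1 - \<zeta> t)" if "0 < t" "t < T" for t
  proof -
    have "P / (cmod (\<zeta> t))\<^sup>2 \<le> P / z1\<^sup>2"
      using cmod_zeta_gt[OF that] z1_pos P_pos zeta_nz[of t] that
      by (intro divide_left_mono power_mono mult_pos_pos zero_less_power) auto
    hence "Im (\<zeta> t) * (1 + P / (cmod (\<zeta> t))\<^sup>2) \<le> Im (\<zeta> t) * (1 + P / z1\<^sup>2)"
      using Im_zeta_pos[of t] that by (intro mult_left_mono) auto
    moreover have "\<sigma> * t \<le> \<sigma> * Im (V t)" using Im_V_ge(1)[of t] that sigma_pos by simp
    ultimately have "\<sigma> * t \<le> Im (\<zeta> t) * (1 + P / z1\<^sup>2)" using parts_zeta(2)[of t] that by simp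
    hence "c0 * t \<le> Im (\<zeta> t)" unfolding c0_def using P_pos
      by (simp add: divide_le_eq add_pos_nonneg)
    also have "\<dots> \<le> cmod (of_real z1 - \<zeta> t)" using abs_Im_le_cmod[of "of_real z1 - \<zeta> t"] by simp
    finally show ?thesis .
  qed
  have l1: "((\<lambda>t. t * ?l1 t) \<longlongrightarrow> 0) (at_right 0)"
  proof (rule Lim_null_comparison)
    have "((\<lambda>t. t * ln (c0 * t)) \<longlongrightarrow> 0) (at_right 0)"
      using c0 by real_asymp
    thus "((\<lambda>t. \<bar>t * ln (c0 * t)\<bar>) \<longlongrightarrow> 0) (at_right 0)" by (rule tendsto_rabs_zero)
    have "((\<lambda>t. cmod (of_real z1 - \<zeta> t)) \<longlongrightarrow> cmod (of_real z1 - of_real z1)) (at_right 0)"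
      by (intro tendsto_intros tendsto_zeta_at_0)
    hence "\<forall>\<^sub>F t in at_right 0. cmod (of_real z1 - \<zeta> t) < 1" by (intro order_tendstoD) auto
    thus "\<forall>\<^sub>F t in at_right 0. norm (t * ?l1 t) \<le> \<bar>t * ln (c0 * t)\<bar>"
      using ev
    proof eventually_elim
      case (elim t)
      have p: "0 < c0 * t" using c0 elim by simp
      have le: "c0 * t \<le> cmod (of_real z1 - \<zeta> t)" using lb elim by auto
      hence "ln (c0 * t) \<le> ?l1 t" using p by (intro ln_mono) auto
      moreover have "?l1 t \<le> 0" using elim less_le_trans[OF p le] by (intro less_imp_le ln_less_zero) auto
      ultimately show ?case using elim by (simp add: abs_mult mult_left_mono)
    qed
  qed
  have "((\<lambda>t. t * ?l2 t) \<longlongrightarrow> 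
    0 * (ln (cmod (of_real z2 - of_real z1)) - ln (cmod (of_real z1 + of_real z1)) - ln (cmod (of_real z2 + of_real z1)))) (at_right 0)"
    using z1_pos z1_less by (intro tendsto_intros tendsto_zeta_at_0) (auto simp flip: of_real_diff of_real_add)
  from tendsto_add[OF l1 this]
  have "((\<lambda>t. t * ?l1 t + t * ?l2 t) \<longlongrightarrow> 0) (at_right 0)"
    by simp
  note l2 = this
  have l3: "((\<lambda>t. Im (Ln (\<zeta> t))) \<longlongrightarrow> Im (Ln (of_real z1))) (at_right 0)"
    using z1_pos by (intro tendsto_intros tendsto_zeta_at_0) (auto simp: complex_nonpos_Reals_iff)
  have "((\<lambda>t. (Im (Ln (\<zeta> t)) - (t * ?l1 t + t * ?l2 t)) / pi)
     \<longlongrightarrow> (Im (Ln (of_real z1)) - 0) / pi) (at_right 0)"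
    by (intro tendsto_divide tendsto_diff l2 l3 tendsto_const) auto
  moreover have "Im (Ln (of_real z1)) = 0" using z1_pos by (simp add: Ln_of_real)
  moreover have "\<forall>\<^sub>F t in at_right 0. (Im (Ln (\<zeta> t)) - (t * ?l1 t + t * ?l2 t)) / pi = Theta t"
    using ev 
  proof eventually_elim
    case (elim t)
    thus ?case using zeta_in_D[of t] by (simp add: Theta_eq Re_f algebra_simps)
  qed
  ultimately show ?thesis by (simp only: diff_0_right div_0) (rule Lim_transform_eventually)
qed

section \<open>Asymptotics of the coefficients\<close>

text \<open>Seen from z1 / 2, a segment to a point off the real axis meets that axis only at its
  start, which lies in the gap (0, z1).\<close>

lemma starlike_D: "starlike D"
proof -
  have "closed_segment (of_real (z1 / 2)) z \<subseteq> D" if z: "z \<in> D" for z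
  proof
    fix w assume "w \<in> closed_segment (of_real (z1 / 2)) z"
    then obtain u where u: "0 \<le> u" "u \<le> 1" "w = (1 - u) *\<^sub>R of_real (z1 / 2) + u *\<^sub>R z"
      by (auto simp: closed_segment_def)
    have im: "Im w = u * Im z" and re: "Re w = (1 - u) * (z1 / 2) + u * Re z" using u by auto
    show "w \<in> D"
    proof (cases "Im z = 0")
      case True
      hence rz: "0 < Re z" "Re z < z1" using z by (auto simp: D_def)
      have "Re w \<in> {0<..<z1}" unfolding re
        using convexD[of "{0<..<z1}" "z1/2" "Re z" "1 - u" u] rz z1_pos u by auto
      thus ?thesis by (auto simp: D_def)
    next
      case False
      thus ?thesis using im re z1_pos by (cases "u = 0") (auto simp: D_def)
    qed
  qed
  moreover have "complex_of_real (z1 / 2) \<in> D" using z1_pos by (auto simp: D_def)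
  ultimately show ?thesis unfolding starlike_def by blast
qed

lemma primitive_on_D:
  assumes "g holomorphic_on D"
  obtains \<Psi> where "\<And>z. z \<in> D \<Longrightarrow> (\<Psi> has_field_derivative g z) (at z)"
  using holomorphic_starlike_primitive[OF holomorphic_on_imp_continuous_on[OF assms] starlike_D open_D finite.emptyI]
    holomorphic_on_imp_differentiable_at[OF assms open_D] by auto

lemma ball_subset_Dsym: "ball 0 z1 \<subseteq> Dsym"
proof
  fix z :: complex assume "z \<in> ball 0 z1"
  thus "z \<in> Dsym" using abs_Re_le_cmod[of z] by (auto simp: Dsym_def)
qed

text \<open>By symmetry F is real on the imaginary axis, and with z = i y the form i^n F dz /
  z^(n+1) becomes F dy / y^(n+1). Moving an end point along either half of the axis hence leaves the
  imaginary part unchanged.\<close>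

lemma imaginary_axis_constant:
  assumes F: "\<And>z. z \<in> Dsym \<Longrightarrow> F (- cnj z) = cnj (F z)"
    and \<Psi>: "\<And>z. z \<in> D \<Longrightarrow> (\<Psi> has_field_derivative F z / z ^ Suc n) (at z)"
    and "convex S" "0 \<notin> S" "x \<in> S" "y \<in> S"
  shows "Im (\<i> ^ n * \<Psi> (\<i> * of_real x)) = Im (\<i> ^ n * \<Psi> (\<i> * of_real y))"
proof -
  have "\<exists>C. \<forall>y\<in>S. Im (\<i> ^ n * \<Psi> (\<i> * of_real y)) = C"
  proof (rule has_field_derivative_zero_constant[OF assms(3)])
    fix y assume "y \<in> S"
    hence y0: "y \<noteq> 0" using assms(4) by auto
    define z where "z = \<i> * complex_of_real y"
    have zD: "z \<in> D" using y0 by (auto simp: z_def D_def)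
    have "cnj (F z) = F (- cnj z)" using F[of z] zD D_subset by auto
    also have "- cnj z = z" by (simp add: z_def)
    finally have Fr: "Im (F z) = 0" by (simp add: complex_eq_iff)
    have "((\<lambda>y. \<i> * complex_of_real y) has_vector_derivative \<i>) (at y)"
      by (auto intro!: derivative_eq_intros)
    hence "((\<Psi> \<circ> (\<lambda>y. \<i> * complex_of_real y)) has_vector_derivative \<i> * (F z / z ^ Suc n)) (at y)"
      using field_vector_diff_chain_at \<Psi>[OF zD] unfolding z_def by blast
    hence "((\<lambda>y. \<i> ^ n * \<Psi> (\<i> * of_real y)) has_vector_derivative \<i> ^ n * (\<i> * (F z / z ^ Suc n))) (at y)"
      unfolding o_def by (rule has_vector_derivative_mult_right)
    moreover have "\<i> ^ n * (\<i> * (F z / z ^ Suc n)) = F z / of_real (y ^ Suc n)"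
      by (simp add: z_def power_mult_distrib field_simps y0)
    ultimately have "((\<lambda>y. \<i> ^ n * \<Psi> (\<i> * of_real y)) has_vector_derivative F z / of_real (y ^ Suc n)) (at y)"
      by simp
    from bounded_linear.has_vector_derivative[OF bounded_linear_Im this]
    have "((\<lambda>y. Im (\<i> ^ n * \<Psi> (\<i> * of_real y))) has_vector_derivative 0) (at y)"
      using Fr by (simp only: Im_divide_of_real div_0)
    thus "((\<lambda>y. Im (\<i> ^ n * \<Psi> (\<i> * of_real y))) has_field_derivative 0) (at y within S)"
      unfolding has_real_derivative_iff_has_vector_derivative by (rule has_vector_derivative_at_within)
  qed
  thus ?thesis using assms(5,6) by auto
qed

text \<open>The half circle may be replaced by any path in \<open>D\<close> from the lower to the
  upper half of the imaginary axis, with end points at any heights; the saddle path ends at heights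
  not known in advance.\<close>

lemma coefficient_formula:
  assumes F: "F has_fps_expansion A" "F holomorphic_on Dsym" "\<And>z. z \<in> Dsym \<Longrightarrow> F (- cnj z) = cnj (F z)"
    and \<Psi>: "\<And>z. z \<in> D \<Longrightarrow> (\<Psi> has_field_derivative F z / z ^ Suc n) (at z)"
    and b: "b > 0" "b' > 0"
  shows "\<i> ^ n * A $ n = of_real (Im (\<i> ^ n * (\<Psi> (\<i> * of_real b) - \<Psi> (- \<i> * of_real b'))) / pi)"
proof -
  define r where "r = z1 / 2"
  have r: "0 < r" "r < z1" using z1_pos by (auto simp: r_def)
  have path: "path_image (part_circlepath 0 r (- pi / 2) (pi / 2)) \<subseteq> D"
  proof
    fix z assume "z \<in> path_image (part_circlepath 0 r (- pi / 2) (pi / 2))"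
    then obtain x where x: "- pi / 2 \<le> x" "x \<le> pi / 2" "z = of_real r * exp (\<i> * of_real x)"
      by (auto simp: path_image_part_circlepath closed_segment_eq_real_ivl)
    hence z: "z = of_real r * cis x" by (simp add: cis_conv_exp)
    show "z \<in> D"
    proof (cases "x = 0")
      case True thus ?thesis using r by (auto simp: z D_def)
    next
      case False
      have "sin x \<noteq> 0"
        using sin_gt_zero[of x] sin_gt_zero[of "-x"] x(1,2) False pi_gt_zero 
        by (cases "x > 0") (auto simp: sin_minus)
      thus ?thesis using r by (auto simp: z D_def)
    qed
  qed
  have "contour_integral (part_circlepath 0 r (- pi / 2) (pi / 2)) (\<lambda>z. F z / z ^ Suc n)
     = \<Psi> (pathfinish (part_circlepath 0 r (- pi / 2) (pi / 2))) - \<Psi> (pathstart (part_circlepath 0 r (- pi / 2) (pi / 2)))"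
    using \<Psi> path by (intro contour_integral_unique contour_integral_primitive[of D])
       (auto intro: has_field_derivative_at_within)
  also have "\<dots> = \<Psi> (\<i> * of_real r) - \<Psi> (\<i> * of_real (- r))"
  proof -
    have "exp (\<i> * complex_of_real (pi / 2)) = \<i>" "exp (\<i> * complex_of_real (- pi / 2)) = - \<i>"
      by (simp_all only: cis_conv_exp[symmetric]) (simp_all add: complex_eq_iff)
    thus ?thesis unfolding pathstart_part_circlepath pathfinish_part_circlepath by (simp add: mult.commute)
  qed
  finally have J: "contour_integral (part_circlepath 0 r (- pi / 2) (pi / 2)) (\<lambda>z. F z / z ^ Suc n) =
    \<Psi> (\<i> * of_real r) - \<Psi> (\<i> * of_real (- r))" .
  have "Im (\<i> ^ n * \<Psi> (\<i> * of_real r)) = Im (\<i> ^ n * \<Psi> (\<i> * of_real b))"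
    by (rule imaginary_axis_constant[OF F(3) \<Psi>, of "{0<..}"]) (use r b in auto)
  moreover have "Im (\<i> ^ n * \<Psi> (\<i> * of_real (- r))) = Im (\<i> ^ n * \<Psi> (\<i> * of_real (- b')))"
    by (rule imaginary_axis_constant[OF F(3) \<Psi>, of "{..<0}"]) (use r b in auto)
  ultimately have "Im (\<i> ^ n * (\<Psi> (\<i> * of_real r) - \<Psi> (\<i> * of_real (- r)))) = Im (\<i> ^ n * (\<Psi> (\<i> * of_real b) - \<Psi> (\<i> * of_real (- b'))))"
    by (simp only: right_diff_distrib minus_complex.sel)
  moreover have "\<i> ^ n * A $ n = of_real (Im (\<i> ^ n * contour_integral (part_circlepath 0 r (- pi / 2) (pi / 2)) (\<lambda>z. F z / z ^ Suc n)) / pi)"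
    using half_circle_coefficient[OF F(1) holomorphic_on_subset[OF F(2) ball_subset_Dsym] r] F(3) ball_subset_Dsym by blast
  ultimately show ?thesis unfolding J by simp
qed

lemma conn_points:
  assumes "0 < t" "t < T" "t \<noteq> \<tau>"
  obtains \<epsilon> b b' where "\<epsilon> > 0" "b > 0" "b' > 0"
    "connected_component (U t) (- \<i> * of_real b') (\<zeta> t - of_real \<epsilon> * dir t)"
    "connected_component (U t) (\<zeta> t + of_real \<epsilon> * dir t) (\<i> * of_real b)"
    "\<And>y. \<bar>y\<bar> \<le> \<epsilon> \<Longrightarrow> \<zeta> t + of_real y * dir t \<in> D \<and>
       Re (phi t (\<zeta> t + of_real y * dir t)) - c t \<le> - (1 / (2 * t) / 2) * y\<^sup>2"
proof -
  obtain b' where b': "b' > 0" "\<forall>\<^sub>F \<epsilon> in at_right 0. \<zeta> t - of_real \<epsilon> * dir t \<in> U t \<longrightarrow>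
    connected_component (U t) (- \<i> * of_real b') (\<zeta> t - of_real \<epsilon> * dir t)"
    using conn_below[OF assms] by blast
  have "phi2 t / 2 * (dir t)\<^sup>2 = - of_real (1 / (2 * t))" using phi2_dir[OF assms] by simp
  hence "\<forall>\<^sub>F \<epsilon> in at_right 0. \<forall>y. \<bar>y\<bar> \<le> \<epsilon> \<longrightarrow> \<zeta> t + of_real y * dir t \<in> D \<and>
       Re (phi t (\<zeta> t + of_real y * dir t)) - c t \<le> - (1 / (2 * t) / 2) * y\<^sup>2"
    using assms zeta_in_D[of t]
    by (intro quadratic_decay[OF open_D _ has_field_derivative_phi _ phi_second_deriv] phi_crit) auto
  with eventually_at_right_less[of 0] b'(2) conn_above[OF assms]
  have "\<forall>\<^sub>F \<epsilon> in at_right 0. \<epsilon> > 0 \<and> (\<exists>b>0. 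
     connected_component (U t) (- \<i> * of_real b') (\<zeta> t - of_real \<epsilon> * dir t) \<and>
     connected_component (U t) (\<zeta> t + of_real \<epsilon> * dir t) (\<i> * of_real b)) \<and>
     (\<forall>y. \<bar>y\<bar> \<le> \<epsilon> \<longrightarrow> \<zeta> t + of_real y * dir t \<in> D \<and>
       Re (phi t (\<zeta> t + of_real y * dir t)) - c t \<le> - (1 / (2 * t) / 2) * y\<^sup>2)"
  proof eventually_elim
    case (elim \<epsilon>)
    have neg: "- (1 / (2 * t) / 2) * \<epsilon>\<^sup>2 < 0" using assms elim by simp
    have "\<zeta> t + of_real \<epsilon> * dir t \<in> D" "Re (phi t (\<zeta> t + of_real \<epsilon> * dir t)) - c t \<le> - (1 / (2 * t) / 2) * \<epsilon>\<^sup>2"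
      using elim(4)[rule_format, of \<epsilon>] elim(1) by auto
    hence 1: "\<zeta> t + of_real \<epsilon> * dir t \<in> U t" using neg by (simp add: U_def)
    have "\<zeta> t + of_real (- \<epsilon>) * dir t \<in> D" "Re (phi t (\<zeta> t + of_real (- \<epsilon>) * dir t)) - c t \<le> - (1 / (2 * t) / 2) * (- \<epsilon>)\<^sup>2"
      using elim(4)[rule_format, of "- \<epsilon>"] elim(1) by auto
    hence 2: "\<zeta> t - of_real \<epsilon> * dir t \<in> U t" using neg by (simp add: U_def)
    show ?case using elim 1 2 by blast
  qed
  from eventually_happens'[OF trivial_limit_at_right_real this] show ?thesis using that b'(1) by blast
qed

text \<open>The leading coefficient of Laplace's method at zeta t; the rate 1 / (2 t) is - phi2 t /
  2 * (dir t)^2.\<close>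

definition amp :: "(complex \<Rightarrow> complex) \<Rightarrow> real \<Rightarrow> complex" where
  "amp G t = G (\<zeta> t) / \<zeta> t * (dir t * of_real (\<integral>v. exp (- (1 / (2 * t)) * v\<^sup>2) \<partial>lborel))"

lemma amp_nz:
  assumes "0 < t" "t < T" "t \<noteq> \<tau>" "G (\<zeta> t) \<noteq> 0"
  shows "amp G t \<noteq> 0"
  using assms dir_nz[OF assms(1-3)] zeta_nz[of t] gaussian_integral_pos(2)[of "1 / (2 * t)"]
  by (auto simp: amp_def)

text \<open>Moving t to t + s n / n multiplies the integrand by the bounded factor exp (i s n f),
  which joins the amplitude. Thus the exponent n phi_t, its saddle and the path are the same for the
  whole window.\<close>

lemma coefficient_asymptotics:
  fixes e :: "nat \<Rightarrow> real \<Rightarrow> complex" and s :: "nat \<Rightarrow> real"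
  assumes t: "0 < t" "t < T" "t \<noteq> \<tau>"
    and G: "G holomorphic_on Dsym" "\<And>z. z \<in> Dsym \<Longrightarrow> G (- cnj z) = cnj (G z)"
    and e: "\<And>n u. \<exists>A. (\<lambda>z. G z * exp (\<i> * of_nat n * of_real u * f z)) has_fps_expansion A \<and> A $ n = e n u"
    and s: "\<And>n. 0 \<le> s n" "\<And>n. s n \<le> M"
  shows "(\<lambda>n. sqrt (real n) * exp (- real n * c t) * (pi * Re (\<i> ^ n * e n (t + s n / real n)))
     - Im (\<i> ^ n * exp (\<i> * of_real (real n * Im (phi t (\<zeta> t)))) * (amp G t * exp (\<i> * of_real (s n) * f (\<zeta> t))))) \<longlonglongrightarrow> 0"
proof -
  let ?g = "dir t * of_real (\<integral>v. exp (- (1 / (2 * t)) * v\<^sup>2) \<partial>lborel)"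
  let ?q = "\<lambda>n. complex_of_real (sqrt (real n)) * exp (- of_nat n * phi t (\<zeta> t))"
  obtain \<epsilon> b b' where eb: "\<epsilon> > 0" "b > 0" "b' > 0"
    "connected_component (U t) (- \<i> * of_real b') (\<zeta> t - of_real \<epsilon> * dir t)"
    "connected_component (U t) (\<zeta> t + of_real \<epsilon> * dir t) (\<i> * of_real b)"
    "\<And>y. \<bar>y\<bar> \<le> \<epsilon> \<Longrightarrow> \<zeta> t + of_real y * dir t \<in> D \<and>
       Re (phi t (\<zeta> t + of_real y * dir t)) - c t \<le> - (1 / (2 * t) / 2) * y\<^sup>2"
    using conn_points[OF t] by blast
  define am where "am = \<zeta> t - of_real \<epsilon> * dir t"
  define ap where "ap = \<zeta> t + of_real \<epsilon> * dir t"
  define K where "K n z = G z / z * exp (\<i> * of_real (s n) * f z)" for n z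
  have zD: "\<zeta> t \<in> D" "\<zeta> t \<in> Dsym" using zeta_in_D[OF t(1)] by auto
  have GD: "G holomorphic_on D" "f holomorphic_on D"
    using G(1) holomorphic_f D_subset holomorphic_on_subset by blast+
  have holK: "K n holomorphic_on D" for n
    unfolding K_def using D_slit(2) by (intro holomorphic_intros GD) auto
  have holKe: "(\<lambda>z. K n z * exp (of_nat n * phi t z)) holomorphic_on D" for n
    by (intro holomorphic_intros holK holomorphic_phi)
  have "\<forall>n. \<exists>\<Psi>. \<forall>z\<in>D. (\<Psi> has_field_derivative K n z * exp (of_nat n * phi t z)) (at z)"
  proof
    fix n show "\<exists>\<Psi>. \<forall>z\<in>D. (\<Psi> has_field_derivative K n z * exp (of_nat n * phi t z)) (at z)"
      by (rule primitive_on_D[OF holKe[of n]]) blast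
  qed
  from choice[OF this] obtain \<Psi> where "\<forall>n. \<forall>z\<in>D. (\<Psi> n has_field_derivative K n z * exp (of_nat n * phi t z)) (at z)"
    by blast
  hence \<Psi>: "\<And>n z. z \<in> D \<Longrightarrow> (\<Psi> n has_field_derivative K n z * exp (of_nat n * phi t z)) (at z)"
    by blast
  have Keq: "K n z * exp (of_nat n * phi t z) = G z * exp (\<i> * of_nat n * of_real (t + s n / real n) * f z) / z ^ Suc n"
    if "z \<in> D" "n > 0" for n z
  proof -
    have z0: "z \<noteq> 0" using D_slit that by auto
    have ex: "\<i> * of_real (s n) * f z + of_nat n * phi t z = \<i> * of_nat n * of_real (t + s n / real n) * f z + - (of_nat n * Ln z)"
      using that(2) by (simp add: phi_def algebra_simps)
    have "exp (of_nat n * Ln z) = z ^ n" using z0 by (simp add: exp_of_nat_mult)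
    hence ln: "exp (- (of_nat n * Ln z)) = 1 / z ^ n" by (simp only: exp_minus inverse_eq_divide)
    have eq: "exp (\<i> * of_real (s n) * f z) * exp (of_nat n * phi t z) = exp (\<i> * of_nat n * of_real (t + s n / real n) * f z) / z ^ n"
      by (simp only: mult_exp_exp ex exp_add[of _ "- (of_nat n * Ln z)"] ln times_divide_eq_right mult_1_right)
    show ?thesis unfolding K_def mult.assoc[of "G z / z"] eq by (simp only: times_divide_times_eq power_Suc)
  qed
  have coeff: "\<i> ^ n * e n (t + s n / real n) = of_real (Im (\<i> ^ n * (\<Psi> n (\<i> * of_real b) - \<Psi> n (- \<i> * of_real b'))) / pi)"
    if n: "n > 0" for n
  proof -
    define u where "u = t + s n / real n"
    obtain A where A: "(\<lambda>z. G z * exp (\<i> * of_nat n * of_real u * f z)) has_fps_expansion A" "A $ n = e n u"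
      using e[of n u] by blast
    have "\<i> ^ n * A $ n = of_real (Im (\<i> ^ n * (\<Psi> n (\<i> * of_real b) - \<Psi> n (- \<i> * of_real b'))) / pi)"
    proof (rule coefficient_formula[OF A(1) _ _ _ eb(2,3)])
      show "(\<lambda>z. G z * exp (\<i> * of_nat n * of_real u * f z)) holomorphic_on Dsym"
        by (intro holomorphic_intros G holomorphic_f)
      fix z assume z: "z \<in> Dsym"
      have fm: "f (- cnj z) = - cnj (f z)" by (simp only: f_minus f_cnj[OF z])
      have cm: "cnj (\<i> * of_nat n * of_real u * w) = \<i> * of_nat n * of_real u * - cnj w" for w by simp
      show "G (- cnj z) * exp (\<i> * of_nat n * of_real u * f (- cnj z)) = cnj (G z * exp (\<i> * of_nat n * of_real u * f z))"
        by (simp only: complex_cnj_mult[of "G z"] exp_cnj cm fm G(2)[OF z])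
    next
      fix z assume "z \<in> D"
      thus "(\<Psi> n has_field_derivative G z * exp (\<i> * of_nat n * of_real u * f z) / z ^ Suc n) (at z)"
        using \<Psi>[of z n] Keq[of z n] n by (simp add: u_def)
    qed
    thus ?thesis using A(2) by (simp add: u_def)
  qed
  \<comment> \<open>Bounds all K n at once, since 0 <= s n <= M. The sequence s n may oscillate, so
    K n need not converge and uniform bounds are used.\<close>
  define h where "h w = cmod (G w / w) * exp (M * cmod (f w))" for w
  have contH: "continuous_on D h"
    unfolding h_def using D_slit(2)
    by (intro continuous_intros holomorphic_on_imp_continuous_on[OF GD(1)] holomorphic_on_imp_continuous_on[OF GD(2)]) auto
  have Kh: "cmod (K n w) \<le> h w" for n w
  proof -
    have "Re (\<i> * of_real (s n) * f w) \<le> cmod (\<i> * of_real (s n) * f w)" by (rule complex_Re_le_cmod)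
    also have "\<dots> = s n * cmod (f w)" using s(1)[of n] by (simp add: norm_mult)
    also have "\<dots> \<le> M * cmod (f w)" using s(2) by (intro mult_right_mono) auto
    finally show ?thesis
      unfolding K_def h_def norm_mult norm_exp_eq_Re by (intro mult_left_mono) auto
  qed
  have Kb: "\<exists>r>0. \<exists>B. \<forall>w\<in>ball z r. \<forall>n. cmod (K n w) \<le> B" if zD': "z \<in> D" for z
  proof -
    obtain r where r: "r > 0" "cball z r \<subseteq> D" using iffD1[OF open_contains_cball open_D] zD' by auto
    have "continuous_on (cball z r) h" by (rule continuous_on_subset[OF contH r(2)])
    hence "bounded (h ` cball z r)" by (intro compact_imp_bounded compact_continuous_image) auto
    then obtain B where B: "\<And>w. w \<in> cball z r \<Longrightarrow> \<bar>h w\<bar> \<le> B"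
      unfolding bounded_iff by (auto simp del: mem_cball)
    have "cmod (K n w) \<le> B" if w: "w \<in> ball z r" for n w
    proof -
      have "cmod (K n w) \<le> h w" by (rule Kh)
      also have "\<dots> \<le> B" using B[of w] w by auto
      finally show ?thesis .
    qed
    thus ?thesis using r(1) by blast
  qed
  have UD: "U t \<subseteq> D" by (auto simp: U_def)
  have neg: "(\<lambda>n. sqrt (real n) * exp (- real n * c t) * cmod (\<Psi> n y - \<Psi> n x)) \<longlonglongrightarrow> 0"
    if "connected_component (U t) x y" for x y
    by (rule primitive_difference_negligible[where \<phi> = "phi t" and K = K, OF open_U _ _ _ _ that])
       (use \<Psi> Kb UD in \<open>auto simp: U_def intro!: continuous_on_subset[OF holomorphic_on_imp_continuous_on[OF holomorphic_phi]]\<close>)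
  have seg: "(\<lambda>n. ?q n * (\<Psi> n ap - \<Psi> n am)
      - K n (\<zeta> t) * ?g) \<longlonglongrightarrow> 0"
  proof -
    have inD: "closed_segment am ap \<subseteq> D"
    proof
      fix z assume "z \<in> closed_segment am ap"
      then obtain x where x: "0 \<le> x" "x \<le> 1" "z = (1 - x) *\<^sub>R am + x *\<^sub>R ap"
        by (auto simp: closed_segment_def)
      have "z = \<zeta> t + of_real ((2 * x - 1) * \<epsilon>) * dir t" unfolding x am_def ap_def by (simp add: scaleR_conv_of_real algebra_simps)
      moreover have "\<bar>(2 * x - 1) * \<epsilon>\<bar> \<le> \<epsilon>" using x eb(1) by (auto simp: abs_mult)
      ultimately show "z \<in> D" using eb(6) by metis
    qed
    have ci: "contour_integral (linepath am ap) (\<lambda>z. K n z * exp (of_nat n * phi t z)) = \<Psi> n ap - \<Psi> n am" for n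
    proof -
      have "((\<lambda>z. K n z * exp (of_nat n * phi t z)) has_contour_integral (\<Psi> n (pathfinish (linepath am ap)) - \<Psi> n (pathstart (linepath am ap)))) (linepath am ap)"
        by (rule contour_integral_primitive[of D]) (use \<Psi> inD in \<open>auto intro: has_field_derivative_at_within\<close>)
      thus ?thesis by (simp add: contour_integral_unique)
    qed
    have "continuous_on (closed_segment am ap) h" by (rule continuous_on_subset[OF contH inD])
    hence "bounded (h ` closed_segment am ap)" by (intro compact_imp_bounded compact_continuous_image) auto
    then obtain B where B: "\<And>w. w \<in> closed_segment am ap \<Longrightarrow> \<bar>h w\<bar> \<le> B" unfolding bounded_iff by auto
    have KB: "cmod (K n (\<zeta> t + of_real y * dir t)) \<le> B" if y: "\<bar>y\<bar> \<le> \<epsilon>" for n y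
    proof -
      define w where "w = \<zeta> t + of_real y * dir t"
      define x where "x = (y / \<epsilon> + 1) / 2"
      have x: "0 \<le> x" "x \<le> 1" "(2 * x - 1) * \<epsilon> = y" using y eb(1) by (auto simp: x_def field_simps abs_le_iff)
      have "w = (1 - x) *\<^sub>R am + x *\<^sub>R ap"
        unfolding w_def am_def ap_def x(3)[symmetric] by (simp add: scaleR_conv_of_real algebra_simps)
      hence w: "w \<in> closed_segment am ap" using x by (auto simp: closed_segment_def)
      have "cmod (K n w) \<le> h w" by (rule Kh)
      also have "\<dots> \<le> B" using B[OF w] by auto
      finally show ?thesis by (simp add: w_def)
    qed
    have Klim: "(\<lambda>n. K n (\<zeta> t + of_real (v / sqrt (real n)) * dir t) - K n (\<zeta> t)) \<longlonglongrightarrow> 0" for v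
    proof -
      define w where "w n = \<zeta> t + of_real (v / sqrt (real n)) * dir t" for n
      have "(\<lambda>n. v / sqrt (real n)) \<longlonglongrightarrow> 0" by real_asymp
      hence "w \<longlonglongrightarrow> \<zeta> t + of_real 0 * dir t" unfolding w_def by (intro tendsto_intros)
      hence w: "w \<longlonglongrightarrow> \<zeta> t" by simp
      have fl: "(\<lambda>n. f (w n)) \<longlonglongrightarrow> f (\<zeta> t)" by (rule isCont_tendsto_compose[OF isCont_f[OF zD(2)] w])
      have "isCont G (\<zeta> t)" using G(1) zD(2) open_Dsym
        by (meson continuous_on_eq_continuous_at holomorphic_on_imp_continuous_on)
      hence "(\<lambda>n. G (w n) / w n) \<longlonglongrightarrow> G (\<zeta> t) / \<zeta> t"
        using D_slit(2)[OF zD(1)] by (intro tendsto_intros w isCont_tendsto_compose[OF _ w])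
      hence gl: "(\<lambda>n. G (w n) / w n - G (\<zeta> t) / \<zeta> t) \<longlonglongrightarrow> 0" by (simp add: LIM_zero)
      have dl: "(\<lambda>n. \<i> * of_real (s n) * (f (w n) - f (\<zeta> t))) \<longlonglongrightarrow> 0"
      proof (rule Lim_null_comparison)
        show "\<forall>\<^sub>F n in sequentially. norm (\<i> * of_real (s n) * (f (w n) - f (\<zeta> t))) \<le> M * norm (f (w n) - f (\<zeta> t))"
          using s by (intro always_eventually allI) (auto simp: norm_mult intro!: mult_right_mono)
        show "(\<lambda>n. M * norm (f (w n) - f (\<zeta> t))) \<longlonglongrightarrow> 0"
          using fl by (intro tendsto_mult_right_zero tendsto_norm_zero) (simp add: LIM_zero)
      qed
      from tendsto_exp[OF dl] have el: "(\<lambda>n. exp (\<i> * of_real (s n) * (f (w n) - f (\<zeta> t)))) \<longlonglongrightarrow> 1" by simp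
      have prod: "(\<lambda>n. (G (w n) / w n) * exp (\<i> * of_real (s n) * (f (w n) - f (\<zeta> t))) - G (\<zeta> t) / \<zeta> t) \<longlonglongrightarrow> 0"
        using tendsto_mult[OF \<open>(\<lambda>n. G (w n) / w n) \<longlonglongrightarrow> G (\<zeta> t) / \<zeta> t\<close> el] by (simp add: LIM_zero)
      define C where "C = exp (M * cmod (f (\<zeta> t)))"
      show ?thesis
      proof (rule Lim_null_comparison)
        show "\<forall>\<^sub>F n in sequentially. cmod (K n (\<zeta> t + of_real (v / sqrt (real n)) * dir t) - K n (\<zeta> t))
           \<le> C * cmod ((G (w n) / w n) * exp (\<i> * of_real (s n) * (f (w n) - f (\<zeta> t))) - G (\<zeta> t) / \<zeta> t)"
        proof (intro always_eventually allI)
          fix n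
          have "exp (\<i> * of_real (s n) * f (w n)) = exp (\<i> * of_real (s n) * f (\<zeta> t)) * exp (\<i> * of_real (s n) * (f (w n) - f (\<zeta> t)))"
            unfolding mult_exp_exp by (simp add: algebra_simps)
          hence "K n (w n) - K n (\<zeta> t) = exp (\<i> * of_real (s n) * f (\<zeta> t)) * ((G (w n) / w n) * exp (\<i> * of_real (s n) * (f (w n) - f (\<zeta> t))) - G (\<zeta> t) / \<zeta> t)"
            unfolding K_def by (simp add: algebra_simps)
          moreover have "cmod (exp (\<i> * of_real (s n) * f (\<zeta> t))) \<le> C"
          proof -
            have "Re (\<i> * of_real (s n) * f (\<zeta> t)) \<le> cmod (\<i> * of_real (s n) * f (\<zeta> t))" by (rule complex_Re_le_cmod)
            also have "\<dots> = s n * cmod (f (\<zeta> t))" using s(1)[of n] by (simp add: norm_mult)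
            also have "\<dots> \<le> M * cmod (f (\<zeta> t))" using s(2) by (intro mult_right_mono) auto
            finally show ?thesis unfolding C_def norm_exp_eq_Re by simp
          qed
          ultimately show "cmod (K n (\<zeta> t + of_real (v / sqrt (real n)) * dir t) - K n (\<zeta> t))
           \<le> C * cmod ((G (w n) / w n) * exp (\<i> * of_real (s n) * (f (w n) - f (\<zeta> t))) - G (\<zeta> t) / \<zeta> t)"
            unfolding w_def[symmetric] by (simp only: norm_mult) (intro mult_right_mono, auto)
        qed
        show "(\<lambda>n. C * cmod ((G (w n) / w n) * exp (\<i> * of_real (s n) * (f (w n) - f (\<zeta> t))) - G (\<zeta> t) / \<zeta> t)) \<longlonglongrightarrow> 0"
          by (intro tendsto_mult_right_zero tendsto_norm_zero prod)
      qed
    qed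
    have mu: "phi2 t / 2 * (dir t)\<^sup>2 = - of_real (1 / (2 * t))" using phi2_dir[OF t] by simp
    have kt: "1 / (2 * t) > 0" using t(1) by simp
    have "(\<lambda>n. ?q n *
      contour_integral (linepath (\<zeta> t - of_real \<epsilon> * dir t) (\<zeta> t + of_real \<epsilon> * dir t)) (\<lambda>z. K n z * exp (of_nat n * phi t z))
      - K n (\<zeta> t) * ?g) \<longlonglongrightarrow> 0"
      by (rule laplace_segment[where B = B, OF open_D zD(1) has_field_derivative_phi phi_crit[OF t(1)] phi_second_deriv[OF t(1)] mu kt eb(1,6)
          holomorphic_on_imp_continuous_on[OF holK] KB Klim])
    thus ?thesis unfolding am_def[symmetric] ap_def[symmetric] ci .
  qed
  \<comment> \<open>The whole normalised integral. It is split at \<open>am\<close> and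
    \<open>ap\<close> into the Laplace segment and two parts inside U t, which are
    negligible.\<close>
  define X where "X n = ?q n * (\<Psi> n (\<i> * of_real b) - \<Psi> n (- \<i> * of_real b'))" for n
  have cexp: "cmod (?q n * w) = sqrt (real n) * exp (- real n * c t) * cmod w" for n w
    by (simp add: norm_mult)
  have neg': "(\<lambda>n. ?q n * (\<Psi> n y - \<Psi> n x)) \<longlonglongrightarrow> 0"
    if "connected_component (U t) x y" for x y
    by (rule tendsto_norm_zero_cancel, simp only: cexp, rule neg[OF that])
  have "(\<lambda>n. X n - K n (\<zeta> t) * ?g) \<longlonglongrightarrow> 0 + 0 + 0"
  proof (rule Lim_transform_eventually[OF tendsto_add[OF tendsto_add[OF seg neg'[OF eb(4)]] neg'[OF eb(5)]]])
    show "\<forall>\<^sub>F n in sequentially. ?q n * (\<Psi> n ap - \<Psi> n am) -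
           K n (\<zeta> t) * ?g +
           ?q n * (\<Psi> n (\<zeta> t - of_real \<epsilon> * dir t) - \<Psi> n (- \<i> * of_real b')) +
           ?q n * (\<Psi> n (\<i> * of_real b) - \<Psi> n (\<zeta> t + of_real \<epsilon> * dir t)) =
          X n - K n (\<zeta> t) * ?g"
    proof (intro always_eventually allI)
      fix n
      have alg: "q * (a - a') - k + q * (a' - z') + q * (z - a) = q * (z - z') - k" for q a a' k z z' :: complex
        by (simp add: algebra_simps)
      show "?q n * (\<Psi> n ap - \<Psi> n am) -
           K n (\<zeta> t) * ?g +
           ?q n * (\<Psi> n (\<zeta> t - of_real \<epsilon> * dir t) - \<Psi> n (- \<i> * of_real b')) +
           ?q n * (\<Psi> n (\<i> * of_real b) - \<Psi> n (\<zeta> t + of_real \<epsilon> * dir t)) =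
          X n - K n (\<zeta> t) * ?g"
        unfolding X_def am_def[symmetric] ap_def[symmetric] by (rule alg)
    qed
  qed
  hence X: "(\<lambda>n. X n - amp G t * exp (\<i> * of_real (s n) * f (\<zeta> t))) \<longlonglongrightarrow> 0"
    by (simp add: K_def amp_def mult_ac)
  show ?thesis
  proof (rule Lim_null_comparison)
    show "(\<lambda>n. cmod (X n - amp G t * exp (\<i> * of_real (s n) * f (\<zeta> t)))) \<longlonglongrightarrow> 0"
      using X by (rule tendsto_norm_zero)
    show "\<forall>\<^sub>F n in sequentially. norm (sqrt (real n) * exp (- real n * c t) * (pi * Re (\<i> ^ n * e n (t + s n / real n)))
     - Im (\<i> ^ n * exp (\<i> * of_real (real n * Im (phi t (\<zeta> t)))) * (amp G t * exp (\<i> * of_real (s n) * f (\<zeta> t)))))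
     \<le> cmod (X n - amp G t * exp (\<i> * of_real (s n) * f (\<zeta> t)))"
      using eventually_gt_at_top[of 0]
    proof eventually_elim
      case (elim n)
      \<comment> \<open>A unit factor cancelling the phase of exp (- n phi_t(zeta t)), so that the
        positive normalisation exp (- n c t) is left.\<close>
      define w where "w = exp (\<i> * of_real (real n * Im (phi t (\<zeta> t))))"
      define d where "d = \<Psi> n (\<i> * of_real b) - \<Psi> n (- \<i> * of_real b')"
      have "pi * Re (\<i> ^ n * e n (t + s n / real n)) = Im (\<i> ^ n * d)"
        unfolding coeff[OF elim] d_def by simp
      hence "sqrt (real n) * exp (- real n * c t) * (pi * Re (\<i> ^ n * e n (t + s n / real n))) = 
         Im (of_real (sqrt (real n) * exp (- real n * c t)) * (\<i> ^ n * d))" by simp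
      also have "of_real (sqrt (real n) * exp (- real n * c t)) * (\<i> ^ n * d) = \<i> ^ n * w * X n"
      proof -
        have "w * exp (- of_nat n * phi t (\<zeta> t)) = exp (of_real (- real n * c t))"
          unfolding w_def mult_exp_exp by (rule arg_cong[of _ _ exp]) (simp add: complex_eq_iff)
        hence wexp: "of_real (exp (- real n * c t)) = w * exp (- of_nat n * phi t (\<zeta> t))" by (simp only: exp_of_real)
        have "a * (w' * e') * (i' * d') = i' * w' * (a * e' * d')" for a w' e' i' d' :: complex by (simp only: mult_ac)
        thus ?thesis unfolding X_def d_def[symmetric] of_real_mult wexp .
      qed
      finally have "sqrt (real n) * exp (- real n * c t) * (pi * Re (\<i> ^ n * e n (t + s n / real n)))
         - Im (\<i> ^ n * w * (amp G t * exp (\<i> * of_real (s n) * f (\<zeta> t)))) =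
         Im (\<i> ^ n * w * (X n - amp G t * exp (\<i> * of_real (s n) * f (\<zeta> t))))"
        by (simp only: right_diff_distrib minus_complex.sel)
      also have "norm \<dots> \<le> cmod (\<i> ^ n * w * (X n - amp G t * exp (\<i> * of_real (s n) * f (\<zeta> t))))"
        using abs_Im_le_cmod by (simp only: real_norm_def)
      also have "\<dots> = cmod (X n - amp G t * exp (\<i> * of_real (s n) * f (\<zeta> t)))"
        by (simp add: norm_mult norm_power w_def)
      finally show ?case unfolding w_def .
    qed
  qed
qed

section \<open>The zeros on the critical line\<close>

text \<open>This makes i^n times the coefficient a real function on the line, whose zeros can be
  found from sign changes.\<close>

lemma coefficient_real:
  assumes F: "F has_fps_expansion A" "F holomorphic_on Dsym" "\<And>z. z \<in> Dsym \<Longrightarrow> F (- cnj z) = cnj (F z)"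
  shows "Im (\<i> ^ n * A $ n) = 0"
proof -
  have "(\<lambda>z. F z / z ^ Suc n) holomorphic_on D"
    using D_slit(2) by (intro holomorphic_intros holomorphic_on_subset[OF F(2) D_subset]) auto
  then obtain \<Psi> where \<Psi>: "\<And>z. z \<in> D \<Longrightarrow> (\<Psi> has_field_derivative F z / z ^ Suc n) (at z)"
    using primitive_on_D by blast
  show ?thesis unfolding coefficient_formula[OF F \<Psi> zero_less_one zero_less_one, simplified] by simp
qed

lemma symmetric_integrand:
  assumes "z \<in> Dsym" "G (- cnj z) = cnj (G z)"
  shows "G (- cnj z) * exp (\<i> * of_nat n * of_real u * f (- cnj z)) = cnj (G z * exp (\<i> * of_nat n * of_real u * f z))"
proof -
  have fm: "f (- cnj z) = - cnj (f z)" by (simp only: f_minus f_cnj[OF assms(1)])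
  have cm: "cnj (\<i> * of_nat n * of_real u * w) = \<i> * of_nat n * of_real u * - cnj w" for w by simp
  show ?thesis by (simp only: complex_cnj_mult[of "G z"] exp_cnj cm fm assms(2))
qed

text \<open>The offset s in (0, M) parametrises the window (t, t + M / n). The normalised
  coefficient is a sine wave of amplitude w s >= a, up to an error that is eventually below a / 2
  for all s together.\<close>

lemma local_zero_count:
  fixes e :: "nat \<Rightarrow> real \<Rightarrow> complex"
  assumes t: "0 < t" "t < T" "t \<noteq> \<tau>" and M: "M > 0"
    and G: "G holomorphic_on Dsym" "\<And>z. z \<in> Dsym \<Longrightarrow> G (- cnj z) = cnj (G z)" "\<And>z. z \<in> Dsym \<Longrightarrow> G z \<noteq> 0"
    and e: "\<And>n u. \<exists>A. (\<lambda>z. G z * exp (\<i> * of_nat n * of_real u * f z)) has_fps_expansion A \<and> A $ n = e n u"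
    and cont: "\<And>n. continuous_on UNIV (e n)"
    and fin: "\<And>n. finite {u. e n u = 0} \<or> (\<forall>u. e n u = 0)"
  shows "\<forall>\<^sub>F n in sequentially. finite {u. e n u = 0} \<and>
     M * dens t - 2 \<le> real (card ({u. e n u = 0} \<inter> {t<..<t + M / real n}))"
proof -
  have real: "Im (\<i> ^ n * e n u) = 0" for n u
  proof -
    obtain A where A: "(\<lambda>z. G z * exp (\<i> * of_nat n * of_real u * f z)) has_fps_expansion A" "A $ n = e n u"
      using e by blast
    have "Im (\<i> ^ n * A $ n) = 0"
      by (rule coefficient_real[OF A(1)]) (intro holomorphic_intros G holomorphic_f symmetric_integrand | assumption)+
    thus ?thesis unfolding A(2) .
  qed
  define F where "F = - Re (f (\<zeta> t))"
  have F: "F > 0" "F / pi = dens t" using dens_pos[OF t(1,2)] by (auto simp: F_def dens_def divide_less_0_iff)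
  define \<gamma> where "\<gamma> = gam (\<zeta> t)"
  have \<gamma>: "\<gamma> > 0" "Im (f (\<zeta> t)) = - \<gamma>" using gam_pos Im_f_upper[OF Im_zeta_pos[OF t(1)]] by (auto simp: \<gamma>_def)
  define a where "a = cmod (amp G t)"
  have a: "a > 0" using amp_nz[OF t, of G] G(3) zeta_in_D[OF t(1)] by (simp add: a_def)
  \<comment> \<open>At least a quarter period pi / 2 / F is always included, which serves to exclude
    that e n vanishes identically.\<close>
  define M' where "M' = max M (pi / 2 / F)"
  have M': "M \<le> M'" "pi / 2 / F \<le> M'" "0 < M'" using M by (auto simp: M'_def)
  define R where "R n s = sqrt (real n) * exp (- real n * c t) * (pi * Re (\<i> ^ n * e n (t + s / real n)))" for n s
  define b where "b n = \<i> ^ n * exp (\<i> * of_real (real n * Im (phi t (\<zeta> t)))) * amp G t" for n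
  have bn: "cmod (b n) = a" for n by (simp add: b_def norm_mult norm_power a_def)
  define w where "w s = a * exp (s * \<gamma>)" for s
  \<comment> \<open>exp (i s f) has modulus exp (s gamma) and phase - s F with gamma = - Im f and F
    = - Re f: a wave of frequency F and growing amplitude.\<close>
  have main: "Im (b n * exp (\<i> * of_real s * f (\<zeta> t))) = - (w s * sin (- Arg (b n) + s * F))" for n s
  proof -
    have "b n = of_real a * cis (Arg (b n))" using rcis_cmod_Arg[of "b n"] by (simp add: rcis_def bn)
    moreover have "exp (\<i> * of_real s * f (\<zeta> t)) = of_real (exp (s * \<gamma>)) * cis (- s * F)"
      using \<gamma>(2) by (simp add: complex_eq_iff Re_exp Im_exp F_def)
    ultimately have "b n * exp (\<i> * of_real s * f (\<zeta> t)) = of_real (w s) * (cis (Arg (b n)) * cis (- s * F))"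
      by (metis (no_types, opaque_lifting) w_def of_real_mult mult.assoc mult.left_commute)
    also have "\<dots> = of_real (w s) * cis (- (- Arg (b n) + s * F))" by (simp add: cis_mult)
    finally have "b n * exp (\<i> * of_real s * f (\<zeta> t)) = of_real (w s) * cis (- (- Arg (b n) + s * F))" .
    moreover have "Im (of_real (w s) * cis (- y)) = - (w s * sin y)" for y by simp
    ultimately show ?thesis by (simp only:)
  qed
  have "\<forall>\<^sub>F n in sequentially. \<forall>s\<in>{0..M'}. \<bar>R n s + w s * sin (- Arg (b n) + s * F)\<bar> < a / 2"
  proof (rule uniform_from_sequences)
    fix s :: "nat \<Rightarrow> real" assume "\<And>n. s n \<in> {0..M'}"
    hence "(\<lambda>n. sqrt (real n) * exp (- real n * c t) * (pi * Re (\<i> ^ n * e n (t + s n / real n)))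
     - Im (\<i> ^ n * exp (\<i> * of_real (real n * Im (phi t (\<zeta> t)))) * (amp G t * exp (\<i> * of_real (s n) * f (\<zeta> t))))) \<longlonglongrightarrow> 0"
      by (intro coefficient_asymptotics[OF t G(1,2) e]) auto
    moreover have "\<i> ^ n * exp (\<i> * of_real (real n * Im (phi t (\<zeta> t)))) * (amp G t * exp (\<i> * of_real (s n) * f (\<zeta> t)))
       = b n * exp (\<i> * of_real (s n) * f (\<zeta> t))" for n by (simp only: b_def mult.assoc)
    ultimately have "(\<lambda>n. R n (s n) - Im (b n * exp (\<i> * of_real (s n) * f (\<zeta> t)))) \<longlonglongrightarrow> 0"
      unfolding R_def by (simp only:)
    thus "(\<lambda>n. R n (s n) + w (s n) * sin (- Arg (b n) + s n * F)) \<longlonglongrightarrow> 0"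
      unfolding main by simp
  qed (use a M' in auto)
  with eventually_gt_at_top[of "0::nat"] show ?thesis
  proof eventually_elim
    case (elim n)
    have R0: "R n s = 0 \<longleftrightarrow> e n (t + s / real n) = 0" for s
    proof -
      have "R n s = 0 \<longleftrightarrow> Re (\<i> ^ n * e n (t + s / real n)) = 0" using elim(1) by (simp add: R_def)
      also have "\<dots> \<longleftrightarrow> \<i> ^ n * e n (t + s / real n) = 0" using real[of n "t + s / real n"] by (simp add: complex_eq_iff)
      finally show ?thesis by simp
    qed
    have wge: "a \<le> w s" if "0 \<le> s" for s
      using that \<gamma>(1) a by (simp add: w_def)
    \<comment> \<open>If e n vanished everywhere, the sine alone would be below 1/2 at offsets 0 and
      pi / 2 / F. There its values are sin theta and cos theta, whose squares add up to 1.\<close>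
    have finZ: "finite {u. e n u = 0}"
    proof (rule ccontr)
      assume "infinite {u. e n u = 0}"
      hence z: "R n s = 0" for s using fin[of n] R0 by blast
      define \<theta> where "\<theta> = - Arg (b n)"
      have small: "\<bar>sin (\<theta> + s * F)\<bar> < 1 / 2" if s: "s \<in> {0..M'}" for s
      proof -
        have "a * \<bar>sin (\<theta> + s * F)\<bar> \<le> w s * \<bar>sin (\<theta> + s * F)\<bar>" using wge s by (intro mult_right_mono) auto
        also have "\<dots> = \<bar>w s * sin (\<theta> + s * F)\<bar>" using wge[of s] s a by (simp add: abs_mult)
        also have "\<dots> < a / 2"
        proof -
          have "\<bar>R n s + w s * sin (- Arg (b n) + s * F)\<bar> < a / 2" using elim(2) s by blast
          thus ?thesis unfolding z \<theta>_def by simp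
        qed
        finally show ?thesis using a by simp
      qed
      have "\<bar>sin \<theta>\<bar> < 1 / 2" using small[of 0] M' by simp
      moreover have "sin (\<theta> + pi / 2 / F * F) = cos \<theta>" using F(1) by (simp add: sin_add)
      hence "\<bar>cos \<theta>\<bar> < 1 / 2" using small[of "pi / 2 / F"] M' F(1) by simp
      moreover have "y\<^sup>2 < (1 / 2)\<^sup>2" if "\<bar>y\<bar> < 1 / 2" for y :: real
        using power_strict_mono[OF that, of 2] by simp
      ultimately have "(sin \<theta>)\<^sup>2 < (1 / 2)\<^sup>2" "(cos \<theta>)\<^sup>2 < (1 / 2)\<^sup>2" by blast+
      hence "(sin \<theta>)\<^sup>2 + (cos \<theta>)\<^sup>2 < 1" by (simp add: power2_eq_square)
      thus False by simp
    qed
    have inj: "inj_on (\<lambda>s. t + s / real n) S" for S using elim(1) by (auto simp: inj_on_def)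
    have sub: "(\<lambda>s. t + s / real n) ` {s \<in> {0<..<M}. R n s = 0} \<subseteq> {u. e n u = 0} \<inter> {t<..<t + M / real n}"
      using elim(1) by (auto simp: R0 divide_strict_right_mono)
    have finI: "finite ({u. e n u = 0} \<inter> {t<..<t + M / real n})" using finZ by simp
    have fs: "finite {s \<in> {0<..<M}. R n s = 0}" by (rule finite_imageD[OF finite_subset[OF sub finI] inj])
    \<comment> \<open>The limiting wave carries a minus sign, hence the counting lemma is applied to
      - R.\<close>
    have "M * F / pi - 2 \<le> real (card {s \<in> {0<..<M}. - R n s = 0})"
    proof (rule card_zeros_sin_perturbation[where w = w and \<theta> = "- Arg (b n)"])
      show "continuous_on {0..M} (\<lambda>s. - R n s)"
        unfolding R_def using elim(1)
        by (intro continuous_intros continuous_on_compose2[OF cont[of n]]) auto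
      show "\<bar>- R n s - w s * sin (- Arg (b n) + s * F)\<bar> < w s" if "s \<in> {0..M}" for s
      proof -
        have "s \<in> {0..M'}" using that M' by auto
        hence "\<bar>R n s + w s * sin (- Arg (b n) + s * F)\<bar> < a / 2" using elim(2) by blast
        moreover have "a \<le> w s" using wge that by simp
        ultimately show ?thesis using a by linarith
      qed
      show "finite {s \<in> {0<..<M}. - R n s = 0}" using fs by simp
    qed (rule F(1))
    also have "{s \<in> {0<..<M}. - R n s = 0} = {s \<in> {0<..<M}. R n s = 0}" by simp
    also have "real (card {s \<in> {0<..<M}. R n s = 0}) \<le> real (card ({u. e n u = 0} \<inter> {t<..<t + M / real n}))"
      using card_inj_on_le[OF inj sub finI] by simp
    finally show ?case using finZ F(2)[symmetric] by simp
  qed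
qed

lemma integral_dens:
  assumes "0 < a" "a \<le> b" "b < T"
  shows "integral {a..b} dens = Theta b - Theta a"
proof (rule integral_unique, rule fundamental_theorem_of_calculus_interior_strong[of "{\<tau>}"])
  show "continuous_on {a..b} Theta" using assms by (intro continuous_at_imp_continuous_on) (auto intro: isCont_Theta)
  fix x assume "x \<in> {a<..<b} - {\<tau>}"
  thus "(Theta has_vector_derivative dens x) (at x)"
    using Theta_deriv[of x] assms by (auto simp: has_real_derivative_iff_has_vector_derivative)
qed (use assms in auto)

lemma continuous_on_dens: "0 < a \<Longrightarrow> b < T \<Longrightarrow> continuous_on {a..b} dens"
  by (intro continuous_at_imp_continuous_on) (auto intro: isCont_dens)

lemma zero_count_limit:
  fixes e :: "nat \<Rightarrow> real \<Rightarrow> complex"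
  assumes G: "G holomorphic_on Dsym" "\<And>z. z \<in> Dsym \<Longrightarrow> G (- cnj z) = cnj (G z)" "\<And>z. z \<in> Dsym \<Longrightarrow> G z \<noteq> 0"
    and e: "\<And>n u. \<exists>A. (\<lambda>z. G z * exp (\<i> * of_nat n * of_real u * f z)) has_fps_expansion A \<and> A $ n = e n u"
    and cont: "\<And>n. continuous_on UNIV (e n)"
    and fin: "\<And>n. finite {u. e n u = 0} \<or> (\<forall>u. e n u = 0)"
    and card: "\<And>n. finite {u. e n u = 0} \<Longrightarrow> card {u. e n u = 0} \<le> n"
    and sym: "\<And>n u. e n u = 0 \<Longrightarrow> e n (- u) = 0"
    and xy: "0 < x" "x < y" "y < T"
  shows "(\<lambda>n. real (card ({u. e n u = 0} \<inter> {x<..<y})) / real n) \<longlonglongrightarrow> Theta y - Theta x"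
proof -
  \<comment> \<open>The empty set stands in for indices at which e n vanishes identically; by
    \<open>local_zero_count\<close> these stop for large n, so the limit is the same.\<close>
  define Z where "Z n = (if finite {u. e n u = 0} then {u. e n u = 0} else {})" for n
  have fin_ev: "\<forall>\<^sub>F n in sequentially. finite {u. e n u = 0}"
  proof -
    define t where "t = min \<tau> T / 2"
    have "0 < t" "t < T" "t \<noteq> \<tau>" using tau_pos T_pos by (auto simp: t_def)
    hence "\<forall>\<^sub>F n in sequentially. finite {u. e n u = 0} \<and>
         1 * dens t - 2 \<le> real (card ({u. e n u = 0} \<inter> {t<..<t + 1 / real n}))"
      by (intro local_zero_count[OF _ _ _ _ G e cont fin]) auto
    thus ?thesis by eventually_elim (rule conjunct1)
  qed
  have "(\<lambda>n. real (card (Z n \<inter> {x<..<y})) / real n) \<longlonglongrightarrow> Theta y - Theta x"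
  proof (rule counting_squeeze[where T = T, OF _ _ _ Theta_at_0 Theta_at_T xy])
    fix n
    show "finite (Z n)" by (simp add: Z_def)
    show "real (card (Z n \<inter> {0<..})) \<le> real n / 2"
      by (rule card_pos_symmetric_le) (auto simp: Z_def sym card split: if_splits)
  next
    fix a b \<eta> :: real assume ab: "0 < a" "a < b" "b < T" "\<eta> > 0"
    have "\<forall>\<^sub>F n in sequentially. integral {a..b} dens - \<eta> \<le> real (card (Z n \<inter> {a<..<b})) / real n"
    proof (rule counting_liminf[OF ab(2) _ continuous_on_dens[OF ab(1,3)] _ _ ab(4), of Z "{\<tau>}"])
      fix t M :: real assume t: "a < t" "t < b" "t \<notin> {\<tau>}" and M: "M > 0"
      have "\<forall>\<^sub>F n in sequentially. finite {u. e n u = 0} \<and>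
         M * dens t - 2 \<le> real (card ({u. e n u = 0} \<inter> {t<..<t + M / real n}))"
        using t ab M by (intro local_zero_count[OF _ _ _ _ G e cont fin]) auto
      thus "\<forall>\<^sub>F n in sequentially. M * dens t - 2 \<le> real (card (Z n \<inter> {t<..<t + M / real n}))"
        by eventually_elim (simp add: Z_def)
    qed (auto simp: Z_def)
    thus "\<forall>\<^sub>F n in sequentially. Theta b - Theta a - \<eta> \<le> real (card (Z n \<inter> {a<..<b})) / real n"
      using ab by (simp add: integral_dens)
  qed
  moreover have "\<forall>\<^sub>F n in sequentially. real (card (Z n \<inter> {x<..<y})) / real n = real (card ({u. e n u = 0} \<inter> {x<..<y})) / real n"
    using fin_ev by eventually_elim (simp add: Z_def)
  ultimately show ?thesis by (rule Lim_transform_eventually)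
qed

text \<open>At x = tau \<open>Theta_deriv\<close> gives no derivative. The mean value theorem on (x,
  x + eps), an interval free of tau for small eps, and the continuity of \<open>dens\<close> include
  this point.\<close>

lemma Theta_right_derivative:
  assumes "0 < x" "x < T"
  shows "((\<lambda>\<epsilon>. 1 / \<epsilon> * (Theta (x + \<epsilon>) - Theta x)) \<longlongrightarrow> dens x) (at_right 0)"
proof (rule tendstoI)
  fix r :: real assume r: "r > 0"
  obtain d where d: "d > 0" "\<And>y. \<bar>y - x\<bar> < d \<Longrightarrow> \<bar>dens y - dens x\<bar> < r"
    using isCont_dens[OF assms] r unfolding continuous_at_eps_delta dist_real_def by metis
  \<comment> \<open>Keeps x + eps below T and within reach of continuity, and if x < tau also keeps
    tau out of the open interval.\<close>
  define m where "m = Min ({d, T - x} \<union> (if x < \<tau> then {\<tau> - x} else {}))"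
  have m: "m > 0" "m \<le> d" "m \<le> T - x" "x < \<tau> \<Longrightarrow> m \<le> \<tau> - x"
    using d assms by (auto simp: m_def)
  have "\<forall>\<^sub>F \<epsilon> in at_right 0. \<epsilon> \<in> {0<..<m}" using m(1) by (rule eventually_at_right_real)
  thus "\<forall>\<^sub>F \<epsilon> in at_right 0. dist (1 / \<epsilon> * (Theta (x + \<epsilon>) - Theta x)) (dens x) < r"
  proof eventually_elim
    case (elim \<epsilon>)
    have "x < x + \<epsilon>" using elim by simp
    moreover have "continuous_on {x..x + \<epsilon>} Theta"
      using elim m(3) assms by (intro continuous_at_imp_continuous_on) (auto intro!: isCont_Theta)
    moreover have deriv: "(Theta has_real_derivative dens z) (at z)" if "x < z" "z < x + \<epsilon>" for z
    proof -
      have "z \<noteq> \<tau>" using that elim m(4) by (cases "x < \<tau>") auto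
      thus ?thesis using that elim m(3) assms by (intro Theta_deriv) auto
    qed
    ultimately obtain l z where z: "x < z" "z < x + \<epsilon>" "DERIV Theta z :> l"
        "Theta (x + \<epsilon>) - Theta x = (x + \<epsilon> - x) * l"
      using MVT[of x "x + \<epsilon>" Theta] real_differentiable_def by blast
    have "l = dens z" using DERIV_unique[OF z(3) deriv[OF z(1,2)]] .
    hence "1 / \<epsilon> * (Theta (x + \<epsilon>) - Theta x) = dens z" using z(4) elim by simp
    moreover have "\<bar>z - x\<bar> < d" using z elim m(2) by auto
    ultimately show ?case using d(2)[of z] by (simp add: dist_real_def)
  qed
qed

section \<open>The weight G = h e^(c f)\<close>

lemma slit_square:
  assumes "z \<in> Dsym" "\<alpha> > z1\<^sup>2"
  shows "of_real \<alpha> - z\<^sup>2 \<notin> \<real>\<^sub>\<le>\<^sub>0"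
proof
  assume "of_real \<alpha> - z\<^sup>2 \<in> \<real>\<^sub>\<le>\<^sub>0"
  hence *: "Re z * Im z = 0" "\<alpha> \<le> (Re z)\<^sup>2 - (Im z)\<^sup>2"
    by (auto simp: complex_nonpos_Reals_iff power2_eq_square)
  have "0 < \<alpha>" using assms(2) by (meson le_less_trans zero_le_power2)
  have "Re z \<noteq> 0"
  proof
    assume "Re z = 0"
    thus False using *(2) \<open>0 < \<alpha>\<close> zero_le_power2[of "Im z"] by simp
  qed
  hence "Im z = 0" using *(1) by simp
  hence "\<bar>Re z\<bar> < z1" using assms(1) by (auto simp: Dsym_def)
  hence "(Re z)\<^sup>2 < z1\<^sup>2" using power_strict_mono[of "\<bar>Re z\<bar>" z1 2] by simp
  thus False using *(2) \<open>Im z = 0\<close> assms(2) by simp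
qed

lemma even_weight_facts:
  assumes "\<forall>i\<in>{1..m}. \<alpha> i > z1\<^sup>2"
  shows "even_weight z1 z2 a b m \<alpha> r holomorphic_on Dsym"
    and "z \<in> Dsym \<Longrightarrow> even_weight z1 z2 a b m \<alpha> r (- cnj z) = cnj (even_weight z1 z2 a b m \<alpha> r z)"
    and "even_weight z1 z2 a b m \<alpha> r z \<noteq> 0"
proof -
  have sq: "of_real (\<alpha> i) - z\<^sup>2 \<notin> \<real>\<^sub>\<le>\<^sub>0" if "z \<in> Dsym" "i \<in> {1..m}" for z i
    using slit_square[OF that(1)] assms that(2) by blast
  show "even_weight z1 z2 a b m \<alpha> r holomorphic_on Dsym"
    unfolding even_weight_def using slit sq by (intro holomorphic_intros) auto
  show "even_weight z1 z2 a b m \<alpha> r z \<noteq> 0" by (simp add: even_weight_def)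
  show "even_weight z1 z2 a b m \<alpha> r (- cnj z) = cnj (even_weight z1 z2 a b m \<alpha> r z)" if z: "z \<in> Dsym"
  proof -
    have "Ln (of_real z1 - - cnj z) = cnj (Ln (of_real z1 + z))" "Ln (of_real z1 + - cnj z) = cnj (Ln (of_real z1 - z))"
         "Ln (of_real z2 - - cnj z) = cnj (Ln (of_real z2 + z))" "Ln (of_real z2 + - cnj z) = cnj (Ln (of_real z2 - z))"
      using slit[OF z] by (simp_all add: cnj_Ln)
    moreover have "(\<Prod>i=1..m. exp (of_real (r i) * Ln (of_real (\<alpha> i) - (- cnj z)\<^sup>2))) = 
       cnj (\<Prod>i=1..m. exp (of_real (r i) * Ln (of_real (\<alpha> i) - z\<^sup>2)))"
      unfolding cnj_prod
    proof (rule prod.cong[OF refl])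
      fix i assume "i \<in> {1..m}"
      from cnj_Ln[OF sq[OF z this]]
      show "exp (of_real (r i) * Ln (of_real (\<alpha> i) - (- cnj z)\<^sup>2)) = cnj (exp (of_real (r i) * Ln (of_real (\<alpha> i) - z\<^sup>2)))"
        by (simp add: exp_cnj)
    qed
    ultimately show ?thesis
      unfolding even_weight_def complex_cnj_mult exp_cnj complex_cnj_add complex_cnj_complex_of_real
      by (simp only: add.commute)
  qed
qed

text \<open>The exponents p + k of z1 - z and p' - k of z1 + z coincide, and likewise for z2. With s
  = i n u this is the integrand on the critical line; s = - k recovers h from the even
  weight.\<close>

lemma h_times_exp:
  assumes "\<forall>i\<in>{1..m}. \<alpha> i > z1\<^sup>2" "p' - p = 2 * k" "q' - q = 2 * k" "z \<in> Dsym"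
  shows "h_fun z1 z2 p p' q q' m \<alpha> r z * exp ((of_real k + s) * f z) = even_weight z1 z2 (p + k) (q + k) m \<alpha> r z * exp (s * f z)"
proof -
  have n: "of_real z1 - z \<noteq> 0" "of_real z2 - z \<noteq> 0" "of_real z1 + z \<noteq> 0" "of_real z2 + z \<noteq> 0"
    using slit_nz[OF assms(4)] by auto
  have "of_real (\<alpha> i) - z\<^sup>2 \<noteq> 0" if "i \<in> {1..m}" for i
    using slit_square[OF assms(4), of "\<alpha> i"] assms(1) that by fastforce
  hence pr: "(\<Prod>i=1..m. (of_real (\<alpha> i) - z\<^sup>2) powr of_real (r i)) = (\<Prod>i=1..m. exp (of_real (r i) * Ln (of_real (\<alpha> i) - z\<^sup>2)))"
    by (intro prod.cong refl) (simp add: powr_def)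
  have pq: "p' = p + 2 * k" "q' = q + 2 * k" using assms(2,3) by auto
  define L1 L2 L3 L4 where "L1 = Ln (of_real z1 - z)" and "L2 = Ln (of_real z2 - z)" 
    and "L3 = Ln (of_real z1 + z)" and "L4 = Ln (of_real z2 + z)"
  have "exp (of_real p * L1) * exp (of_real p' * L3) * exp (of_real q * L2) * exp (of_real q' * L4) * exp ((of_real k + s) * (L1 + L2 - L3 - L4))
     = exp (of_real (p + k) * (L1 + L3) + of_real (q + k) * (L2 + L4)) * exp (s * (L1 + L2 - L3 - L4))"
    unfolding mult_exp_exp pq by (rule arg_cong[of _ _ exp]) (simp add: algebra_simps)
  thus ?thesis
    unfolding h_fun_def even_weight_def f_fun_def pr using n
    by (simp add: powr_def flip: L1_def L2_def L3_def L4_def) (simp only: mult_ac)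
qed

end

theorem mainTheorem2:
  fixes z1 z2 p p' q q' c :: real and m :: nat and \<alpha> r :: "nat \<Rightarrow> real"
    and H :: "nat \<Rightarrow> complex poly" and x :: real
  assumes "0 < z1" and "z1 < z2"
    and "\<forall>i\<in>{1..m}. \<alpha> i > z1\<^sup>2"
    and "p' - p = 2 * c" and "q' - q = 2 * c"
    and "gen_polys (h_fun z1 z2 p p' q q' m \<alpha> r) (f_fun z1 z2) H"
    and "0 < x" and "x < T_end z1 z2"
  shows "\<exists>L :: real \<Rightarrow> real.
           (\<forall>\<^sub>F \<epsilon> in at_right 0. (\<lambda>n. real (zero_count H c n \<epsilon> x) / real n) \<longlonglongrightarrow> L \<epsilon>) \<and>
           ((\<lambda>\<epsilon>. 1 / \<epsilon> * L \<epsilon>) \<longlongrightarrow>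
              1 / pi * ln (cmod (((of_real z1 + zeta z1 z2 x) * (of_real z2 + zeta z1 z2 x)) /
                                 ((of_real z1 - zeta z1 z2 x) * (of_real z2 - zeta z1 z2 x)))))
             (at_right 0)"
proof -
  interpret two_radii z1 z2 using assms(1,2) by unfold_locales
  define h where "h = h_fun z1 z2 p p' q q' m \<alpha> r"
  define G where "G = even_weight z1 z2 (p + c) (q + c) m \<alpha> r"
  have G: "G holomorphic_on Dsym" "\<And>z. z \<in> Dsym \<Longrightarrow> G (- cnj z) = cnj (G z)" "\<And>z. G z \<noteq> 0"
    unfolding G_def using even_weight_facts[OF assms(3)] by auto
  have near0: "\<forall>\<^sub>F z in nhds 0. z \<in> Dsym"
    using open_Dsym z1_pos by (intro eventually_nhds_in_open) (auto simp: Dsym_def)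
  have exps: "(\<lambda>z. G z * exp (s * f_fun z1 z2 z)) has_fps_expansion Abs_fps (\<lambda>k. poly (H k) (of_real c + s) / fact k)" for s
  proof -
    have "(\<lambda>z. h z * exp ((of_real c + s) * f_fun z1 z2 z)) has_fps_expansion Abs_fps (\<lambda>k. poly (H k) (of_real c + s) / fact k)"
      using assms(6) by (simp add: gen_polys_def h_def)
    moreover have "\<forall>\<^sub>F z in nhds 0. h z * exp ((of_real c + s) * f_fun z1 z2 z) = G z * exp (s * f_fun z1 z2 z)"
      using near0 by eventually_elim (simp add: h_def G_def h_times_exp[OF assms(3-5)])
    ultimately show ?thesis using has_fps_expansion_cong[OF _ refl] by fast
  qed
  define e where "e n u = poly (H n) (of_real c + \<i> * of_nat n * of_real u) / fact n" for n and u :: real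
  have e: "\<exists>A. (\<lambda>z. G z * exp (\<i> * of_nat n * of_real u * f_fun z1 z2 z)) has_fps_expansion A \<and> A $ n = e n u" for n u
    using exps[of "\<i> * of_nat n * of_real u"] by (intro exI[of _ "Abs_fps (\<lambda>k. poly (H k) (of_real c + \<i> * of_nat n * of_real u) / fact k)"]) (simp add: e_def)
  have cont: "continuous_on UNIV (e n)" for n unfolding e_def by (intro continuous_intros) auto
  have e0: "e n u = 0 \<longleftrightarrow> poly (H n) (of_real c + \<i> * of_real (real n) * of_real u) = 0" for n u by (simp add: e_def)
  \<comment> \<open>For n = 0 the point c + i n u does not depend on u, so e 0 is constant and its
    zero set is empty or the whole line.\<close>
  have fin: "finite {u. e n u = 0} \<or> (\<forall>u. e n u = 0)" for n
  proof (cases "n = 0 \<or> H n = 0")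
    case True
    thus ?thesis by (cases "e n 0 = 0") (auto simp: e_def)
  next
    case False
    thus ?thesis unfolding e0 using card_line_zeros_le(1)[of "H n" "real n"] by auto
  qed
  \<comment> \<open>h is analytic at 0 because it equals G e^(- c f) on \<open>Dsym\<close>.\<close>
  have analytic: "h analytic_on {0}" "f_fun z1 z2 analytic_on {0}" "f_fun z1 z2 0 = 0"
  proof -
    have "(\<lambda>z. G z * exp (- of_real c * f_fun z1 z2 z)) holomorphic_on Dsym"
      by (intro holomorphic_intros G holomorphic_f)
    moreover have "G z * exp (- of_real c * f_fun z1 z2 z) = h z" if "z \<in> Dsym" for z
      using h_times_exp[OF assms(3-5) that, of r "- of_real c"] by (simp add: h_def G_def)
    ultimately have "h holomorphic_on Dsym" by (rule holomorphic_transform)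
    moreover have "0 \<in> Dsym" using z1_pos by (simp add: Dsym_def)
    ultimately show "h analytic_on {0}" "f_fun z1 z2 analytic_on {0}"
      using holomorphic_f open_Dsym by (auto simp: analytic_at)
    show "f_fun z1 z2 0 = 0" by (simp add: f_fun_def)
  qed
  have card: "card {u. e n u = 0} \<le> n" if fin': "finite {u. e n u = 0}" for n
  proof (cases "n = 0 \<or> H n = 0")
    case True
    have "{u. e n u = 0} = {} \<or> {u. e n u = 0} = UNIV" using True by (cases "e n 0 = 0") (auto simp: e_def)
    thus ?thesis using fin' infinite_UNIV_char_0[where 'a = real] by auto
  next
    case False
    have "degree (H n) \<le> n" using degree_gen_polys_le[OF assms(6)] analytic by (simp add: h_def)
    thus ?thesis unfolding e0 using card_line_zeros_le(2)[of "H n" "real n" c] False by simp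
  qed
  \<comment> \<open>G is even and f is odd, so replacing z by - z exchanges u and - u and multiplies
    the n-th coefficient by (- 1)^n.\<close>
  have sym: "e n (- u) = 0" if "e n u = 0" for n u
  proof -
    have "((\<lambda>z. G z * exp (\<i> * of_nat n * of_real u * f_fun z1 z2 z)) \<circ> (\<lambda>z. - z)) has_fps_expansion
       (Abs_fps (\<lambda>k. poly (H k) (of_real c + \<i> * of_nat n * of_real u) / fact k) oo (- fps_X))"
      by (intro has_fps_expansion_compose exps) (auto intro!: fps_expansion_intros)
    moreover have "(\<lambda>z. G z * exp (\<i> * of_nat n * of_real u * f_fun z1 z2 z)) \<circ> (\<lambda>z. - z) =
       (\<lambda>z. G z * exp (\<i> * of_nat n * of_real (- u) * f_fun z1 z2 z))"
      by (auto simp: fun_eq_iff G_def even_weight_def f_minus add.commute)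
    ultimately have "Abs_fps (\<lambda>k. poly (H k) (of_real c + \<i> * of_nat n * of_real u) / fact k) oo (- fps_X) =
       Abs_fps (\<lambda>k. poly (H k) (of_real c + \<i> * of_nat n * of_real (- u)) / fact k)"
      using exps[of "\<i> * of_nat n * of_real (- u)"] by (auto intro: fps_expansion_unique_complex)
    from arg_cong[OF this, of "\<lambda>A. A $ n"] have "(- 1) ^ n * e n u = e n (- u)"
      by (simp add: e_def fps_compose_uminus')
    thus ?thesis using that by auto
  qed
  define L where "L \<epsilon> = Theta (x + \<epsilon>) - Theta x" for \<epsilon>
  have "\<forall>\<^sub>F \<epsilon> in at_right 0. (\<lambda>n. real (zero_count H c n \<epsilon> x) / real n) \<longlonglongrightarrow> L \<epsilon>"
  proof (rule eventually_mono)
    show "\<forall>\<^sub>F \<epsilon> in at_right 0. \<epsilon> \<in> {0<..<T_end z1 z2 - x}"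
      using assms(8) by (intro eventually_at_right_real) simp
    fix \<epsilon> assume "\<epsilon> \<in> {0<..<T_end z1 z2 - x}"
    hence "(\<lambda>n. real (card ({u. e n u = 0} \<inter> {x<..<x + \<epsilon>})) / real n) \<longlonglongrightarrow> L \<epsilon>"
      unfolding L_def using assms(7) by (intro zero_count_limit[OF G(1,2) _ e cont fin card sym] G(3)) auto
    moreover have "zero_count H c n \<epsilon> x = card ({u. e n u = 0} \<inter> {x<..<x + \<epsilon>})" for n
      unfolding zero_count_def by (rule arg_cong[of _ _ card]) (auto simp: e_def)
    ultimately show "(\<lambda>n. real (zero_count H c n \<epsilon> x) / real n) \<longlonglongrightarrow> L \<epsilon>" by simp
  qed
  moreover have "((\<lambda>\<epsilon>. 1 / \<epsilon> * L \<epsilon>) \<longlongrightarrow> dens x) (at_right 0)"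
    unfolding L_def by (rule Theta_right_derivative[OF assms(7,8)])
  ultimately show ?thesis unfolding dens_eq[OF assms(7)] by blast
qed

end
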